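(* Let $(V,p)$ be an irreducible Markov chain on a finite state space $V$ whose transition function has symmetric support, and let $d$ be a general path distance on $V$ with respect to the induced graph $G$. The following are equivalent: (i) $G$ has non-negative Ollivier curvature and $\beta_1(M_2(G))=\deg_{\max}/2$; (ii) there exist an abelian group structure $\cdot$ on $V$ and a generating set $\{a_1,\dots,a_m\}$ with $a_i\ne a_j^{\varepsilon}$ for all $i\ne j$, $\varepsilon\in\{-1,1\}$, such that (a) $p(x,y)>0$ iff $y\in\{a_i^{\varepsilon}\cdot x: i=1,\dots,m,\ \varepsilon\in\{-1,1\}\}$, for all $x,y\in V$; (b) for every $i$ there is $c_i\in\mathbb R$ with $p(x,a_i x)d(x,a_i x)-p(x,a_i^{-1}x)d(x,a_i^{-1}x)=c_i$ for all $x\in V$; (c) $p(x,a_i^{\varepsilon_1}x)=p(a_j^{\varepsilon_2}x,a_i^{\varepsilon_1}a_j^{\varepsilon_2}x)$ for all $x\in V$, $i\ne j$, $\varepsilon_1,\varepsilon_2\in\{-1,1\}$; (d) $d(x,a_i x)=d(a_j x,a_j a_i x)$ for all $x\in V$, $i\ne j$; (e) $\beta_1(M_2(G))=m$.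
   Context: A Markov chain $(V,p)$: $p:V\times V\to[0,1]$ with $\sum_yp(x,y)=1$; irreducible; symmetric support ($p(x,y)>0$ iff $p(y,x)>0$). Induced graph: $x\sim y$ iff $x\ne y$ and $p(x,y)>0$; $\deg(x)=|\{y:y\sim x\}|$, $\deg_{\max}=\max_x\deg(x)$. A general path distance is symmetric $d$ with $d(x,y)=0$ iff $x=y$ and $d(x,y)=\inf\{\sum_kd(x_{k-1},x_k):x=x_0\sim\dots\sim x_n=y\}$. Laplacian $\Delta f(x)=\sum_yp(x,y)(f(y)-f(x))$; $\nabla_{xy}f=(f(x)-f(y))/d(x,y)$; Ollivier curvature $\kappa(x,y)=\inf\{\nabla_{xy}\Delta f:\nabla_{yx}f=1,\sup_{u\ne v}|\nabla_{uv}f|=1\}$; non-negative means $\kappa\ge0$ on all edges. $M_2(G)$: 1-forms antisymmetric on ordered adjacent pairs; cycles $(x_0\sim\dots\sim x_{n-1})$ of distinct vertices, $n\ge3$, $x_{n-1}\sim x_0$, up to rotation/reversal; $X_2$ = cycles admitting a labeling with $n=3$, or $d(x_0,x_3)<d(x_0,x_1)+d(x_1,x_2)+d(x_2,x_3)$ and $x_3\sim\dots\sim x_{n-1}\sim x_0$ a geodesic; $\delta\alpha(c)=\sum_i\alpha(x_i,x_{i+1\bmod n})$; $\delta_0f(x,y)=f(x)-f(y)$; $\beta_1(M_2(G))=\dim(\ker\delta_1/\operatorname{Im}\delta_0)$, $\ker\delta_1=\{\alpha:\delta\alpha=0\text{ on }X_2\}$.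
   Formalization: Condition (a) is required only for x ≠ y, since the chain may be lazy (p(x,x) > 0): read literally at x = y it fails, e.g. for the lazy walk on a 6-cycle, where (i) holds but (a) would force the identity among the a_i. *)

theory Defs
  imports "HOL-Analysis.Analysis" "HOL-Algebra.Generated_Groups"
begin

section \<open>Markov chains and their induced graphs\<close>

definition markov_chain :: "('v::finite \<Rightarrow> 'v \<Rightarrow> real) \<Rightarrow> bool" where
  "markov_chain p \<longleftrightarrow> (\<forall>x y. 0 \<le> p x y \<and> p x y \<le> 1) \<and> (\<forall>x. (\<Sum>y\<in>UNIV. p x y) = 1)"

primrec transition_power :: "('v::finite \<Rightarrow> 'v \<Rightarrow> real) \<Rightarrow> nat \<Rightarrow> 'v \<Rightarrow> 'v \<Rightarrow> real" where
  "transition_power p 0 x y = (if x = y then 1 else 0)"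
| "transition_power p (Suc n) x y = (\<Sum>z\<in>UNIV. p x z * transition_power p n z y)"

definition irreducible_chain :: "('v::finite \<Rightarrow> 'v \<Rightarrow> real) \<Rightarrow> bool" where
  "irreducible_chain p \<longleftrightarrow> (\<forall>x y. \<exists>n. 0 < transition_power p n x y)"

definition symmetric_support :: "('v \<Rightarrow> 'v \<Rightarrow> real) \<Rightarrow> bool" where
  "symmetric_support p \<longleftrightarrow> (\<forall>x y. 0 < p x y \<longleftrightarrow> 0 < p y x)"

text \<open>Laziness (\<open>p x x > 0\<close>) is allowed, but never gives a loop of the induced graph.\<close>

definition adj :: "('v \<Rightarrow> 'v \<Rightarrow> real) \<Rightarrow> 'v \<Rightarrow> 'v \<Rightarrow> bool" where
  "adj p x y \<longleftrightarrow> x \<noteq> y \<and> 0 < p x y"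

definition vdeg :: "('v::finite \<Rightarrow> 'v \<Rightarrow> real) \<Rightarrow> 'v \<Rightarrow> nat" where
  "vdeg p x = card {y. adj p y x}"

definition deg_max :: "('v::finite \<Rightarrow> 'v \<Rightarrow> real) \<Rightarrow> nat" where
  "deg_max p = Max (range (vdeg p))"


section \<open>Path distances\<close>

text \<open>A path \<open>x\<^sub>0 \<sim> \<dots> \<sim> x\<^sub>n\<close> is the list of its \<open>n + 1\<close> vertices; \<open>n = 0\<close> is allowed.\<close>

definition is_path :: "('v \<Rightarrow> 'v \<Rightarrow> real) \<Rightarrow> 'v list \<Rightarrow> bool" where
  "is_path p xs \<longleftrightarrow> xs \<noteq> [] \<and> successively (adj p) xs"

definition path_length :: "('v \<Rightarrow> 'v \<Rightarrow> real) \<Rightarrow> 'v list \<Rightarrow> real" where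
  "path_length d xs = (\<Sum>k<length xs - 1. d (xs ! k) (xs ! Suc k))"

definition general_path_distance ::
    "('v \<Rightarrow> 'v \<Rightarrow> real) \<Rightarrow> ('v \<Rightarrow> 'v \<Rightarrow> real) \<Rightarrow> bool" where
  "general_path_distance p d \<longleftrightarrow>
     (\<forall>x y. 0 \<le> d x y) \<and>
     (\<forall>x y. d x y = d y x) \<and>
     (\<forall>x y. d x y = 0 \<longleftrightarrow> x = y) \<and>
     (\<forall>x y. d x y = Inf {path_length d xs | xs. is_path p xs \<and> hd xs = x \<and> last xs = y})"

definition is_geodesic ::
    "('v \<Rightarrow> 'v \<Rightarrow> real) \<Rightarrow> ('v \<Rightarrow> 'v \<Rightarrow> real) \<Rightarrow> 'v list \<Rightarrow> bool" where
  "is_geodesic p d xs \<longleftrightarrow> is_path p xs \<and> path_length d xs = d (hd xs) (last xs)"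


section \<open>Ollivier curvature\<close>

definition laplacian :: "('v::finite \<Rightarrow> 'v \<Rightarrow> real) \<Rightarrow> ('v \<Rightarrow> real) \<Rightarrow> 'v \<Rightarrow> real" where
  "laplacian p f x = (\<Sum>y\<in>UNIV. p x y * (f y - f x))"

definition grad :: "('v \<Rightarrow> 'v \<Rightarrow> real) \<Rightarrow> 'v \<Rightarrow> 'v \<Rightarrow> ('v \<Rightarrow> real) \<Rightarrow> real" where
  "grad d x y f = (f x - f y) / d x y"

definition ollivier_curvature ::
    "('v::finite \<Rightarrow> 'v \<Rightarrow> real) \<Rightarrow> ('v \<Rightarrow> 'v \<Rightarrow> real) \<Rightarrow> 'v \<Rightarrow> 'v \<Rightarrow> real" where
  "ollivier_curvature p d x y =
     Inf {grad d x y (laplacian p f) | f.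
            grad d y x f = 1 \<and> Sup {\<bar>grad d u v f\<bar> | u v. u \<noteq> v} = 1}"

definition nonneg_ollivier_curvature ::
    "('v::finite \<Rightarrow> 'v \<Rightarrow> real) \<Rightarrow> ('v \<Rightarrow> 'v \<Rightarrow> real) \<Rightarrow> bool" where
  "nonneg_ollivier_curvature p d \<longleftrightarrow> (\<forall>x y. adj p x y \<longrightarrow> 0 \<le> ollivier_curvature p d x y)"


section \<open>The complex \<open>M\<^sub>2(G)\<close> and its first Betti number\<close>

text \<open>A 1-form on the ordered adjacent pairs is a matrix that vanishes on all other pairs.\<close>

definition one_forms :: "('v::finite \<Rightarrow> 'v \<Rightarrow> real) \<Rightarrow> (real^'v^'v) set" where
  "one_forms p = {\<alpha>. (\<forall>x y. adj p x y \<longrightarrow> \<alpha> $ x $ y = - \<alpha> $ y $ x) \<and>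
                      (\<forall>x y. \<not> adj p x y \<longrightarrow> \<alpha> $ x $ y = 0)}"

text \<open>
  A list is one labeling of a cycle; the cycle itself is the class of the list under
  \<open>same_cycle\<close>. Changing the labeling changes \<open>delta1\<close> at most by a sign.
\<close>

definition is_cycle :: "('v \<Rightarrow> 'v \<Rightarrow> real) \<Rightarrow> 'v list \<Rightarrow> bool" where
  "is_cycle p xs \<longleftrightarrow>
     3 \<le> length xs \<and> distinct xs \<and> successively (adj p) xs \<and> adj p (last xs) (hd xs)"

definition same_cycle :: "'v list \<Rightarrow> 'v list \<Rightarrow> bool" where
  "same_cycle xs ys \<longleftrightarrow> (\<exists>k. ys = rotate k xs \<or> ys = rotate k (rev xs))"

definition X2 :: "('v \<Rightarrow> 'v \<Rightarrow> real) \<Rightarrow> ('v \<Rightarrow> 'v \<Rightarrow> real) \<Rightarrow> 'v list set" where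
  "X2 p d = {ys. is_cycle p ys \<and> (\<exists>xs. same_cycle ys xs \<and>
     (length xs = 3 \<or>
      4 \<le> length xs \<and>
      d (xs ! 0) (xs ! 3) < d (xs ! 0) (xs ! 1) + d (xs ! 1) (xs ! 2) + d (xs ! 2) (xs ! 3) \<and>
      is_geodesic p d (drop 3 xs @ [xs ! 0])))}"

definition delta0 :: "('v::finite \<Rightarrow> 'v \<Rightarrow> real) \<Rightarrow> ('v \<Rightarrow> real) \<Rightarrow> real^'v^'v" where
  "delta0 p f = (\<chi> x y. if adj p x y then f x - f y else 0)"

definition delta1 :: "real^'v^'v \<Rightarrow> 'v::finite list \<Rightarrow> real" where
  "delta1 \<alpha> xs = (\<Sum>i<length xs. \<alpha> $ (xs ! i) $ (xs ! (Suc i mod length xs)))"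

definition ker_delta1 ::
    "('v::finite \<Rightarrow> 'v \<Rightarrow> real) \<Rightarrow> ('v \<Rightarrow> 'v \<Rightarrow> real) \<Rightarrow> (real^'v^'v) set" where
  "ker_delta1 p d = {\<alpha> \<in> one_forms p. \<forall>xs\<in>X2 p d. delta1 \<alpha> xs = 0}"

definition im_delta0 :: "('v::finite \<Rightarrow> 'v \<Rightarrow> real) \<Rightarrow> (real^'v^'v) set" where
  "im_delta0 p = range (delta0 p)"

text \<open>
  For subspaces \<open>U \<subseteq> W\<close>, the cosets of the elements of \<open>B\<close> form a basis of \<open>W / U\<close>.
  Independence modulo \<open>U\<close> forces these cosets to be pairwise distinct.
\<close>

definition quotient_basis :: "'a::real_vector set \<Rightarrow> 'a set \<Rightarrow> 'a set \<Rightarrow> bool" where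
  "quotient_basis W U B \<longleftrightarrow>
     finite B \<and> B \<subseteq> W \<and>
     (\<forall>c. (\<Sum>b\<in>B. c b *\<^sub>R b) \<in> U \<longrightarrow> (\<forall>b\<in>B. c b = 0)) \<and>
     (\<forall>w\<in>W. \<exists>c. w - (\<Sum>b\<in>B. c b *\<^sub>R b) \<in> U)"

definition quotient_dim :: "'a::real_vector set \<Rightarrow> 'a set \<Rightarrow> nat" where
  "quotient_dim W U = (THE n. \<exists>B. quotient_basis W U B \<and> card B = n)"

lemma quotient_basis_card:
  fixes W U :: "'a::euclidean_space set"
  assumes W: "subspace W" and U: "subspace U" and UW: "U \<subseteq> W" and B: "quotient_basis W U B"
  shows "card B = dim W - dim U"
proof -
  obtain C where C: "C \<subseteq> U" "independent C" "U \<subseteq> span C" "card C = dim U"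
    using basis_exists by blast
  have finC: "finite C" using C(2) independent_imp_finite by blast
  have sC: "span C = U" using C U by (metis span_minimal subset_antisym)
  have fB: "finite B" "B \<subseteq> W" using B by (auto simp: quotient_basis_def)
  have ind: "\<And>c. (\<Sum>b\<in>B. c b *\<^sub>R b) \<in> U \<Longrightarrow> \<forall>b\<in>B. c b = 0"
    and sp: "\<And>w. w \<in> W \<Longrightarrow> \<exists>c. w - (\<Sum>b\<in>B. c b *\<^sub>R b) \<in> U"
    using B by (auto simp: quotient_basis_def)
  have disj: "B \<inter> C = {}"
  proof (rule ccontr)
    assume "B \<inter> C \<noteq> {}"
    then obtain b where b: "b \<in> B" "b \<in> C" by blast
    have "(\<Sum>x\<in>B. (if x = b then 1 else 0) *\<^sub>R x) = b"
      using b fB by (simp add: if_distrib[of "\<lambda>c. c *\<^sub>R _"] sum.delta cong: if_cong)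
    then have "\<forall>x\<in>B. (if x = b then 1 else 0 :: real) = 0"
      using b C(1) by (intro ind) auto
    then show False using b by auto
  qed
  have "independent (B \<union> C)"
  proof (rule independent_if_scalars_zero)
    fix f x assume s: "(\<Sum>x\<in>B \<union> C. f x *\<^sub>R x) = 0" and x: "x \<in> B \<union> C"
    have e: "(\<Sum>x\<in>B. f x *\<^sub>R x) + (\<Sum>x\<in>C. f x *\<^sub>R x) = 0"
      using s disj fB finC by (simp add: sum.union_disjoint)
    have cU: "(\<Sum>x\<in>C. f x *\<^sub>R x) \<in> U"
      using C(1) U by (intro subspace_sum) (auto intro: subspace_scale)
    have "(\<Sum>x\<in>B. f x *\<^sub>R x) = - (\<Sum>x\<in>C. f x *\<^sub>R x)" using e by (simp add: add_eq_0_iff2)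
    hence "(\<Sum>x\<in>B. f x *\<^sub>R x) \<in> U" using cU U by (simp add: subspace_neg)
    hence z: "\<forall>b\<in>B. f b = 0" by (rule ind)
    hence "(\<Sum>x\<in>C. f x *\<^sub>R x) = 0" using e by simp
    hence "\<forall>b\<in>C. f b = 0" using independentD[OF C(2) finC subset_refl, of f] by blast
    with z x show "f x = 0" by blast
  qed (use fB finC in simp)
  moreover have "W \<subseteq> span (B \<union> C)"
  proof
    fix w assume "w \<in> W"
    then obtain c where c: "w - (\<Sum>b\<in>B. c b *\<^sub>R b) \<in> span C" using sp sC by blast
    have "(\<Sum>b\<in>B. c b *\<^sub>R b) \<in> span (B \<union> C)"
      by (intro span_sum span_scale span_base) auto
    moreover have "w - (\<Sum>b\<in>B. c b *\<^sub>R b) \<in> span (B \<union> C)"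
      using c span_mono[of C "B \<union> C"] by auto
    ultimately show "w \<in> span (B \<union> C)" using span_add by fastforce
  qed
  moreover have "B \<union> C \<subseteq> W" using fB C UW by auto
  ultimately have "dim W = card (B \<union> C)" using basis_card_eq_dim by metis
  also have "\<dots> = card B + card C" using disj fB finC by (simp add: card_Un_disjoint)
  finally show ?thesis using C by simp
qed

lemma quotient_basis_exists:
  fixes W U :: "'a::euclidean_space set"
  assumes W: "subspace W" and U: "subspace U" and UW: "U \<subseteq> W"
  shows "\<exists>B. quotient_basis W U B"
proof -
  obtain C where C: "C \<subseteq> U" "independent C" "U \<subseteq> span C" "card C = dim U"
    using basis_exists by blast
  have sC: "span C = U" using C U by (metis span_minimal subset_antisym)
  have "C \<subseteq> W" using C UW by auto
  then obtain D where D: "C \<subseteq> D" "D \<subseteq> W" "independent D" "W \<subseteq> span D"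
    using maximal_independent_subset_extend[OF _ C(2)] by metis
  have finD: "finite D" using D(3) independent_imp_finite by blast
  have finC: "finite C" using D(1) finD finite_subset by blast
  have DC: "D = (D - C) \<union> C" using D by auto
  have split: "(\<Sum>x\<in>D. g x *\<^sub>R x) = (\<Sum>x\<in>D-C. g x *\<^sub>R x) + (\<Sum>x\<in>C. g x *\<^sub>R x)" for g
    using sum.subset_diff[OF D(1) finD] by blast
  have "quotient_basis W U (D - C)"
    unfolding quotient_basis_def
  proof (intro conjI allI impI ballI)
    show "finite (D - C)" "D - C \<subseteq> W" using finD D by auto
  next
    fix c b assume s: "(\<Sum>b\<in>D - C. c b *\<^sub>R b) \<in> U" and b: "b \<in> D - C"
    then obtain u where u: "(\<Sum>b\<in>D - C. c b *\<^sub>R b) = (\<Sum>v\<in>C. u v *\<^sub>R v)"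
      using span_finite[OF finC] sC by auto
    define g where "g x = (if x \<in> C then - u x else c x)" for x
    have "(\<Sum>x\<in>D-C. g x *\<^sub>R x) = (\<Sum>x\<in>D-C. c x *\<^sub>R x)" by (rule sum.cong) (auto simp: g_def)
    moreover have "(\<Sum>x\<in>C. g x *\<^sub>R x) = - (\<Sum>x\<in>C. u x *\<^sub>R x)"
      by (simp add: g_def sum_negf)
    ultimately have "(\<Sum>x\<in>D. g x *\<^sub>R x) = 0" using split[of g] u by simp
    then have "g b = 0" using independentD[OF D(3) finD subset_refl, of g b] b by blast
    then show "c b = 0" using b by (simp add: g_def)
  next
    fix w assume "w \<in> W"
    then have "w \<in> span D" using D by auto
    then obtain u where u: "w = (\<Sum>v\<in>D. u v *\<^sub>R v)" using span_finite[OF finD] by auto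
    have "(\<Sum>x\<in>C. u x *\<^sub>R x) \<in> U"
      using C(1) U by (intro subspace_sum) (auto intro: subspace_scale)
    then show "\<exists>c. w - (\<Sum>b\<in>D - C. c b *\<^sub>R b) \<in> U"
      using u split[of u] by (intro exI[of _ u]) simp
  qed
  then show ?thesis by blast
qed

lemma quotient_dim_eq:
  fixes W U :: "'a::euclidean_space set"
  assumes "subspace W" "subspace U" "U \<subseteq> W"
  shows "quotient_dim W U = dim W - dim U"
  unfolding quotient_dim_def
  using quotient_basis_card[OF assms] quotient_basis_exists[OF assms]
  by (intro the_equality) blast+

definition betti1 :: "('v::finite \<Rightarrow> 'v \<Rightarrow> real) \<Rightarrow> ('v \<Rightarrow> 'v \<Rightarrow> real) \<Rightarrow> nat" where
  "betti1 p d = quotient_dim (ker_delta1 p d) (im_delta0 p)"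

end

theory Submission
  imports Defs
begin

text \<open>
  Every class in \<open>ker \<delta>\<^sub>1 / im \<delta>\<^sub>0\<close> has a unique representative \<open>\<alpha>\<close> of constant divergence, so
  \<open>\<beta>\<^sub>1\<close> is the dimension of the space \<open>H\<close> of these harmonic forms. The cycles in \<open>X\<^sub>2\<close> are just those
  needed for \<open>\<alpha>\<close> to have a Lipschitz primitive around an edge. By nonnegative curvature the heat flow
  does not increase the maximum norm of \<open>\<alpha>(x,y) / d(x,y)\<close>; hence a harmonic form minimises this norm
  in its class, its norm-attaining edges contain a directed cycle, and transport along this cycle
  produces such an edge at every vertex. So the unit ball dual to the norm of \<open>H\<close> is the convex hull
  of the edge functionals at any single vertex. It is symmetric, which gives \<open>2 \<beta>\<^sub>1 \<le> deg x\<close>; in the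
  case of equality the edge functionals at every vertex are \<open>\<plusminus>b\<^sub>1, \<dots>, \<plusminus>b\<^sub>m\<close> for a fixed basis
  of \<open>H\<close>, and following the edge labelled \<open>b\<^sub>i\<close> defines commuting permutations of the vertices,
  which generate a regular abelian group. Conversely, on such a Cayley graph the curvature can be
  estimated by translating the neighbours of \<open>x\<close> to those of \<open>a\<^sub>i x\<close>.
\<close>

section \<open>Paths and geodesics\<close>

text \<open>Curvature is a statement about functions, but a closed form need not be exact. The way
  out is locality: the Laplacians at the two ends of an edge x y see only x, y and their neighbours,
  and any two of these points are joined by a walk of at most three edges through x and y. This is
  why \<open>X2\<close> compares three leading edges with the distance of their ends: the integral
  along such a walk becomes the integral along some geodesic, hence at most the distance if the norm
  is at most 1. Constant rather than zero divergence is forced because p is not assumed reversible: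
  the range of the Laplacian is a complement of the constants, so an exact form can correct a
  divergence only up to a constant. The constants in (b) are the divergences of the forms dual to
  the edge functionals. A second obstacle is that edge lengths vary: transport might send one edge
  to a chain of several shorter ones, so commutation of the translations needs a count of edges
  besides the transport.\<close>

lemma path_length_single [simp]: "path_length w [x] = 0"
  by (simp add: path_length_def)

lemma path_length_Cons [simp]: "path_length w (x # y # zs) = w x y + path_length w (y # zs)"
  unfolding path_length_def by (simp add: sum.lessThan_Suc_shift del: sum.lessThan_Suc)

lemma path_length_append:
  "path_length w (xs @ x # ys) = path_length w (xs @ [x]) + path_length w (x # ys)"
proof (induction xs)
  case (Cons a xs)
  then show ?case by (cases xs) auto
qed simp

text \<open>\<open>path_length\<close> makes sense for any weight, so with weight \<alpha> it is a
  line integral. Appending the head closes the walk and replaces the index modulo the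
  length.\<close>

lemma delta1_eq_path_length:
  assumes "xs \<noteq> []"
  shows "delta1 \<alpha> xs = path_length (\<lambda>u v. \<alpha> $ u $ v) (xs @ [hd xs])"
  unfolding delta1_def path_length_def
proof (rule sum.cong)
  fix i assume "i \<in> {..<length (xs @ [hd xs]) - 1}"
  then have i: "i < length xs" by simp
  show "\<alpha> $ (xs ! i) $ (xs ! (Suc i mod length xs))
      = \<alpha> $ ((xs @ [hd xs]) ! i) $ ((xs @ [hd xs]) ! Suc i)"
    using i assms by (cases "Suc i = length xs") (auto simp: nth_append hd_conv_nth)
qed simp

locale path_metric_chain =
  fixes p :: "'v::finite \<Rightarrow> 'v \<Rightarrow> real" and d :: "'v \<Rightarrow> 'v \<Rightarrow> real"
  assumes markov: "markov_chain p"
    and irred: "irreducible_chain p"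
    and symm: "symmetric_support p"
    and dist: "general_path_distance p d"
begin

lemma p_nonneg [simp]: "0 \<le> p x y"
  and p_sum: "(\<Sum>y\<in>UNIV. p x y) = 1"
  using markov by (auto simp: markov_chain_def)

lemma adj_sym: "adj p x y \<longleftrightarrow> adj p y x"
  using symm by (auto simp: adj_def symmetric_support_def)

lemma not_adj_refl [simp]: "\<not> adj p x x"
  by (simp add: adj_def)

lemma p_eq_0: "\<not> adj p x y \<Longrightarrow> x \<noteq> y \<Longrightarrow> p x y = 0"
  using p_nonneg[of x y] unfolding adj_def by linarith

lemma d_nonneg [simp]: "0 \<le> d x y"
  and d_sym: "d x y = d y x"
  and d_eq_0 [simp]: "d x y = 0 \<longleftrightarrow> x = y"
  and d_Inf: "d x y = Inf {path_length d xs | xs. is_path p xs \<and> hd xs = x \<and> last xs = y}"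
  using dist unfolding general_path_distance_def by blast+

lemma d_refl [simp]: "d x x = 0"
  by simp

lemma d_pos [simp]: "0 < d x y \<longleftrightarrow> x \<noteq> y"
  using d_nonneg[of x y] d_eq_0[of x y] by linarith

lemma path_length_nonneg: "0 \<le> path_length d xs"
  unfolding path_length_def by (intro sum_nonneg) auto

lemma is_path_Cons: "is_path p (x # y # zs) \<longleftrightarrow> adj p x y \<and> is_path p (y # zs)"
  by (simp add: is_path_def)

lemma is_path_single [simp]: "is_path p [x]"
  by (simp add: is_path_def)

lemma is_path_append:
  "is_path p (xs @ x # ys) \<longleftrightarrow> is_path p (xs @ [x]) \<and> is_path p (x # ys)"
  by (auto simp: is_path_def successively_append_iff)

lemma transition_power_path:
  "0 < transition_power p n x y \<Longrightarrow> \<exists>xs. is_path p xs \<and> hd xs = x \<and> last xs = y"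
proof (induction n arbitrary: x)
  case 0
  then have "x = y" by (simp split: if_splits)
  then show ?case by (intro exI[of _ "[x]"]) simp
next
  case (Suc n)
  have "\<exists>z. 0 < p x z * transition_power p n z y"
  proof (rule ccontr)
    assume "\<not> ?thesis"
    then have "(\<Sum>z\<in>UNIV. p x z * transition_power p n z y) \<le> 0"
      by (intro sum_nonpos) (simp add: not_less)
    then show False using Suc.prems by simp
  qed
  then obtain z where z: "0 < p x z * transition_power p n z y" by blast
  then have z': "0 < p x z" "0 < transition_power p n z y"
    using p_nonneg[of x z] by (auto simp: zero_less_mult_iff)
  obtain xs where xs: "is_path p xs" "hd xs = z" "last xs = y" using Suc.IH[OF z'(2)] by blast
  show ?case
  \<comment> \<open>A lazy step is not an edge of the induced graph and is left out of the
    path.\<close>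
  proof (cases "x = z")
    case True
    then show ?thesis using xs by blast
  next
    case False
    then have "adj p x z" using z' by (simp add: adj_def)
    then have "is_path p (x # xs)" using xs by (cases xs) (auto simp: is_path_def)
    moreover have "last (x # xs) = y" using xs by (auto simp: is_path_def)
    ultimately show ?thesis by (metis list.sel(1))
  qed
qed

lemma path_exists: "\<exists>xs. is_path p xs \<and> hd xs = x \<and> last xs = y"
  using irred transition_power_path unfolding irreducible_chain_def by blast

lemma connected_induct:
  assumes "P x" and "\<And>u v. P u \<Longrightarrow> adj p u v \<Longrightarrow> P v"
  shows "P y"
proof -
  have "is_path p xs \<Longrightarrow> P (hd xs) \<Longrightarrow> P (last xs)" for xs
  proof (induction xs)
    case (Cons a xs)
    then show ?case using assms(2) by (cases xs) (auto simp: is_path_def)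
  qed (simp add: is_path_def)
  then show ?thesis using path_exists[of x y] assms(1) by blast
qed

lemma d_le_path_length: "is_path p xs \<Longrightarrow> d (hd xs) (last xs) \<le> path_length d xs"
  unfolding d_Inf[of "hd xs" "last xs"]
  by (rule cInf_lower) (auto intro!: bdd_belowI[of _ 0] path_length_nonneg)

text \<open>The infimum runs over infinitely many walks, but every edge has at least a fixed
  positive length, so only the finitely many walks with few vertices can compete.\<close>

lemma geodesic_exists: "\<exists>xs. is_geodesic p d xs \<and> hd xs = x \<and> last xs = y"
proof -
  let ?P = "{xs. is_path p xs \<and> hd xs = x \<and> last xs = y}"
  obtain ys where ys: "ys \<in> ?P" using path_exists by blast
  \<comment> \<open>A lower bound for the length of every edge; 1 is inserted because there may be
    just one vertex.\<close>
  define \<delta> where "\<delta> = Min (insert 1 ((\<lambda>(u, v). d u v) ` {(u, v). u \<noteq> v}))"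
  have \<delta>: "0 < \<delta>" "\<And>u v. u \<noteq> v \<Longrightarrow> \<delta> \<le> d u v"
    unfolding \<delta>_def by (subst Min_gr_iff) (auto intro!: Min_le)
  have long: "real (length xs - 1) * \<delta> \<le> path_length d xs" if "is_path p xs" for xs
  proof -
    have "d (xs ! k) (xs ! Suc k) \<ge> \<delta>" if "k < length xs - 1" for k
      using \<open>is_path p xs\<close> that \<delta>(2)
      by (auto simp: is_path_def successively_conv_nth adj_def)
    then have "(\<Sum>k<length xs - 1. \<delta>) \<le> path_length d xs"
      unfolding path_length_def by (intro sum_mono) auto
    then show ?thesis by simp
  qed
  obtain N where N: "path_length d ys < real N * \<delta>"
    using reals_Archimedean3[OF \<delta>(1)] by blast
  define F where "F = {xs \<in> ?P. length xs \<le> N}"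
  have finF: "finite F"
    by (rule finite_subset[OF _ finite_lists_length_le[of UNIV N]]) (auto simp: F_def)
  have rest: "path_length d ys < path_length d xs" if "xs \<in> ?P" "xs \<notin> F" for xs
  proof -
    have "N \<le> length xs - 1" using that by (auto simp: F_def)
    then have "real N * \<delta> \<le> real (length xs - 1) * \<delta>" using \<delta>(1) by simp
    then show ?thesis using long[of xs] that N by simp
  qed
  have ysF: "ys \<in> F" using rest[OF ys] by blast
  obtain zs where zs: "zs \<in> F" "\<And>xs. xs \<in> F \<Longrightarrow> path_length d zs \<le> path_length d xs"
    using ex_min_if_finite[of "path_length d ` F"] finF ysF
    by (metis (no_types, lifting) empty_iff finite_imageI imageE imageI linorder_not_less)
  have least: "path_length d zs \<le> path_length d xs" if "xs \<in> ?P" for xs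
    using zs(2)[of xs] zs(2)[OF ysF] rest[OF that] by fastforce
  have "path_length d zs = d x y"
    unfolding d_Inf[of x y]
    by (rule cInf_eq_minimum[symmetric]) (use zs(1) least in \<open>auto simp: F_def\<close>)
  then show ?thesis using zs(1) by (auto simp: F_def is_geodesic_def)
qed

lemma geodesic_is_path: "is_geodesic p d g \<Longrightarrow> is_path p g"
  by (simp add: is_geodesic_def)

lemma geodesic_not_Nil: "is_geodesic p d g \<Longrightarrow> g \<noteq> []"
  by (auto simp: is_geodesic_def is_path_def)

lemma d_triangle: "d x z \<le> d x y + d y z"
proof -
  obtain g where g: "is_geodesic p d g" "hd g = x" "last g = y" using geodesic_exists by blast
  obtain h where h: "is_geodesic p d h" "hd h = y" "last h = z" using geodesic_exists by blast
  obtain g' where g': "g = g' @ [y]" using g geodesic_not_Nil by (metis append_butlast_last_id)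
  obtain h' where h': "h = y # h'" using h geodesic_not_Nil by (metis list.collapse)
  have P: "is_path p (g' @ y # h')"
    using geodesic_is_path[OF g(1)] geodesic_is_path[OF h(1)] is_path_append[of g' y h']
    unfolding g' h' by blast
  have "hd (g' @ y # h') = x" "last (g' @ y # h') = z"
    using g(2) h(3) unfolding g' h' by (cases g'; simp)+
  then have "d x z \<le> path_length d (g' @ y # h')" using d_le_path_length[OF P] by simp
  also have "\<dots> = path_length d g + path_length d h"
    unfolding g' h' by (rule path_length_append)
  finally show ?thesis using g h by (simp add: is_geodesic_def)
qed

text \<open>Each part is at least as long as the distance of its ends, so by the triangle inequality
  neither can be longer.\<close>

lemma geodesic_append:
  assumes "is_geodesic p d (xs @ x # ys)"
  shows "is_geodesic p d (xs @ [x])" and "is_geodesic p d (x # ys)"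
proof -
  have P: "is_path p (xs @ [x])" "is_path p (x # ys)"
    using geodesic_is_path[OF assms] is_path_append[of xs x ys] by blast+
  let ?u = "hd (xs @ [x])" and ?v = "last (x # ys)"
  have "hd (xs @ x # ys) = ?u" by (cases xs) auto
  moreover have "last (xs @ x # ys) = ?v" by simp
  ultimately have "path_length d (xs @ [x]) + path_length d (x # ys) = d ?u ?v"
    using assms path_length_append[of d xs x ys] unfolding is_geodesic_def by metis
  moreover have "d ?u x \<le> path_length d (xs @ [x])" "d x ?v \<le> path_length d (x # ys)"
    using d_le_path_length[OF P(1)] d_le_path_length[OF P(2)] by auto
  moreover have "d ?u ?v \<le> d ?u x + d x ?v" by (rule d_triangle)
  ultimately show "is_geodesic p d (xs @ [x])" "is_geodesic p d (x # ys)"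
    using P unfolding is_geodesic_def by auto
qed

text \<open>A repeated vertex would cut out a closed geodesic, which has length zero and yet an edge
  of positive length.\<close>

lemma geodesic_distinct:
  assumes "is_geodesic p d g" shows "distinct g"
proof (rule ccontr)
  assume "\<not> distinct g"
  then obtain xs ys zs x where "g = xs @ [x] @ ys @ [x] @ zs"
    using not_distinct_decomp by blast
  then have "is_geodesic p d (x # ys @ [x])"
    using assms geodesic_append(2)[of xs x "ys @ x # zs"] geodesic_append(1)[of "x # ys" x zs]
    by simp
  then have 0: "path_length d (x # ys @ [x]) = 0" and P: "is_path p (x # ys @ [x])"
    by (auto simp: is_geodesic_def)
  obtain y zs where y: "ys @ [x] = y # zs" by (cases ys) auto
  then have "0 < d x y" using P by (auto simp: is_path_def adj_def)
  then show False using 0 path_length_nonneg[of "y # zs"] unfolding y path_length_Cons by linarith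
qed

lemma geodesic_edge:
  assumes "adj p x y" shows "is_geodesic p d [x, y]"
  using assms by (simp add: is_geodesic_def is_path_def)

lemma geodesic_rev:
  assumes "is_geodesic p d g" shows "is_geodesic p d (rev g)"
proof -
  have rl: "path_length d (rev xs) = path_length d xs" for xs
  proof (induction xs)
    case (Cons a xs)
    then show ?case
      using path_length_append[of d "rev (tl xs)" "hd xs" "[a]"] d_sym
      by (cases xs) auto
  qed simp
  have "successively (adj p) (rev g)"
    using assms adj_sym by (simp add: is_geodesic_def is_path_def successively_rev)
  then show ?thesis
    using assms d_sym rl by (auto simp: is_geodesic_def is_path_def hd_rev last_rev)
qed

end

context path_metric_chain
begin

section \<open>Closed forms along short closed walks\<close>

abbreviation line_integral :: "real^'v^'v \<Rightarrow> 'v list \<Rightarrow> real" where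
  "line_integral \<alpha> \<equiv> path_length (\<lambda>u v. \<alpha> $ u $ v)"

abbreviation near :: "'v \<Rightarrow> 'v \<Rightarrow> bool" where
  "near x u \<equiv> x = u \<or> adj p x u"

lemma form_nonadj: "\<alpha> \<in> ker_delta1 p d \<Longrightarrow> \<not> adj p x y \<Longrightarrow> \<alpha> $ x $ y = 0"
  unfolding ker_delta1_def one_forms_def by blast

lemma form_diag [simp]: "\<alpha> \<in> ker_delta1 p d \<Longrightarrow> \<alpha> $ x $ x = 0"
  by (simp add: form_nonadj)

lemma form_antisym:
  assumes "\<alpha> \<in> ker_delta1 p d" shows "\<alpha> $ x $ y = - \<alpha> $ y $ x"
proof (cases "adj p x y")
  case True
  then show ?thesis using assms unfolding ker_delta1_def one_forms_def by blast
next
  case False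
  then show ?thesis using form_nonadj[OF assms] adj_sym[of x y] by simp
qed

lemma cycle_integral_zero:
  assumes \<alpha>: "\<alpha> \<in> ker_delta1 p d" and path: "is_path p (u # c @ [u])" and dist: "distinct (u # c)"
    and c: "length c = 2 \<or> (\<exists>x1 x2 x3 c'. c = x1 # x2 # x3 # c' \<and>
               d u x3 < d u x1 + d x1 x2 + d x2 x3 \<and> is_geodesic p d (x3 # c' @ [u]))"
  shows "line_integral \<alpha> (u # c @ [u]) = 0"
proof -
  have ne: "c \<noteq> []" using c by auto
  have "is_cycle p (u # c)"
    unfolding is_cycle_def
  proof (intro conjI)
    show "3 \<le> length (u # c)" using c by auto
    show "successively (adj p) (u # c)" "adj p (last (u # c)) (hd (u # c))"
      using path ne by (auto simp: is_path_def successively_append_iff successively_Cons)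
  qed (use dist in simp)
  moreover have "same_cycle (u # c) (u # c)"
    unfolding same_cycle_def by (intro exI[of _ 0]) simp
  moreover have "length (u # c) = 3 \<or> 4 \<le> length (u # c) \<and>
      d ((u # c) ! 0) ((u # c) ! 3) < d ((u # c) ! 0) ((u # c) ! 1) + d ((u # c) ! 1) ((u # c) ! 2)
        + d ((u # c) ! 2) ((u # c) ! 3) \<and> is_geodesic p d (drop 3 (u # c) @ [(u # c) ! 0])"
    using c by (auto simp: numeral_3_eq_3 numeral_2_eq_2)
  ultimately have "u # c \<in> X2 p d" unfolding X2_def by blast
  then have "delta1 \<alpha> (u # c) = 0" using \<alpha> by (auto simp: ker_delta1_def)
  then show ?thesis using delta1_eq_path_length[of "u # c" \<alpha>] by simp
qed

lemma geodesic_cases: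
  assumes "is_geodesic p d g" "hd g = v" "last g = u" "u \<noteq> v"
  obtains c where "g = v # c @ [u]" "distinct (v # c @ [u])" "is_path p (v # c @ [u])"
proof -
  obtain g' where g: "g = v # g'" using assms geodesic_not_Nil by (metis list.collapse)
  then have "g' \<noteq> []" using assms by auto
  then obtain c where "g' = c @ [u]" using assms g by (metis append_butlast_last_id last_ConsR)
  then show ?thesis using that g geodesic_distinct assms(1) geodesic_is_path by blast
qed

lemma geodesic_split_length:
  assumes "is_geodesic p d (v # w # c)"
  shows "d v (last (w # c)) = d v w + d w (last (w # c))"
  using assms geodesic_append(2)[of "[v]" w c] by (simp add: is_geodesic_def)

text \<open>Unless the geodesic is very short, the leading three edges demanded by \<open>X2\<close>
  are u v and the first two edges of the geodesic. They are strictly longer than the distance of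
  their ends, because the geodesic leads back towards u.\<close>

lemma edge_geodesic_integral:
  assumes \<alpha>: "\<alpha> \<in> ker_delta1 p d" and uv: "adj p u v"
    and g: "is_geodesic p d g" "hd g = v" "last g = u"
  shows "\<alpha> $ u $ v + line_integral \<alpha> g = 0"
proof -
  have "u \<noteq> v" using uv by auto
  then obtain c where c: "g = v # c @ [u]" "distinct (v # c @ [u])" "is_path p (v # c @ [u])"
    using geodesic_cases g by metis
  have P: "is_path p (u # v # c @ [u])" using uv c(3) by (simp add: is_path_Cons)
  show ?thesis
  proof (cases c)
    case Nil
    then show ?thesis using c form_antisym[OF \<alpha>, of u v] by simp
  next
    case (Cons w c1)
    have "line_integral \<alpha> (u # (v # c) @ [u]) = 0"
    proof (rule cycle_integral_zero[OF \<alpha>])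
      show "is_path p (u # (v # c) @ [u])" "distinct (u # v # c)" using P c by auto
      show "length (v # c) = 2 \<or> (\<exists>x1 x2 x3 c'. v # c = x1 # x2 # x3 # c' \<and>
               d u x3 < d u x1 + d x1 x2 + d x2 x3 \<and> is_geodesic p d (x3 # c' @ [u]))"
      proof (cases c1)
        case Nil
        then show ?thesis using Cons by simp
      next
        case (Cons w' c2)
        note C = \<open>c = w # c1\<close> Cons
        have g1: "is_geodesic p d (v # w # w' # c2 @ [u])" using g c C by simp
        have g2: "is_geodesic p d (w # w' # c2 @ [u])"
          using geodesic_append(2)[of "[v]" w] g1 by simp
        have g3: "is_geodesic p d (w' # c2 @ [u])"
          using geodesic_append(2)[of "[w]" w'] g2 by simp
        have "d v u = d v w + d w u" "d w u = d w w' + d w' u"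
          using geodesic_split_length[OF g1] geodesic_split_length[OF g2] by auto
        moreover have "0 < d v w" "0 < d w w'" using c C by auto
        ultimately have "d u w' < d u v + d v w + d w w'"
          using d_sym[of u v] d_sym[of u w'] by linarith
        then show ?thesis using C g3 by blast
      qed
    qed
    then show ?thesis using c by simp
  qed
qed

text \<open>Now only one leading edge is borrowed from the geodesic. If the geodesic passes through
  x, the closed walk is no cycle, but cutting at x leaves two instances of the single-edge
  case.\<close>

lemma two_edge_geodesic_integral:
  assumes \<alpha>: "\<alpha> \<in> ker_delta1 p d" and ux: "adj p u x" and xv: "adj p x v"
    and g: "is_geodesic p d g" "hd g = v" "last g = u"
  shows "\<alpha> $ u $ x + \<alpha> $ x $ v + line_integral \<alpha> g = 0"
proof (cases "u = v")
  case True
  then have "g = [v]" using g geodesic_distinct[OF g(1)] geodesic_not_Nil[OF g(1)]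
    by (metis distinct.simps(2) last_ConsL last_ConsR last_in_set list.collapse)
  then show ?thesis using True form_antisym[OF \<alpha>, of u x] by simp
next
  case uv: False
  then obtain c where c: "g = v # c @ [u]" "distinct (v # c @ [u])" "is_path p (v # c @ [u])"
    using geodesic_cases g by metis
  show ?thesis
  proof (cases "x \<in> set g")
    case True
    then obtain g1 g2 where s: "g = g1 @ x # g2" by (meson split_list)
    have "is_geodesic p d (g1 @ [x])" "is_geodesic p d (x # g2)"
      using g(1) geodesic_append unfolding s by blast+
    moreover have "hd (g1 @ [x]) = v" using g(2) s by (cases g1) auto
    moreover have "last (x # g2) = u" using g(3) s by auto
    ultimately have "\<alpha> $ x $ v + line_integral \<alpha> (g1 @ [x]) = 0"
      "\<alpha> $ u $ x + line_integral \<alpha> (x # g2) = 0"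
      using edge_geodesic_integral[OF \<alpha>] ux xv by auto
    then show ?thesis unfolding s path_length_append[of _ g1 x g2] by simp
  next
    case x: False
    have "line_integral \<alpha> (u # (x # v # c) @ [u]) = 0"
    proof (rule cycle_integral_zero[OF \<alpha>])
      show "is_path p (u # (x # v # c) @ [u])" using c ux xv by (simp add: is_path_Cons)
      show "distinct (u # x # v # c)" using c x ux xv uv by auto
      show "length (x # v # c) = 2 \<or> (\<exists>x1 x2 x3 c'. x # v # c = x1 # x2 # x3 # c' \<and>
               d u x3 < d u x1 + d x1 x2 + d x2 x3 \<and> is_geodesic p d (x3 # c' @ [u]))"
      proof (cases c)
        case (Cons w c1)
        have g1: "is_geodesic p d (v # w # c1 @ [u])" using g c Cons by simp
        have g2: "is_geodesic p d (w # c1 @ [u])"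
          using geodesic_append(2)[of "[v]" w] g1 by simp
        have "d v u = d v w + d w u" using geodesic_split_length[OF g1] by auto
        moreover have "0 < d v w" using c Cons by auto
        moreover have "d u v \<le> d u x + d x v" by (rule d_triangle)
        ultimately have "d u w < d u x + d x v + d v w"
          using d_sym[of u v] d_sym[of u w] by linarith
        then show ?thesis using Cons g2 by blast
      qed simp
    qed
    then show ?thesis using c by simp
  qed
qed

text \<open>Here \<open>short\<close> is the strict inequality of \<open>X2\<close> itself.
  Coincidences among the vertices destroy the cycle and are reduced to a triangle or to the cases
  with fewer edges.\<close>

lemma three_edge_geodesic_integral:
  assumes \<alpha>: "\<alpha> \<in> ker_delta1 p d" and ux: "adj p u x" and xy: "adj p x y" and yv: "adj p y v"
    and short: "d u v < d u x + d x y + d y v"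
    and g: "is_geodesic p d g" "hd g = v" "last g = u"
  shows "\<alpha> $ u $ x + \<alpha> $ x $ y + \<alpha> $ y $ v + line_integral \<alpha> g = 0"
proof -
  consider "u = y" | "x = v" | "u = v" | "u \<noteq> y" "x \<noteq> v" "u \<noteq> v" by blast
  then show ?thesis
  proof cases
    case 1
    then show ?thesis
      using edge_geodesic_integral[OF \<alpha> yv g(1,2)] g(3) form_antisym[OF \<alpha>, of x y] by simp
  next
    case 2
    then show ?thesis
      using edge_geodesic_integral[OF \<alpha> ux g(1)] g(2,3) form_antisym[OF \<alpha>, of x y] by simp
  next
    case 3
    then have "g = [v]" using g geodesic_distinct[OF g(1)] geodesic_not_Nil[OF g(1)]
      by (metis distinct.simps(2) last_ConsL last_ConsR last_in_set list.collapse)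
    moreover have "line_integral \<alpha> (u # [x, y] @ [u]) = 0"
      by (rule cycle_integral_zero[OF \<alpha>]) (use ux xy yv 3 in \<open>auto simp: is_path_Cons\<close>)
    ultimately show ?thesis using 3 by simp
  next
    case 4
    then obtain c where c: "g = v # c @ [u]" "distinct (v # c @ [u])" "is_path p (v # c @ [u])"
      using geodesic_cases g by metis
    consider "x \<in> set g" | "y \<in> set g" | "x \<notin> set g" "y \<notin> set g" by blast
    then show ?thesis
    proof cases
      case 1
      then obtain g1 g2 where s: "g = g1 @ x # g2" by (meson split_list)
      have "is_geodesic p d (g1 @ [x])" "is_geodesic p d (x # g2)"
        using g(1) geodesic_append unfolding s by blast+
      moreover have "hd (g1 @ [x]) = v" using g(2) s by (cases g1) auto
      moreover have "last (x # g2) = u" using g(3) s by auto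
      ultimately have "\<alpha> $ x $ y + \<alpha> $ y $ v + line_integral \<alpha> (g1 @ [x]) = 0"
        "\<alpha> $ u $ x + line_integral \<alpha> (x # g2) = 0"
        using edge_geodesic_integral[OF \<alpha> ux] two_edge_geodesic_integral[OF \<alpha> xy yv] by auto
      then show ?thesis unfolding s path_length_append[of _ g1 x g2] by simp
    next
      case 2
      then obtain g1 g2 where s: "g = g1 @ y # g2" by (meson split_list)
      have "is_geodesic p d (g1 @ [y])" "is_geodesic p d (y # g2)"
        using g(1) geodesic_append unfolding s by blast+
      moreover have "hd (g1 @ [y]) = v" using g(2) s by (cases g1) auto
      moreover have "last (y # g2) = u" using g(3) s by auto
      ultimately have "\<alpha> $ y $ v + line_integral \<alpha> (g1 @ [y]) = 0"
        "\<alpha> $ u $ x + \<alpha> $ x $ y + line_integral \<alpha> (y # g2) = 0"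
        using edge_geodesic_integral[OF \<alpha> yv] two_edge_geodesic_integral[OF \<alpha> ux xy] by auto
      then show ?thesis unfolding s path_length_append[of _ g1 y g2] by simp
    next
      case 3
      have "line_integral \<alpha> (u # (x # y # v # c) @ [u]) = 0"
      proof (rule cycle_integral_zero[OF \<alpha>])
        show "is_path p (u # (x # y # v # c) @ [u])"
          using c ux xy yv by (simp add: is_path_Cons)
        show "distinct (u # x # y # v # c)" using c 3 4 ux xy yv by auto
      qed (use short g c in auto)
      then show ?thesis using c by simp
    qed
  qed
qed

lemma line_integral_rev:
  assumes "\<alpha> \<in> ker_delta1 p d"
  shows "line_integral \<alpha> (rev xs) = - line_integral \<alpha> xs"
proof (induction xs)
  case (Cons a xs)
  show ?case
  proof (cases xs)
    case Nil
    then show ?thesis by simp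
  next
    case C: (Cons b ys)
    have "line_integral \<alpha> (rev (a # xs)) = line_integral \<alpha> (rev ys @ b # [a])"
      using C by simp
    also have "\<dots> = line_integral \<alpha> (rev xs) + \<alpha> $ b $ a"
      unfolding path_length_append[of _ "rev ys" b "[a]"] using C by simp
    finally show ?thesis using Cons.IH form_antisym[OF assms, of b a] C by simp
  qed
qed (simp add: path_length_def)

text \<open>If a walk of at most three edges is longer than the distance of its end points, closing it
  by a geodesic gives (up to degenerations) a cycle of \<open>X\<^sub>2\<close>; otherwise it is itself a geodesic.\<close>

lemma short_walk_geodesic:
  assumes \<alpha>: "\<alpha> \<in> ker_delta1 p d" and ux: "near u x" and xy: "near x y" and yv: "near y v"
  shows "\<exists>g. is_geodesic p d g \<and> hd g = u \<and> last g = v \<and>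
    line_integral \<alpha> g = \<alpha> $ u $ x + \<alpha> $ x $ y + \<alpha> $ y $ v"
proof -
  obtain h where h: "is_geodesic p d h" "hd h = v" "last h = u" using geodesic_exists by blast
  have r: "is_geodesic p d (rev h)" "hd (rev h) = u" "last (rev h) = v"
    "line_integral \<alpha> (rev h) = - line_integral \<alpha> h"
    using h geodesic_rev line_integral_rev[OF \<alpha>] by (auto simp: hd_rev last_rev)
  have two: ?thesis if "adj p u w" "adj p w v" "\<alpha> $ u $ w + \<alpha> $ w $ v = \<alpha> $ u $ x + \<alpha> $ x $ y + \<alpha> $ y $ v" for w
    using that(3) two_edge_geodesic_integral[OF \<alpha> that(1,2) h] r by (intro exI[of _ "rev h"]) auto
  have one: ?thesis if "near u v" "\<alpha> $ u $ v = \<alpha> $ u $ x + \<alpha> $ x $ y + \<alpha> $ y $ v"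
  proof (cases "u = v")
    case True
    then have "is_geodesic p d [u]" by (simp add: is_geodesic_def)
    then show ?thesis using that(2) True \<alpha> by (intro exI[of _ "[u]"]) auto
  next
    case False
    then have "adj p u v" using that(1) by blast
    then show ?thesis
      using that(2) geodesic_edge[of u v] by (intro exI[of _ "[u, v]"]) auto
  qed
  show ?thesis
  proof (cases "u = x \<or> x = y \<or> y = v")
    case True
    then show ?thesis
      using one two[of x] two[of y] ux xy yv \<alpha> by auto
  next
    case False
    then have e: "adj p u x" "adj p x y" "adj p y v" using ux xy yv by auto
    show ?thesis
    proof (cases "d u v < d u x + d x y + d y v")
      case True
      show ?thesis
        using three_edge_geodesic_integral[OF \<alpha> e True h] r
        by (intro exI[of _ "rev h"]) auto
    next
      case False
      have "d u v \<le> d u x + d x y + d y v"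
        using d_triangle[of u v x] d_triangle[of x v y] by linarith
      then have "is_geodesic p d [u, x, y, v]"
        using False e by (simp add: is_geodesic_def is_path_def)
      then show ?thesis by (intro exI[of _ "[u, x, y, v]"]) auto
    qed
  qed
qed

lemma triangle_form:
  assumes "\<alpha> \<in> ker_delta1 p d" "near u x" "near x v" "near u v"
  shows "\<alpha> $ u $ x + \<alpha> $ x $ v = \<alpha> $ u $ v"
proof -
  consider "u = x" | "x = v" | "u = v" | "adj p u x" "adj p x v" "adj p u v" using assms by blast
  then show ?thesis
  proof cases
    case 3
    then show ?thesis using assms(1) form_antisym[OF assms(1), of u x] by simp
  next
    case 4
    have "is_geodesic p d [v, u]" using 4 adj_sym geodesic_edge by blast
    then show ?thesis using two_edge_geodesic_integral[OF assms(1) 4(1,2), of "[v, u]"]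
        form_antisym[OF assms(1), of v u] by simp
  qed (use assms(1) in auto)
qed

end

text \<open>The lower envelope of the cones \<open>\<phi> u + \<delta> u w\<close> is Lipschitz,
  being a minimum of Lipschitz functions. At a point of A its own cone is the lowest one by
  \<open>lip\<close>.\<close>

lemma mcshane_extension:
  fixes \<delta> :: "'a \<Rightarrow> 'a \<Rightarrow> real"
  assumes fin: "finite A" "A \<noteq> {}"
    and tri: "\<And>u v w. \<delta> u w \<le> \<delta> u v + \<delta> v w" and refl: "\<And>u. \<delta> u u = 0"
    and sym: "\<And>u v. \<delta> u v = \<delta> v u"
    and lip: "\<And>u v. u \<in> A \<Longrightarrow> v \<in> A \<Longrightarrow> \<phi> u - \<phi> v \<le> \<delta> u v"
  obtains f where "\<And>u. u \<in> A \<Longrightarrow> f u = \<phi> u" "\<And>u v. f u - f v \<le> \<delta> u v"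
proof
  let ?f = "\<lambda>w. Min ((\<lambda>u. \<phi> u + \<delta> u w) ` A)"
  fix w assume w: "w \<in> A"
  show "?f w = \<phi> w"
  proof (rule Min_eqI)
    fix t assume "t \<in> (\<lambda>u. \<phi> u + \<delta> u w) ` A"
    then obtain u where "u \<in> A" "t = \<phi> u + \<delta> u w" by blast
    then show "\<phi> w \<le> t" using lip[of w u] w sym[of u w] by auto
  qed (use w fin refl in \<open>auto simp: image_iff intro!: bexI[of _ w]\<close>)
next
  let ?f = "\<lambda>w. Min ((\<lambda>u. \<phi> u + \<delta> u w) ` A)"
  fix v w
  have "?f w \<in> (\<lambda>u. \<phi> u + \<delta> u w) ` A" using fin by (intro Min_in) auto
  then obtain u where u: "u \<in> A" "?f w = \<phi> u + \<delta> u w" by blast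
  have "?f v \<le> \<phi> u + \<delta> u v" using u fin by (intro Min_le) auto
  then show "?f v - ?f w \<le> \<delta> v w" using u(2) tri[of u v w] sym[of v w] by linarith
qed

context path_metric_chain
begin

section \<open>Local potentials\<close>

text \<open>For an antisymmetric form the one-sided bound also bounds the absolute value, as d is
  symmetric.\<close>

definition unit_bounded :: "real^'v^'v \<Rightarrow> bool" where
  "unit_bounded \<alpha> \<longleftrightarrow> (\<forall>x y. \<alpha> $ x $ y \<le> d x y)"

definition tight :: "real^'v^'v \<Rightarrow> 'v \<Rightarrow> 'v \<Rightarrow> bool" where
  "tight \<alpha> x y \<longleftrightarrow> adj p x y \<and> \<alpha> $ x $ y = d x y"

definition divergence :: "real^'v^'v \<Rightarrow> 'v \<Rightarrow> real" where
  "divergence \<alpha> x = (\<Sum>y\<in>UNIV. p x y * \<alpha> $ x $ y)"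

abbreviation lip :: "('v \<Rightarrow> real) \<Rightarrow> bool" where
  "lip f \<equiv> \<forall>u v. f u - f v \<le> d u v"

lemma line_integral_le:
  "unit_bounded \<alpha> \<Longrightarrow> line_integral \<alpha> g \<le> path_length d g"
  unfolding path_length_def unit_bounded_def by (intro sum_mono) auto

text \<open>Every edge contributes at most its length, so equal totals leave no slack on any
  edge.\<close>

lemma tight_path:
  assumes "unit_bounded \<alpha>"
  shows "is_path p g \<Longrightarrow> line_integral \<alpha> g = path_length d g \<Longrightarrow> successively (tight \<alpha>) g"
proof (induction g)
  case (Cons a g)
  show ?case
  proof (cases g)
    case C: (Cons b ys)
    have "\<alpha> $ a $ b \<le> d a b" "line_integral \<alpha> g \<le> path_length d g"
      using assms line_integral_le unfolding unit_bounded_def by auto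
    moreover have "\<alpha> $ a $ b + line_integral \<alpha> g = d a b + path_length d g"
      using Cons.prems(2) C by simp
    ultimately have "\<alpha> $ a $ b = d a b" "line_integral \<alpha> g = path_length d g" by linarith+
    then show ?thesis using Cons C by (simp add: is_path_Cons tight_def)
  qed simp
qed simp

lemma near_sym: "near x y \<longleftrightarrow> near y x"
  using adj_sym by blast

lemma short_walk_le:
  assumes "\<alpha> \<in> ker_delta1 p d" "unit_bounded \<alpha>" "near u x" "near x y" "near y v"
  shows "\<alpha> $ u $ x + \<alpha> $ x $ y + \<alpha> $ y $ v \<le> d u v"
proof -
  obtain g where "is_geodesic p d g" "hd g = u" "last g = v"
    "line_integral \<alpha> g = \<alpha> $ u $ x + \<alpha> $ x $ y + \<alpha> $ y $ v"
    using short_walk_geodesic[OF assms(1,3-5)] by blast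
  then show ?thesis using line_integral_le[OF assms(2), of g] by (auto simp: is_geodesic_def)
qed

lemma short_walk_tight:
  assumes "\<alpha> \<in> ker_delta1 p d" "unit_bounded \<alpha>" "near u x" "near x y" "near y v"
    and eq: "\<alpha> $ u $ x + \<alpha> $ x $ y + \<alpha> $ y $ v = d u v"
  obtains g where "is_geodesic p d g" "hd g = u" "last g = v" "successively (tight \<alpha>) g"
proof -
  obtain g where g: "is_geodesic p d g" "hd g = u" "last g = v"
    "line_integral \<alpha> g = \<alpha> $ u $ x + \<alpha> $ x $ y + \<alpha> $ y $ v"
    using short_walk_geodesic[OF assms(1,3-5)] by blast
  then have "line_integral \<alpha> g = path_length d g" using eq by (simp add: is_geodesic_def)
  then have "successively (tight \<alpha>) g" using tight_path assms(2) g(1) geodesic_is_path by blast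
  then show thesis using that g by blast
qed

text \<open>The differences of the candidate \<phi> are integrals along walks of at most three
  edges, so \<open>short_walk_le\<close> makes \<phi> Lipschitz on the points near x or y, and it
  extends to all vertices.\<close>

lemma local_potential:
  assumes \<alpha>: "\<alpha> \<in> ker_delta1 p d" and b: "unit_bounded \<alpha>" and xy: "near x y"
  obtains f where "lip f" "\<And>u. near x u \<Longrightarrow> f x - f u = \<alpha> $ x $ u"
    "\<And>u. near y u \<Longrightarrow> f y - f u = \<alpha> $ y $ u"
proof -
  define A where "A = {u. near x u \<or> near y u}"
  \<comment> \<open>The potential is normalised to vanish at x. A point near both ends may be
    reached by either route, because triangles have integral zero.\<close>
  define \<phi> where "\<phi> u = (if near x u then \<alpha> $ u $ x else \<alpha> $ u $ y + \<alpha> $ y $ x)" for u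
  have yx: "near y x" using xy adj_sym by blast
  have \<phi>x: "\<phi> u = - \<alpha> $ x $ u" if "near x u" for u
    using that form_antisym[OF \<alpha>, of u x] by (simp add: \<phi>_def)
  have \<phi>y: "\<phi> u = \<alpha> $ y $ x - \<alpha> $ y $ u" if "near y u" for u
  proof (cases "near x u")
    case True
    then have "\<alpha> $ u $ y + \<alpha> $ y $ x = \<alpha> $ u $ x"
      using triangle_form[OF \<alpha>, of u y x] that yx near_sym by blast
    then show ?thesis using True form_antisym[OF \<alpha>, of u y] by (simp add: \<phi>_def)
  next
    case False
    then show ?thesis using form_antisym[OF \<alpha>, of u y] by (simp add: \<phi>_def)
  qed
  have walk: "\<alpha> $ s $ t - \<alpha> $ s $ u + \<alpha> $ t $ v \<le> d u v"
    if "near s u" "near s t" "near t v" for s t u v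
    using short_walk_le[OF \<alpha> b, of u s t v] that near_sym[of s u] form_antisym[OF \<alpha>, of u s] by force
  have "\<phi> u - \<phi> v \<le> d u v" if "u \<in> A" "v \<in> A" for u v
  proof -
    consider "near x u" "near x v" | "near x u" "near y v" | "near y u" "near x v"
      | "near y u" "near y v" using \<open>u \<in> A\<close> \<open>v \<in> A\<close> unfolding A_def by blast
    then show ?thesis
    proof cases
      case 1
      then show ?thesis using walk[of x u x v] \<phi>x \<alpha> by simp
    next
      case 2
      then show ?thesis
        using walk[of x u y v] \<phi>x[of u] \<phi>y[of v] xy form_antisym[OF \<alpha>, of x y] by linarith
    next
      case 3
      then show ?thesis using walk[of y u x v] \<phi>x[of v] \<phi>y[of u] yx by linarith
    next
      case 4
      then show ?thesis using walk[of y u y v] \<phi>y \<alpha> by simp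
    qed
  qed
  moreover have "finite A" "A \<noteq> {}" by (auto simp: A_def)
  ultimately obtain f where f: "\<And>u. u \<in> A \<Longrightarrow> f u = \<phi> u" "lip f"
    using mcshane_extension[of A d \<phi>] d_triangle d_sym d_eq_0 by metis
  show thesis
  proof
    show "lip f" by (rule f(2))
    show "f x - f u = \<alpha> $ x $ u" if "near x u" for u
    proof -
      have "x \<in> A" "u \<in> A" using that by (auto simp: A_def)
      then show ?thesis using f(1) \<phi>x[of x] \<phi>x[OF that] \<alpha> by simp
    qed
    show "f y - f u = \<alpha> $ y $ u" if "near y u" for u
    proof -
      have "y \<in> A" "u \<in> A" using that by (auto simp: A_def)
      then show ?thesis using f(1) \<phi>y[of y] \<phi>y[OF that] \<alpha> by simp
    qed
  qed
qed

lemma divergence_eq_laplacian: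
  assumes "\<And>u. near x u \<Longrightarrow> f x - f u = \<alpha> $ x $ u"
  shows "divergence \<alpha> x = - laplacian p f x"
  unfolding divergence_def laplacian_def sum_negf[symmetric]
proof (rule sum.cong)
  fix u
  show "p x u * \<alpha> $ x $ u = - (p x u * (f u - f x))"
  proof (cases "near x u")
    case True
    then show ?thesis using assms[of u] by (simp flip: mult_minus_right)
  next
    case False
    then show ?thesis using p_eq_0[of x u] by simp
  qed
qed simp

section \<open>Consequences of nonnegative curvature\<close>

lemma laplacian_bound:
  assumes "lip f" shows "\<bar>laplacian p f x\<bar> \<le> (\<Sum>y\<in>UNIV. p x y * d x y)"
proof -
  have "\<bar>laplacian p f x\<bar> \<le> (\<Sum>y\<in>UNIV. \<bar>p x y * (f y - f x)\<bar>)"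
    unfolding laplacian_def by (rule sum_abs)
  also have "\<dots> \<le> (\<Sum>y\<in>UNIV. p x y * d x y)"
  proof (rule sum_mono)
    fix y
    have "f y - f x \<le> d y x" "f x - f y \<le> d x y" using assms by blast+
    then have "\<bar>f y - f x\<bar> \<le> d x y" using d_sym[of x y] by linarith
    then show "\<bar>p x y * (f y - f x)\<bar> \<le> p x y * d x y"
      by (simp add: abs_mult mult_left_mono)
  qed
  finally show ?thesis .
qed

lemma grad_le_1_iff_lip: "(\<forall>u v. u \<noteq> v \<longrightarrow> \<bar>grad d u v f\<bar> \<le> 1) \<longleftrightarrow> lip f"
proof
  assume L: "\<forall>u v. u \<noteq> v \<longrightarrow> \<bar>grad d u v f\<bar> \<le> 1"
  show "lip f"
  proof (intro allI)
    fix u v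
    show "f u - f v \<le> d u v"
    proof (cases "u = v")
      case False
      then have "(f u - f v) / d u v \<le> 1" using L unfolding grad_def by (meson abs_le_D1)
      then show ?thesis using False by (simp add: divide_le_eq split: if_splits)
    qed simp
  qed
next
  assume L: "lip f"
  show "\<forall>u v. u \<noteq> v \<longrightarrow> \<bar>grad d u v f\<bar> \<le> 1"
  proof (intro allI impI)
    fix u v :: 'v assume "u \<noteq> v"
    moreover have "f u - f v \<le> d u v" "f v - f u \<le> d v u" using L by blast+
    ultimately have "\<bar>f u - f v\<bar> \<le> d u v" "0 < d u v" using d_sym[of u v] by auto
    then show "\<bar>grad d u v f\<bar> \<le> 1" by (simp add: grad_def abs_divide)
  qed
qed

text \<open>The gradient prescribed on the edge attains 1, so requiring the supremum to equal 1
  amounts to requiring it to be at most 1.\<close>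

lemma curvature_set_iff:
  assumes "x \<noteq> y"
  shows "grad d y x f = 1 \<and> Sup {\<bar>grad d u v f\<bar> | u v. u \<noteq> v} = 1
    \<longleftrightarrow> lip f \<and> f y - f x = d x y"
proof -
  let ?S = "{\<bar>grad d u v f\<bar> | u v. u \<noteq> v}"
  have "finite ?S"
    by (rule finite_subset[of _ "(\<lambda>(u, v). \<bar>grad d u v f\<bar>) ` UNIV"]) auto
  then have bdd: "bdd_above ?S" by (rule bdd_above_finite)
  have g: "grad d y x f = 1 \<longleftrightarrow> f y - f x = d x y"
    using assms d_sym[of x y] by (auto simp: grad_def divide_eq_eq)
  have S: "Sup ?S = 1 \<longleftrightarrow> lip f" if "grad d y x f = 1"
  proof
    assume s: "Sup ?S = 1"
    have "\<bar>grad d u v f\<bar> \<le> 1" if "u \<noteq> v" for u v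
      using that bdd unfolding s[symmetric] by (intro cSup_upper) auto
    then show "lip f" by (intro iffD1[OF grad_le_1_iff_lip]) simp
  next
    assume "lip f"
    then have "\<forall>u v. u \<noteq> v \<longrightarrow> \<bar>grad d u v f\<bar> \<le> 1" by (rule iffD2[OF grad_le_1_iff_lip])
    then have "\<And>t. t \<in> ?S \<Longrightarrow> t \<le> 1" by force
    moreover have "1 \<in> ?S"
      unfolding mem_Collect_eq by (intro exI[of _ y] exI[of _ x]) (use that assms in simp)
    ultimately show "Sup ?S = 1" by (intro cSup_eq_maximum)
  qed
  have "grad d y x f = 1 \<and> Sup ?S = 1 \<longleftrightarrow> grad d y x f = 1 \<and> lip f"
    by (rule conj_cong[OF refl S])
  also have "\<dots> \<longleftrightarrow> lip f \<and> f y - f x = d x y"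
    unfolding g by (rule conj_commute)
  finally show ?thesis .
qed

lemma curvature_eq:
  assumes "x \<noteq> y"
  shows "ollivier_curvature p d x y
    = Inf {(laplacian p f x - laplacian p f y) / d x y | f. lip f \<and> f y - f x = d x y}"
  unfolding ollivier_curvature_def curvature_set_iff[OF assms] by (simp add: grad_def)

lemma curvature_nonneg_iff:
  assumes "x \<noteq> y"
  shows "0 \<le> ollivier_curvature p d x y
    \<longleftrightarrow> (\<forall>f. lip f \<longrightarrow> f y - f x = d x y \<longrightarrow> laplacian p f y \<le> laplacian p f x)"
proof -
  let ?C = "{(laplacian p f x - laplacian p f y) / d x y | f. lip f \<and> f y - f x = d x y}"
  have pos: "0 < d x y" using assms by simp
  \<comment> \<open>Over the reals \<open>Inf\<close> is a greatest lower bound only for a nonempty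
    set that is bounded below. The bound comes from the Laplacians of Lipschitz functions, and the
    member exhibited below is the distance from x.\<close>
  have "bdd_below ?C"
  proof (rule bdd_belowI)
    fix t assume "t \<in> ?C"
    then obtain f where f: "lip f" "t = (laplacian p f x - laplacian p f y) / d x y" by blast
    have "- (\<Sum>z\<in>UNIV. p x z * d x z) - (\<Sum>z\<in>UNIV. p y z * d y z)
        \<le> laplacian p f x - laplacian p f y"
      using laplacian_bound[OF f(1), of x] laplacian_bound[OF f(1), of y] by linarith
    then show "(- (\<Sum>z\<in>UNIV. p x z * d x z) - (\<Sum>z\<in>UNIV. p y z * d y z)) / d x y \<le> t"
      unfolding f(2) using pos by (intro divide_right_mono) auto
  qed
  moreover have "?C \<noteq> {}"
  proof -
    have "lip (d x)" using d_triangle[of x] d_sym by (metis diff_le_eq add.commute)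
    moreover have "d x y - d x x = d x y" by simp
    ultimately show ?thesis by blast
  qed
  ultimately have "0 \<le> Inf ?C \<longleftrightarrow> (\<forall>t\<in>?C. 0 \<le> t)" by (rule le_cInf_iff[rotated])
  also have "\<dots> \<longleftrightarrow> (\<forall>f. lip f \<and> f y - f x = d x y \<longrightarrow>
      0 \<le> (laplacian p f x - laplacian p f y) / d x y)"
    by blast
  also have "\<dots> \<longleftrightarrow> (\<forall>f. lip f \<longrightarrow> f y - f x = d x y \<longrightarrow> laplacian p f y \<le> laplacian p f x)"
    unfolding zero_le_divide_iff using pos by (metis diff_ge_0_iff_ge less_le_not_le)
  finally show ?thesis unfolding curvature_eq[OF assms] .
qed

end

locale nonneg_curved_chain = path_metric_chain p d
  for p :: "'v::finite \<Rightarrow> 'v \<Rightarrow> real" and d +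
  assumes curv: "nonneg_ollivier_curvature p d"
begin

lemma laplacian_mono_tight:
  assumes "adj p x y" "lip f" "f x - f y = d x y"
  shows "laplacian p f x \<le> laplacian p f y"
proof -
  have "adj p y x" "y \<noteq> x" using assms(1) adj_sym by (auto simp: adj_def)
  then show ?thesis
    using curv curvature_nonneg_iff[of y x] assms(2,3) d_sym[of x y]
    unfolding nonneg_ollivier_curvature_def by auto
qed

text \<open>Near x and y the form is the gradient of a Lipschitz function, and the two divergences
  see nothing beyond these points.\<close>

lemma divergence_mono_tight:
  assumes \<alpha>: "\<alpha> \<in> ker_delta1 p d" and b: "unit_bounded \<alpha>" and t: "tight \<alpha> x y"
  shows "divergence \<alpha> y \<le> divergence \<alpha> x"
proof -
  have xy: "near x y" using t by (simp add: tight_def)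
  obtain f where f: "lip f" "\<And>u. near x u \<Longrightarrow> f x - f u = \<alpha> $ x $ u"
    "\<And>u. near y u \<Longrightarrow> f y - f u = \<alpha> $ y $ u"
    using local_potential[OF \<alpha> b xy] by metis
  have "laplacian p f x \<le> laplacian p f y"
    using laplacian_mono_tight[of x y f] f(1) f(2)[OF xy] t unfolding tight_def by simp
  then show ?thesis
    using divergence_eq_laplacian[of x f, OF f(2)] divergence_eq_laplacian[of y f, OF f(3)] by simp
qed

text \<open>A Lipschitz function that is extremal for the curvature of the edge stays Lipschitz when it is
  raised on the set of points lying tightly below \<open>z\<close>; curvature then compares the mass which the
  two ends give to this set. This takes the place of an optimal transport plan.\<close>

lemma mass_below_mono:
  assumes xy: "adj p x y" and f: "lip f" "f x - f y = d x y"
    and lap: "laplacian p f y \<le> laplacian p f x"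
    and S: "S = {u. f z - f u = d z u}" and y: "y \<notin> S"
  shows "(\<Sum>u\<in>S. p x u) \<le> (\<Sum>u\<in>S. p y u)"
proof -
  have up: "v \<in> S" if "u \<in> S" "f u - f v = d u v" for u v
  proof -
    have "f z - f v \<ge> d z v" using that d_triangle[of z v u] unfolding S by auto
    moreover have "f z - f v \<le> d z v" using f(1) by blast
    ultimately show ?thesis unfolding S by simp
  qed
  have x: "x \<notin> S" using up[of x y] f(2) y by blast
  \<comment> \<open>Raising f on S increases only the differences from a point of S to a point
    outside. E collects their slacks, which are positive because by \<open>up\<close> no tight
    descent leaves S.\<close>
  define E where "E = insert 1 ((\<lambda>(u, v). d u v - (f u - f v)) ` (S \<times> (- S)))"
  define \<epsilon> where "\<epsilon> = Min E"
  have E: "finite E" unfolding E_def by simp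
  have pos: "0 < t" if "t \<in> E" for t
  proof -
    have "0 < d u v - (f u - f v)" if "u \<in> S" "v \<notin> S" for u v
      using f(1) up[of u v] that by (metis diff_gt_0_iff_gt less_eq_real_def)
    then show ?thesis using that by (auto simp: E_def)
  qed
  have \<epsilon>: "0 < \<epsilon>" using pos Min_in[OF E] by (auto simp: \<epsilon>_def E_def)
  have \<epsilon>_le: "\<epsilon> \<le> d u v - (f u - f v)" if "u \<in> S" "v \<notin> S" for u v
    unfolding \<epsilon>_def using that by (intro Min_le[OF E]) (auto simp: E_def)
  define f' where "f' u = f u + (if u \<in> S then \<epsilon> else 0)" for u
  have "lip f'"
  proof (intro allI)
    fix u v
    have "f u - f v \<le> d u v" using f(1) by blast
    then show "f' u - f' v \<le> d u v"
      using \<epsilon>_le[of u v] \<epsilon> unfolding f'_def by (cases "u \<in> S"; cases "v \<in> S") auto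
  qed
  moreover have "f' x - f' y = d x y" using x y f(2) by (simp add: f'_def)
  ultimately have "laplacian p f' x \<le> laplacian p f' y" using laplacian_mono_tight xy by blast
  moreover have "laplacian p f' w = laplacian p f w + \<epsilon> * (\<Sum>u\<in>S. p w u)" if "w \<notin> S" for w
  proof -
    have "laplacian p f' w = (\<Sum>u\<in>UNIV. p w u * (f u - f w) + (if u \<in> S then \<epsilon> * p w u else 0))"
      unfolding laplacian_def using that by (intro sum.cong) (auto simp: f'_def algebra_simps)
    also have "\<dots> = laplacian p f w + (\<Sum>u\<in>UNIV. if u \<in> S then \<epsilon> * p w u else 0)"
      unfolding laplacian_def by (rule sum.distrib)
    also have "(\<Sum>u\<in>UNIV. if u \<in> S then \<epsilon> * p w u else 0) = \<epsilon> * (\<Sum>u\<in>S. p w u)"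
      by (simp add: sum.If_cases sum_distrib_left)
    finally show ?thesis .
  qed
  ultimately have "\<epsilon> * (\<Sum>u\<in>S. p x u) \<le> \<epsilon> * (\<Sum>u\<in>S. p y u)" using x y lap by fastforce
  then show ?thesis using \<epsilon> by simp
qed

text \<open>Equal divergences are the equality case of curvature, in which
  \<open>mass_below_mono\<close> applies. The point z lies tightly below itself, so x gives this set
  at least the mass \<open>p x z\<close>; of the mass given by y only S counts, since p vanishes on
  points not near y.\<close>

lemma tight_transport:
  assumes \<alpha>: "\<alpha> \<in> ker_delta1 p d" and b: "unit_bounded \<alpha>" and t: "tight \<alpha> x y"
    and div: "divergence \<alpha> x = divergence \<alpha> y" and xz: "adj p x z"
    and S: "S = {v. near y v \<and> \<alpha> $ z $ x + \<alpha> $ x $ y + \<alpha> $ y $ v = d z v}"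
    and y: "y \<notin> S"
  shows "p x z \<le> (\<Sum>v\<in>S. p y v)"
proof -
  have xy: "near x y" using t by (simp add: tight_def)
  obtain f where f: "lip f" "\<And>u. near x u \<Longrightarrow> f x - f u = \<alpha> $ x $ u"
    "\<And>u. near y u \<Longrightarrow> f y - f u = \<alpha> $ y $ u"
    using local_potential[OF \<alpha> b xy] by metis
  define S' where "S' = {u. f z - f u = d z u}"
  have fz: "f z - f v = \<alpha> $ z $ x + \<alpha> $ x $ y + \<alpha> $ y $ v" if "near y v" for v
    using f(2)[of z] f(2)[OF xy] f(3)[OF that] xz form_antisym[OF \<alpha>, of z x] by linarith
  have SS: "S = {v \<in> S'. near y v}" using fz unfolding S S'_def by auto
  have "(\<Sum>u\<in>S'. p x u) \<le> (\<Sum>u\<in>S'. p y u)"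
  proof (rule mass_below_mono[OF _ f(1) _ _ S'_def])
    show "adj p x y" "f x - f y = d x y" using t f(2)[OF xy] by (auto simp: tight_def)
    show "laplacian p f y \<le> laplacian p f x"
      using divergence_eq_laplacian[of x f, OF f(2)] divergence_eq_laplacian[of y f, OF f(3)] div
      by simp
    show "y \<notin> S'" using y SS by auto
  qed
  moreover have "p x z \<le> (\<Sum>u\<in>S'. p x u)" by (rule member_le_sum) (auto simp: S'_def)
  moreover have "(\<Sum>u\<in>S'. p y u) = (\<Sum>v\<in>S. p y v)"
    using p_eq_0[of y] by (intro sum.mono_neutral_right) (auto simp: SS)
  ultimately show ?thesis by linarith
qed

corollary tight_transport_exists:
  assumes \<alpha>: "\<alpha> \<in> ker_delta1 p d" and b: "unit_bounded \<alpha>" and t: "tight \<alpha> x y"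
    and div: "divergence \<alpha> x = divergence \<alpha> y" and xz: "near x z"
  shows "\<exists>v. near y v \<and> \<alpha> $ z $ x + \<alpha> $ x $ y + \<alpha> $ y $ v = d z v"
proof (cases "x = z")
  case True
  then show ?thesis using t \<alpha> by (intro exI[of _ y]) (auto simp: tight_def)
next
  case False
  show ?thesis
  proof (rule ccontr)
    assume "\<not> ?thesis"
    then have e: "{v. near y v \<and> \<alpha> $ z $ x + \<alpha> $ x $ y + \<alpha> $ y $ v = d z v} = {}" by blast
    have "p x z \<le> 0" using tight_transport[OF \<alpha> b t div _ e[symmetric]] False xz by auto
    then show False using False xz by (auto simp: adj_def)
  qed
qed

end

context path_metric_chain
begin

section \<open>Harmonic forms\<close>

lemma laplacian_add: "laplacian p (\<lambda>x. f x + g x) x = laplacian p f x + laplacian p g x"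
  by (simp add: laplacian_def sum.distrib[symmetric] algebra_simps)

lemma laplacian_scale: "laplacian p (\<lambda>x. c * f x) x = c * laplacian p f x"
  by (simp add: laplacian_def sum_distrib_left algebra_simps)

lemma laplacian_at_max:
  assumes "\<And>u. f u \<le> f x" shows "laplacian p f x \<le> 0"
  unfolding laplacian_def using assms by (intro sum_nonpos mult_nonneg_nonpos) auto

lemma laplacian_at_min:
  assumes "\<And>u. f x \<le> f u" shows "0 \<le> laplacian p f x"
  unfolding laplacian_def using assms by (intro sum_nonneg mult_nonneg_nonneg) auto

lemma argmax_exists: "\<exists>x. \<forall>u. (f :: 'v \<Rightarrow> real) u \<le> f x"
proof -
  have "Max (range f) \<in> range f" by (rule Max_in) auto
  then obtain x where "f x = Max (range f)" by fastforce
  then show ?thesis using Max_ge[of "range f"] by (metis finite_class.finite_UNIV finite_imageI rangeI)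
qed

lemma argmin_exists: "\<exists>x. \<forall>u. (f :: 'v \<Rightarrow> real) x \<le> f u"
  using argmax_exists[of "\<lambda>x. - f x"] by simp

text \<open>Maximum principle: the Laplacian has opposite signs at a maximum and at a minimum, so c
  = 0, and then the maximal value spreads to all neighbours.\<close>

lemma laplacian_const_imp_const:
  assumes c: "\<And>x. laplacian p f x = c"
  shows "c = 0" and "f x = f y"
proof -
  obtain m where m: "\<And>u. f u \<le> f m" using argmax_exists by blast
  obtain l where l: "\<And>u. f l \<le> f u" using argmin_exists by blast
  show c0: "c = 0" using laplacian_at_max[of f m, OF m] laplacian_at_min[of f l, OF l] c by simp
  have "f u = f m" for u
  proof (rule connected_induct[where P = "\<lambda>u. f u = f m", of m])
    fix u v assume u: "f u = f m" and uv: "adj p u v"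
    have "(\<Sum>w\<in>UNIV. p u w * (f u - f w)) = - laplacian p f u"
      unfolding laplacian_def sum_negf[symmetric] by (intro sum.cong) (auto simp: algebra_simps)
    then have "(\<Sum>w\<in>UNIV. p u w * (f u - f w)) = 0" using c c0 by simp
    moreover have "\<And>w. 0 \<le> p u w * (f u - f w)" using u m by simp
    ultimately have "p u v * (f u - f v) = 0" by (simp add: sum_nonneg_eq_0_iff)
    then show "f v = f m" using uv u by (simp add: adj_def)
  qed simp
  then show "f x = f y" by metis
qed

text \<open>The value at q serves twice: it excludes the constants from the kernel, and it supplies
  the constant by which the range of the Laplacian falls short. The result is an invertible square
  system.\<close>

definition poisson_map :: "'v \<Rightarrow> real^'v \<Rightarrow> real^'v" where
  "poisson_map q v = (\<chi> x. laplacian p (($) v) x + v $ q)"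

lemma laplacian_vec_add: "laplacian p (($) (v + w)) x = laplacian p (($) v) x + laplacian p (($) w) x"
  using laplacian_add[of "($) v" "($) w"] by (simp add: laplacian_def)

lemma laplacian_vec_scale: "laplacian p (($) (c *\<^sub>R v)) x = c * laplacian p (($) v) x"
  using laplacian_scale[of c "($) v"] by (simp add: laplacian_def)

lemma linear_poisson_map: "linear (poisson_map q)"
  unfolding poisson_map_def
  by (rule linearI) (auto simp: vec_eq_iff laplacian_vec_add laplacian_vec_scale algebra_simps)

lemma inj_poisson_map: "inj (poisson_map q)"
  unfolding linear_injective_0[OF linear_poisson_map]
proof (intro allI impI)
  fix v assume "poisson_map q v = 0"
  then have L: "laplacian p (($) v) x = - v $ q" for x
    by (simp add: poisson_map_def vec_eq_iff add_eq_0_iff2)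
  have "v $ q = 0" using laplacian_const_imp_const(1)[of "($) v", OF L] by simp
  moreover have "v $ x = v $ q" for x using laplacian_const_imp_const(2)[of "($) v", OF L] .
  ultimately show "v = 0" by (simp add: vec_eq_iff)
qed

lemma poisson_solvable: "\<exists>f c. \<forall>x. laplacian p f x + c = h x"
proof -
  fix q :: 'v
  have "surj (poisson_map q)"
    using linear_inj_imp_surj[OF linear_poisson_map inj_poisson_map] .
  then obtain v where "poisson_map q v = (\<chi> x. h x)" by (metis surj_def)
  then have "\<forall>x. laplacian p (($) v) x + v $ q = h x" by (simp add: poisson_map_def vec_eq_iff)
  then show "\<exists>f c. \<forall>x. laplacian p f x + c = h x" by blast
qed

text \<open>A function normalised to vanish at q is mapped by \<open>poisson_map\<close> to its
  Laplacian, and the inverse map is bounded. This makes the gradient part of the form vanish in the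
  limit of the heat flow.\<close>

lemma oscillation_bound:
  obtains C where "0 \<le> C" "\<And>f x y G. (\<And>u. \<bar>laplacian p f u\<bar> \<le> G) \<Longrightarrow> f x - f y \<le> C * G"
proof -
  fix q :: 'v
  obtain B where B: "0 < B" "\<And>v. B * norm v \<le> norm (poisson_map q v)"
    using linear_inj_bounded_below_pos[OF linear_poisson_map inj_poisson_map] by metis
  have "f x - f y \<le> (2 * real CARD('v) / B) * G" if G: "\<And>u. \<bar>laplacian p f u\<bar> \<le> G" for f x y G
  proof -
    define v :: "real^'v" where "v = (\<chi> u. f u - f q)"
    have v: "v $ u = f u - f q" for u by (simp add: v_def)
    have "laplacian p (($) v) u = laplacian p f u" for u
      by (simp add: laplacian_def v)
    then have P: "poisson_map q v $ u = laplacian p f u" for u by (simp add: poisson_map_def v)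
    have "B * norm v \<le> norm (poisson_map q v)" by (rule B)
    also have "\<dots> \<le> (\<Sum>u\<in>UNIV. \<bar>poisson_map q v $ u\<bar>)" by (rule norm_le_l1_cart)
    also have "\<dots> \<le> (\<Sum>u\<in>(UNIV :: 'v set). G)" using G P by (intro sum_mono) auto
    finally have "B * norm v \<le> real CARD('v) * G" by simp
    then have n: "norm v \<le> real CARD('v) / B * G" using B(1) by (simp add: field_simps)
    have "f x - f y = v $ x - v $ y" by (simp add: v)
    also have "\<dots> \<le> 2 * norm v"
      using component_le_norm_cart[of v x] component_le_norm_cart[of v y] by linarith
    finally show ?thesis using n by simp
  qed
  moreover have "0 \<le> 2 * real CARD('v) / B" using B by simp
  ultimately show ?thesis using that by blast
qed

text \<open>By the maximum principle a solution of the homogeneous equation has maximum at most 0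
  and minimum at least 0. The implicit step replaces a differential equation by linear
  algebra.\<close>

lemma resolvent_exists:
  assumes s: "0 \<le> s"
  obtains f where "\<And>x. f x - s * laplacian p f x = g x"
proof -
  define R where "R v = (\<chi> x. v $ x - s * laplacian p (($) v) x)" for v :: "real^'v"
  have lin: "linear R"
    unfolding R_def by (rule linearI) (auto simp: vec_eq_iff laplacian_vec_add laplacian_vec_scale algebra_simps)
  have "inj R"
    unfolding linear_injective_0[OF lin]
  proof (intro allI impI)
    fix v assume "R v = 0"
    then have v: "v $ x = s * laplacian p (($) v) x" for x by (simp add: R_def vec_eq_iff)
    obtain m where m: "\<And>u. v $ u \<le> v $ m" using argmax_exists[of "($) v"] by blast
    obtain l where l: "\<And>u. v $ l \<le> v $ u" using argmin_exists[of "($) v"] by blast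
    have "v $ m \<le> 0" using v[of m] laplacian_at_max[of "($) v" m, OF m] s
      by (metis mult_nonneg_nonpos)
    moreover have "0 \<le> v $ l" using v[of l] laplacian_at_min[of "($) v" l, OF l] s
      by (metis mult_nonneg_nonneg)
    ultimately show "v = 0" using m l by (metis vec_eq_iff zero_index order_antisym order_trans)
  qed
  then have "surj R" using linear_inj_imp_surj[OF lin] by blast
  then obtain v where "R v = (\<chi> x. g x)" by (metis surj_def)
  then show ?thesis using that[of "($) v"] by (simp add: R_def vec_eq_iff)
qed

section \<open>Closed, exact and harmonic forms\<close>

lemma delta0_nth: "delta0 p f $ x $ y = (if adj p x y then f x - f y else 0)"
  by (simp add: delta0_def)

lemma delta0_path: "is_path p xs \<Longrightarrow> line_integral (delta0 p f) xs = f (hd xs) - f (last xs)"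
proof (induction xs)
  case (Cons a xs)
  then show ?case by (cases xs) (auto simp: is_path_Cons delta0_nth)
qed (simp add: is_path_def)

lemma delta0_in_ker: "delta0 p f \<in> ker_delta1 p d"
proof -
  have "delta1 (delta0 p f) xs = 0" if "xs \<in> X2 p d" for xs
  proof -
    have c: "is_cycle p xs" using that by (simp add: X2_def)
    then have ne: "xs \<noteq> []" by (auto simp: is_cycle_def)
    have "is_path p (xs @ [hd xs])"
      using c ne by (simp add: is_cycle_def is_path_def successively_append_iff)
    then show ?thesis using delta1_eq_path_length[OF ne] delta0_path ne by simp
  qed
  moreover have "delta0 p f \<in> one_forms p"
    using adj_sym by (auto simp: one_forms_def delta0_nth)
  ultimately show ?thesis by (simp add: ker_delta1_def)
qed

lemma subspace_ker_delta1: "subspace (ker_delta1 p d)"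
proof (rule subspaceI)
  show "0 \<in> ker_delta1 p d" by (simp add: ker_delta1_def one_forms_def delta1_def)
next
  fix \<alpha> \<beta> assume "\<alpha> \<in> ker_delta1 p d" "\<beta> \<in> ker_delta1 p d"
  moreover have "delta1 (\<alpha> + \<beta>) xs = delta1 \<alpha> xs + delta1 \<beta> xs" for xs
    by (simp add: delta1_def sum.distrib)
  ultimately show "\<alpha> + \<beta> \<in> ker_delta1 p d"
    unfolding ker_delta1_def one_forms_def by fastforce
next
  fix c \<alpha> assume "\<alpha> \<in> ker_delta1 p d"
  moreover have "delta1 (c *\<^sub>R \<alpha>) xs = c * delta1 \<alpha> xs" for xs
    by (simp add: delta1_def sum_distrib_left)
  ultimately show "c *\<^sub>R \<alpha> \<in> ker_delta1 p d"
    unfolding ker_delta1_def one_forms_def by fastforce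
qed

lemma linear_delta0: "delta0 p (\<lambda>x. f x + g x) = delta0 p f + delta0 p g"
  "delta0 p (\<lambda>x. c * f x) = c *\<^sub>R delta0 p f"
  by (auto simp: vec_eq_iff delta0_nth algebra_simps)

lemma subspace_im_delta0: "subspace (im_delta0 p)"
proof (rule subspaceI)
  have "delta0 p (\<lambda>x. 0) = 0" by (simp add: vec_eq_iff delta0_nth)
  then show "0 \<in> im_delta0 p" unfolding im_delta0_def by (metis rangeI)
qed (auto simp: im_delta0_def linear_delta0[symmetric])

lemma im_subset_ker: "im_delta0 p \<subseteq> ker_delta1 p d"
  using delta0_in_ker by (auto simp: im_delta0_def)

lemma divergence_add: "divergence (\<alpha> + \<beta>) x = divergence \<alpha> x + divergence \<beta> x"
  by (simp add: divergence_def sum.distrib distrib_left)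

lemma divergence_scale: "divergence (c *\<^sub>R \<alpha>) x = c * divergence \<alpha> x"
  by (simp add: divergence_def sum_distrib_left algebra_simps)

lemma divergence_delta0: "divergence (delta0 p f) x = - laplacian p f x"
  by (rule divergence_eq_laplacian) (auto simp: delta0_nth)

definition harmonic_forms :: "(real^'v^'v) set" where
  "harmonic_forms = {\<alpha> \<in> ker_delta1 p d. \<forall>x y. divergence \<alpha> x = divergence \<alpha> y}"

lemma harmonic_in_ker: "\<alpha> \<in> harmonic_forms \<Longrightarrow> \<alpha> \<in> ker_delta1 p d"
  by (simp add: harmonic_forms_def)

lemma harmonic_divergence: "\<alpha> \<in> harmonic_forms \<Longrightarrow> divergence \<alpha> x = divergence \<alpha> y"
  unfolding harmonic_forms_def by blast

lemma subspace_harmonic: "subspace harmonic_forms"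
proof (rule subspaceI)
  show "0 \<in> harmonic_forms"
    using subspace_0[OF subspace_ker_delta1] by (simp add: harmonic_forms_def divergence_def)
next
  fix \<alpha> \<beta> assume "\<alpha> \<in> harmonic_forms" "\<beta> \<in> harmonic_forms"
  then show "\<alpha> + \<beta> \<in> harmonic_forms"
    using subspace_add[OF subspace_ker_delta1, of \<alpha> \<beta>]
    unfolding harmonic_forms_def mem_Collect_eq divergence_add by metis
next
  fix c \<alpha> assume "\<alpha> \<in> harmonic_forms"
  then show "c *\<^sub>R \<alpha> \<in> harmonic_forms"
    using subspace_scale[OF subspace_ker_delta1, of \<alpha> c]
    unfolding harmonic_forms_def mem_Collect_eq divergence_scale by metis
qed

text \<open>The Poisson equation writes every closed form as harmonic plus exact. The sum is direct:
  an exact form of constant divergence has a primitive of constant Laplacian, and such a primitive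
  is constant.\<close>

lemma betti1_eq_dim_harmonic: "betti1 p d = dim harmonic_forms"
proof -
  have "{\<alpha> + \<beta> | \<alpha> \<beta>. \<alpha> \<in> harmonic_forms \<and> \<beta> \<in> im_delta0 p} = ker_delta1 p d"
  proof (intro equalityI subsetI)
    fix \<gamma> assume "\<gamma> \<in> {\<alpha> + \<beta> | \<alpha> \<beta>. \<alpha> \<in> harmonic_forms \<and> \<beta> \<in> im_delta0 p}"
    then show "\<gamma> \<in> ker_delta1 p d"
      using subspace_add[OF subspace_ker_delta1] harmonic_in_ker im_subset_ker by blast
  next
    fix \<gamma> assume \<gamma>: "\<gamma> \<in> ker_delta1 p d"
    obtain f c where f: "\<And>x. laplacian p f x + c = - divergence \<gamma> x"
      using poisson_solvable[of "\<lambda>x. - divergence \<gamma> x"] by blast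
    define \<alpha> where "\<alpha> = \<gamma> + (-1) *\<^sub>R delta0 p f"
    have "divergence \<alpha> x = - c" for x
      using f[of x] unfolding \<alpha>_def divergence_add divergence_scale divergence_delta0 by simp
    moreover have "\<alpha> \<in> ker_delta1 p d"
      unfolding \<alpha>_def
      by (intro subspace_add[OF subspace_ker_delta1] subspace_scale[OF subspace_ker_delta1] \<gamma> delta0_in_ker)
    ultimately have "\<alpha> \<in> harmonic_forms" by (simp add: harmonic_forms_def)
    moreover have "\<gamma> = \<alpha> + delta0 p f" by (simp add: \<alpha>_def)
    ultimately show "\<gamma> \<in> {\<alpha> + \<beta> | \<alpha> \<beta>. \<alpha> \<in> harmonic_forms \<and> \<beta> \<in> im_delta0 p}"
      unfolding im_delta0_def by blast
  qed
  moreover have "harmonic_forms \<inter> im_delta0 p = {0}"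
  proof (intro equalityI subsetI)
    fix \<gamma> assume "\<gamma> \<in> harmonic_forms \<inter> im_delta0 p"
    then obtain f where f: "\<gamma> = delta0 p f" "\<gamma> \<in> harmonic_forms" by (auto simp: im_delta0_def)
    fix q :: 'v
    have "laplacian p f x = laplacian p f q" for x
      using harmonic_divergence[OF f(2), of x q] unfolding f(1) divergence_delta0 by simp
    from laplacian_const_imp_const(2)[OF this] have "f x - f y = 0" for x y by (metis eq_iff_diff_eq_0)
    then show "\<gamma> \<in> {0}" unfolding f(1) by (simp add: vec_eq_iff delta0_nth)
  qed (use subspace_0[OF subspace_harmonic] subspace_0[OF subspace_im_delta0] in auto)
  ultimately have "dim (ker_delta1 p d) = dim harmonic_forms + dim (im_delta0 p)"
    using dim_sums_Int[OF subspace_harmonic subspace_im_delta0] by simp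
  then show ?thesis
    unfolding betti1_def
      quotient_dim_eq[OF subspace_ker_delta1 subspace_im_delta0 im_subset_ker] by simp
qed

end

context nonneg_curved_chain
begin

text \<open>The implicit heat flow \<open>g \<mapsto> (1 - s\<Delta>)\<^sup>-\<^sup>1 g\<close> does not increase the norm of the form
  \<open>\<alpha> + \<delta>\<^sub>0 g\<close>, by curvature at an edge where the norm is attained; as \<open>s\<close> tends to infinity the form
  converges to the harmonic representative.\<close>

lemma resolvent_contracts:
  assumes \<alpha>: "\<alpha> \<in> harmonic_forms" and s: "0 \<le> s"
    and f: "\<And>x. f x - s * laplacian p f x = g x"
    and L: "\<And>x y. adj p x y \<Longrightarrow> \<alpha> $ x $ y + (g x - g y) \<le> L * d x y"
    and uv: "adj p u v"
  shows "\<alpha> $ u $ v + (f u - f v) \<le> L * d u v"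
proof -
  define \<beta> where "\<beta> = \<alpha> + delta0 p f"
  have \<beta>: "\<beta> \<in> ker_delta1 p d"
    unfolding \<beta>_def
    by (intro subspace_add[OF subspace_ker_delta1] harmonic_in_ker[OF \<alpha>] delta0_in_ker)
  have \<beta>_nth: "\<beta> $ x $ y = \<alpha> $ x $ y + (f x - f y)" if "adj p x y" for x y
    using that by (simp add: \<beta>_def delta0_nth)
  define E where "E = {(x, y). adj p x y}"
  define K where "K = Max ((\<lambda>(x, y). \<beta> $ x $ y / d x y) ` E)"
  have E: "finite E" "E \<noteq> {}" using uv by (auto simp: E_def)
  have "K \<in> (\<lambda>(x, y). \<beta> $ x $ y / d x y) ` E" unfolding K_def using E by (intro Max_in) auto
  then obtain x y where xy: "adj p x y" "K = \<beta> $ x $ y / d x y" by (auto simp: E_def)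
  have dpos: "0 < d a b" if "adj p a b" for a b using that by (simp add: adj_def)
  have K: "\<beta> $ a $ b \<le> K * d a b" if "adj p a b" for a b
  proof -
    have "\<beta> $ a $ b / d a b \<le> K" unfolding K_def using E that by (intro Max_ge) (auto simp: E_def)
    then show ?thesis using dpos[OF that] by (simp add: divide_le_eq)
  qed
  \<comment> \<open>On an edge and its reverse both the form and the gradient cancel.\<close>
  have L0: "0 \<le> L"
  proof -
    have "adj p v u" using uv adj_sym by blast
    then have "0 \<le> L * d u v + L * d v u"
      using L[OF uv] L[of v u] form_antisym[OF harmonic_in_ker[OF \<alpha>], of u v] by linarith
    then have "0 \<le> L * (2 * d u v)" using d_sym[of u v] by (simp add: algebra_simps)
    then show ?thesis using dpos[OF uv] by (simp add: zero_le_mult_iff)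
  qed
  have "K \<le> L"
  proof (rule ccontr)
    assume "\<not> K \<le> L"
    then have KL: "L < K" "0 < K" using L0 by auto
    define \<gamma> where "\<gamma> = (1 / K) *\<^sub>R \<beta>"
    have \<gamma>: "\<gamma> \<in> ker_delta1 p d" unfolding \<gamma>_def by (rule subspace_scale[OF subspace_ker_delta1 \<beta>])
    have "unit_bounded \<gamma>"
      unfolding unit_bounded_def
    proof (intro allI)
      fix a b
      show "\<gamma> $ a $ b \<le> d a b"
      proof (cases "adj p a b")
        case True
        then show ?thesis using K[OF True] KL by (simp add: \<gamma>_def field_simps)
      qed (simp add: form_nonadj[OF \<gamma>])
    qed
    moreover have "tight \<gamma> x y"
    proof -
      have "\<beta> $ x $ y = K * d x y" using xy(2) dpos[OF xy(1)] by simp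
      then show ?thesis using xy(1) KL by (simp add: tight_def \<gamma>_def)
    qed
    ultimately have "divergence \<gamma> y \<le> divergence \<gamma> x" using divergence_mono_tight \<gamma> by blast
    then have "divergence \<beta> y \<le> divergence \<beta> x"
      unfolding \<gamma>_def divergence_scale using KL by (simp add: divide_le_cancel)
    then have "laplacian p f x \<le> laplacian p f y"
      unfolding \<beta>_def divergence_add divergence_delta0
      using harmonic_divergence[OF \<alpha>, of x y] by simp
    \<comment> \<open>As f = g + s \<Delta>f, the comparison of the Laplacians says that f drops
      from x to y no more than g does.\<close>
    then have "s * laplacian p f x \<le> s * laplacian p f y" using s by (rule mult_left_mono)
    then have "f x - f y \<le> g x - g y" using f[of x] f[of y] by linarith
    then have "\<beta> $ x $ y \<le> L * d x y" using L[OF xy(1)] \<beta>_nth[OF xy(1)] by linarith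
    then have "K \<le> L" using xy dpos[OF xy(1)] by (simp add: divide_le_eq)
    then show False using KL by simp
  qed
  then have "K * d u v \<le> L * d u v" by (rule mult_right_mono) simp
  then show ?thesis using K[OF uv] \<beta>_nth[OF uv] by simp
qed

text \<open>For the resolvent f of g the values stay within the bound G of g, so its Laplacian is (f
  - g) / s. As s grows this tends to zero, and with it all differences of f, while the norm never
  exceeds L.\<close>

lemma harmonic_norm_minimal:
  assumes \<alpha>: "\<alpha> \<in> harmonic_forms"
    and L: "\<And>x y. adj p x y \<Longrightarrow> \<alpha> $ x $ y + (g x - g y) \<le> L * d x y"
    and uv: "adj p u v"
  shows "\<alpha> $ u $ v \<le> L * d u v"
proof -
  obtain C where C: "0 \<le> C" "\<And>f x y G. (\<And>u. \<bar>laplacian p f u\<bar> \<le> G) \<Longrightarrow> f x - f y \<le> C * G"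
    using oscillation_bound by metis
  define G where "G = Max (range (\<lambda>x. \<bar>g x\<bar>))"
  have G: "\<bar>g x\<bar> \<le> G" for x unfolding G_def by (rule Max_ge) auto
  have main: "\<alpha> $ u $ v \<le> L * d u v + C * (2 * G / s)" if s: "0 < s" for s
  proof -
    obtain f where f: "\<And>x. f x - s * laplacian p f x = g x"
      using resolvent_exists[of s g] s by auto
    obtain m where m: "\<And>u. f u \<le> f m" using argmax_exists by blast
    obtain l where l: "\<And>u. f l \<le> f u" using argmin_exists by blast
    have "s * laplacian p f m \<le> 0" "0 \<le> s * laplacian p f l"
      using laplacian_at_max[of f m, OF m] laplacian_at_min[of f l, OF l] s
      by (auto simp: mult_le_0_iff)
    then have "f m \<le> G" "- G \<le> f l" using f[of m] f[of l] G[of m] G[of l] by linarith+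
    then have fG: "\<bar>f x\<bar> \<le> G" for x using m[of x] l[of x] by linarith
    have "\<bar>laplacian p f x\<bar> \<le> 2 * G / s" for x
    proof -
      have "laplacian p f x = (f x - g x) / s" using f[of x] s by (simp add: field_simps)
      moreover have "\<bar>f x - g x\<bar> \<le> 2 * G" using fG[of x] G[of x] by linarith
      ultimately show ?thesis using s by (simp add: abs_divide divide_right_mono)
    qed
    then have "f v - f u \<le> C * (2 * G / s)" by (rule C(2))
    moreover have "\<alpha> $ u $ v + (f u - f v) \<le> L * d u v"
      using resolvent_contracts[OF \<alpha> _ f L uv] s by simp
    ultimately show ?thesis by linarith
  qed
  show ?thesis
  proof (rule field_le_epsilon)
    fix e :: real assume e: "0 < e"
    have G0: "0 \<le> G" using G[of u] by linarith
    \<comment> \<open>Chosen so that the error term is at most e; the summand 1 keeps s positive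
      even if C or G is zero.\<close>
    define s where "s = C * 2 * G / e + 1"
    have s: "0 < s" using C(1) G0 e by (simp add: s_def add_nonneg_pos)
    have "C * 2 * G \<le> e * s" using e by (simp add: s_def field_simps)
    then have "C * (2 * G / s) \<le> e" using s by (simp add: field_simps)
    then show "\<alpha> $ u $ v \<le> L * d u v + e" using main[OF s] by linarith
  qed
qed

section \<open>Tight edges at every vertex\<close>

text \<open>Without a directed cycle the number h of vertices reachable by tight edges strictly
  decreases along each tight edge. Adding a small multiple of its gradient lowers the form on every
  tight edge and spoils no other, so the norm falls below 1, against minimality.\<close>

lemma tight_cycle_exists:
  assumes \<alpha>: "\<alpha> \<in> harmonic_forms" and b: "unit_bounded \<alpha>" and t: "tight \<alpha> a b"
  shows "\<exists>x. (tight \<alpha>)\<^sup>+\<^sup>+ x x"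
proof (rule ccontr)
  assume acyc: "\<not> ?thesis"
  define h where "h x = real (card {u. (tight \<alpha>)\<^sup>*\<^sup>* x u})" for x
  have dec: "h y < h x" if "tight \<alpha> x y" for x y
  proof -
    have "{u. (tight \<alpha>)\<^sup>*\<^sup>* y u} \<subset> {u. (tight \<alpha>)\<^sup>*\<^sup>* x u}"
    proof
      show "{u. (tight \<alpha>)\<^sup>*\<^sup>* y u} \<subseteq> {u. (tight \<alpha>)\<^sup>*\<^sup>* x u}"
        using that by (auto intro: converse_rtranclp_into_rtranclp)
      have "x \<notin> {u. (tight \<alpha>)\<^sup>*\<^sup>* y u}"
        using that acyc by (auto dest: rtranclp_into_tranclp2)
      then show "{u. (tight \<alpha>)\<^sup>*\<^sup>* y u} \<noteq> {u. (tight \<alpha>)\<^sup>*\<^sup>* x u}" by blast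
    qed
    then show ?thesis unfolding h_def by (simp add: psubset_card_mono)
  qed
  have "\<forall>\<^sub>F \<epsilon> in at_right 0. adj p x y \<longrightarrow> \<alpha> $ x $ y + \<epsilon> * (h y - h x) < d x y" for x y
  proof (cases "tight \<alpha> x y")
    case True
    then have "\<epsilon> * (h y - h x) < 0" if "0 < \<epsilon>" for \<epsilon> :: real
      using dec that by (simp add: mult_less_0_iff)
    then show ?thesis using True
      by (auto simp: tight_def eventually_at_filter)
  next
    case False
    show ?thesis
    proof (cases "adj p x y")
      case adj: True
      have lt: "\<alpha> $ x $ y < d x y"
        using False adj b unfolding unit_bounded_def tight_def by (metis less_eq_real_def)
      have "((\<lambda>\<epsilon>. \<alpha> $ x $ y + \<epsilon> * (h y - h x)) \<longlongrightarrow> \<alpha> $ x $ y + 0 * (h y - h x)) (at_right 0)"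
        by (intro tendsto_intros)
      then have "\<forall>\<^sub>F \<epsilon> in at_right 0. \<alpha> $ x $ y + \<epsilon> * (h y - h x) < d x y"
        using order_tendstoD(2)[of _ _ _ "d x y"] lt by simp
      then show ?thesis by (auto elim: eventually_mono)
    qed simp
  qed
  then have "\<forall>\<^sub>F \<epsilon> in at_right 0. \<forall>x y. adj p x y \<longrightarrow> \<alpha> $ x $ y + \<epsilon> * (h y - h x) < d x y"
    by (intro eventually_all_finite)
  then obtain \<epsilon> where \<epsilon>: "\<And>x y. adj p x y \<Longrightarrow> \<alpha> $ x $ y + \<epsilon> * (h y - h x) < d x y"
    using eventually_happens'[OF trivial_limit_at_right_real[of 0]] by blast
  define L where "L = Max (insert 0 ((\<lambda>(x, y). (\<alpha> $ x $ y + \<epsilon> * (h y - h x)) / d x y) ` {(x, y). adj p x y}))"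
  have "L < 1"
    unfolding L_def by (subst Max_less_iff) (auto simp: adj_def \<epsilon>)
  moreover have "\<alpha> $ x $ y + ((- \<epsilon> * h x) - (- \<epsilon> * h y)) \<le> L * d x y" if "adj p x y" for x y
  proof -
    have "(\<alpha> $ x $ y + \<epsilon> * (h y - h x)) / d x y \<le> L"
      unfolding L_def using that by (intro Max_ge) auto
    moreover have "0 < d x y" using that by (simp add: adj_def)
    ultimately show ?thesis by (simp add: divide_le_eq algebra_simps)
  qed
  then have "\<alpha> $ a $ b \<le> L * d a b"
    using harmonic_norm_minimal[OF \<alpha>, of "\<lambda>x. - \<epsilon> * h x" L a b] t by (simp add: tight_def)
  moreover have "0 < d a b" "\<alpha> $ a $ b = d a b" using t by (auto simp: tight_def adj_def)
  ultimately show False by (simp add: mult_le_cancel_right1)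
qed

lemma tight_path_rtranclp:
  "successively (tight \<alpha>) g \<Longrightarrow> g \<noteq> [] \<Longrightarrow> (tight \<alpha>)\<^sup>*\<^sup>* (hd g) (last g)"
proof (induction g)
  case (Cons a g)
  then show ?case by (cases g) (auto intro: converse_rtranclp_into_rtranclp)
qed simp

text \<open>Follow an endless tight walk s inside M and carry a neighbour z along by transport. Each
  transport moves the companion along tight edges. Starting from a companion z' with the fewest
  vertices reachable from it, it can no longer move, for otherwise it would lie on a tight cycle.
  But next to a companion at rest the values of \<alpha> along s drop for ever.\<close>

lemma tight_cycle_reachable_near:
  assumes \<alpha>: "\<alpha> \<in> harmonic_forms" and b: "unit_bounded \<alpha>"
    and M: "M = {x. \<exists>c. (tight \<alpha>)\<^sup>*\<^sup>* x c \<and> (tight \<alpha>)\<^sup>+\<^sup>+ c c}"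
    and x: "x \<in> M" and xz: "near x z"
  shows "z \<in> M"
proof (rule ccontr)
  assume z: "z \<notin> M"
  note ker = harmonic_in_ker[OF \<alpha>]
  have next_M: "\<exists>v. v \<in> M \<and> tight \<alpha> u v" if u: "u \<in> M" for u
  proof -
    obtain c where c: "(tight \<alpha>)\<^sup>*\<^sup>* u c" "(tight \<alpha>)\<^sup>+\<^sup>+ c c" using u unfolding M by blast
    then have "(tight \<alpha>)\<^sup>+\<^sup>+ u c" by simp
    then obtain v where "tight \<alpha> u v" "(tight \<alpha>)\<^sup>*\<^sup>* v c" by (auto dest: tranclpD)
    then show ?thesis using c(2) unfolding M by blast
  qed
  obtain s where s: "s 0 = x" "\<And>k. s k \<in> M \<and> tight \<alpha> (s k) (s (Suc k))"
  proof -
    have "\<exists>f. \<forall>n. (f n \<in> M \<and> (n = 0 \<longrightarrow> f n = x)) \<and> tight \<alpha> (f n) (f (Suc n))"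
      by (rule dependent_nat_choice) (use x next_M in auto)
    then show thesis using that by auto
  qed
  define r where "r v = card {u. (tight \<alpha>)\<^sup>*\<^sup>* v u}" for v
  define Q where "Q = {v. (tight \<alpha>)\<^sup>*\<^sup>* z v \<and> (\<exists>k. near (s k) v)}"
  have "z \<in> Q" unfolding Q_def using s(1) xz by blast
  then obtain z' where z': "z' \<in> Q" "\<And>v. v \<in> Q \<Longrightarrow> r z' \<le> r v"
    using ex_has_least_nat[of "\<lambda>v. v \<in> Q" z r] by blast
  have zz': "(tight \<alpha>)\<^sup>*\<^sup>* z z'" using z'(1) by (simp add: Q_def)
  obtain k where k: "near (s k) z'" using z'(1) by (auto simp: Q_def)
  \<comment> \<open>Minimality of \<open>r z'\<close> makes the transported point v reach z' again.
    So v different from z' would put z' on a tight cycle and hence z into M. With v = z' the tight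
    walk from z' back to z' has integral zero, which is the stated drop.\<close>
  have stay: "near (s (Suc j)) z' \<and> \<alpha> $ s (Suc j) $ z' = \<alpha> $ s j $ z' - d (s j) (s (Suc j))"
    if j: "near (s j) z'" for j
  proof -
    have t: "tight \<alpha> (s j) (s (Suc j))" using s(2) by blast
    obtain v where v: "near (s (Suc j)) v"
      "\<alpha> $ z' $ s j + \<alpha> $ s j $ s (Suc j) + \<alpha> $ s (Suc j) $ v = d z' v"
      using tight_transport_exists[OF ker b t harmonic_divergence[OF \<alpha>] j] by blast
    have "near z' (s j)" "near (s j) (s (Suc j))" using j t near_sym by (auto simp: tight_def)
    then obtain g where g: "is_geodesic p d g" "hd g = z'" "last g = v" "successively (tight \<alpha>) g"
      using short_walk_tight[OF ker b _ _ v] by blast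
    have zv: "(tight \<alpha>)\<^sup>*\<^sup>* z' v" using tight_path_rtranclp[OF g(4) geodesic_not_Nil[OF g(1)]] g by simp
    have "v = z'"
    proof (rule ccontr)
      assume "v \<noteq> z'"
      have sub: "{u. (tight \<alpha>)\<^sup>*\<^sup>* v u} \<subseteq> {u. (tight \<alpha>)\<^sup>*\<^sup>* z' u}"
        using zv by (auto intro: rtranclp_trans)
      have "v \<in> Q" using v(1) zv zz' unfolding Q_def by (auto intro: rtranclp_trans)
      then have "r z' \<le> r v" by (rule z'(2))
      then have "{u. (tight \<alpha>)\<^sup>*\<^sup>* v u} = {u. (tight \<alpha>)\<^sup>*\<^sup>* z' u}"
        using sub unfolding r_def by (intro card_seteq) auto
      then have "(tight \<alpha>)\<^sup>*\<^sup>* v z'" by blast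
      moreover have "(tight \<alpha>)\<^sup>+\<^sup>+ z' v" using zv \<open>v \<noteq> z'\<close> by (metis rtranclpD)
      ultimately have "(tight \<alpha>)\<^sup>+\<^sup>+ z' z'" by simp
      then show False using z zz' unfolding M by blast
    qed
    then show ?thesis
      using v t form_antisym[OF ker, of z' "s j"] by (auto simp: tight_def)
  qed
  have nr: "near (s (k + n)) z'" for n
    by (induction n) (use k stay in auto)
  \<comment> \<open>The values of \<alpha> lie between -D and D, so they cannot drop by \<delta>
    more often than 2 D / \<delta> times.\<close>
  define D where "D = Max (range (\<lambda>(u, v). d u v))"
  have D: "d u v \<le> D" for u v unfolding D_def by (rule Max_ge) auto
  define \<delta> where "\<delta> = Min ((\<lambda>(u, v). d u v) ` {(u, v). adj p u v})"
  have e: "adj p (s 0) (s 1)" using s(2)[of 0] by (simp add: tight_def)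
  have "\<delta> \<in> (\<lambda>(u, v). d u v) ` {(u, v). adj p u v}"
    unfolding \<delta>_def using e by (intro Min_in) auto
  then have \<delta>: "0 < \<delta>" by (auto simp: adj_def)
  have \<delta>_le: "\<delta> \<le> d (s j) (s (Suc j))" for j
    unfolding \<delta>_def using s(2)[of j] by (intro Min_le) (auto simp: tight_def)
  have low: "\<alpha> $ s (k + n) $ z' \<le> \<alpha> $ s k $ z' - real n * \<delta>" for n
  proof (induction n)
    case (Suc n)
    then show ?case using stay[OF nr[of n]] \<delta>_le[of "k + n"] by (simp add: algebra_simps)
  qed simp
  obtain n where n: "2 * D < real n * \<delta>" using reals_Archimedean3[OF \<delta>] by blast
  have "\<alpha> $ z' $ s (k + n) \<le> D" "\<alpha> $ s k $ z' \<le> D"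
    using b D unfolding unit_bounded_def by (meson order_trans)+
  then show False using low[of n] n form_antisym[OF ker, of z' "s (k + n)"] by linarith
qed

lemma harmonic_tight_everywhere:
  assumes \<alpha>: "\<alpha> \<in> harmonic_forms" and b: "unit_bounded \<alpha>" and t: "tight \<alpha> a b"
  shows "\<exists>y. tight \<alpha> x y"
proof -
  define M where "M = {x. \<exists>c. (tight \<alpha>)\<^sup>*\<^sup>* x c \<and> (tight \<alpha>)\<^sup>+\<^sup>+ c c}"
  obtain c where "(tight \<alpha>)\<^sup>+\<^sup>+ c c" using tight_cycle_exists[OF assms] by blast
  then have "c \<in> M" by (auto simp: M_def)
  then have "x \<in> M"
    using connected_induct[of "\<lambda>u. u \<in> M" c x] tight_cycle_reachable_near[OF \<alpha> b M_def] by blast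
  then obtain c' where "(tight \<alpha>)\<^sup>*\<^sup>* x c'" "(tight \<alpha>)\<^sup>+\<^sup>+ c' c'" by (auto simp: M_def)
  then have "(tight \<alpha>)\<^sup>+\<^sup>+ x c'" by simp
  then show ?thesis by (blast dest: tranclpD)
qed

end

section \<open>Dual vectors, signed bases and symmetric extreme points\<close>

lemma dual_basis_vector:
  fixes B :: "'a::euclidean_space set"
  assumes "independent B" "b \<in> B"
  obtains v where "v \<in> span B" "v \<bullet> b = 1" "\<And>c. c \<in> B \<Longrightarrow> c \<noteq> b \<Longrightarrow> v \<bullet> c = 0"
proof -
  \<comment> \<open>The part of b orthogonal to the other basis vectors is, up to scaling, the dual
    vector.\<close>
  obtain y z where yz: "y \<in> span (B - {b})" "\<And>w. w \<in> span (B - {b}) \<Longrightarrow> orthogonal z w" "b = y + z"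
    using orthogonal_subspace_decomp_exists[of "B - {b}" b] by metis
  have "b \<notin> span (B - {b})" using assms dependent_def by blast
  then have "z \<noteq> 0" using yz by auto
  then have zz: "z \<bullet> z \<noteq> 0" by simp
  have zb: "z \<bullet> b = z \<bullet> z" using yz by (simp add: inner_add_right orthogonal_def)
  have "z = b - y" using yz(3) by simp
  moreover have "y \<in> span B" using yz(1) span_mono[of "B - {b}" B] by auto
  ultimately have "z \<in> span B" using assms(2) span_base span_diff by blast
  show thesis
  proof
    show "(1 / (z \<bullet> z)) *\<^sub>R z \<in> span B" using \<open>z \<in> span B\<close> by (rule span_scale)
    show "(1 / (z \<bullet> z)) *\<^sub>R z \<bullet> b = 1" using zb zz by simp
    show "(1 / (z \<bullet> z)) *\<^sub>R z \<bullet> c = 0" if "c \<in> B" "c \<noteq> b" for c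
      using yz(2)[OF span_base, of c] that by (simp add: orthogonal_def)
  qed
qed

lemma uminus_notin_independent:
  fixes B :: "'a::real_vector set"
  assumes "independent B" "b \<in> B"
  shows "- b \<notin> B"
proof
  assume nb: "- b \<in> B"
  have "b \<noteq> 0" using assms dependent_zero by blast
  then have "b \<noteq> - b" by (metis eq_neg_iff_add_eq_0 scaleR_2 scaleR_eq_0_iff zero_neq_numeral)
  then have "- b \<in> span (B - {b})" using nb by (intro span_base) auto
  then have "b \<in> span (B - {b})" using span_neg by fastforce
  then show False using assms dependent_def by blast
qed

lemma card_union_uminus_independent:
  fixes B :: "'a::real_vector set"
  assumes "independent B" "finite B"
  shows "card (B \<union> uminus ` B) = 2 * card B"
proof -
  have "B \<inter> uminus ` B = {}" using uminus_notin_independent[OF assms(1)] by auto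
  then show ?thesis using assms(2) by (simp add: card_Un_disjoint card_image)
qed

lemma extreme_point_uminus:
  fixes K :: "'a::real_vector set"
  assumes sym: "\<And>v. v \<in> K \<Longrightarrow> - v \<in> K" and e: "e extreme_point_of K"
  shows "(- e) extreme_point_of K"
  unfolding extreme_point_of_def
proof (intro conjI ballI notI)
  show "- e \<in> K" using e sym by (simp add: extreme_point_of_def)
next
  fix a b assume ab: "a \<in> K" "b \<in> K" "- e \<in> open_segment a b"
  then obtain t where t: "a \<noteq> b" "0 < t" "t < 1" "- e = (1 - t) *\<^sub>R a + t *\<^sub>R b"
    by (auto simp: in_segment)
  have "e = - (- e)" by simp
  also have "\<dots> = (1 - t) *\<^sub>R (- a) + t *\<^sub>R (- b)" unfolding t(4) by simp
  finally have "e = (1 - t) *\<^sub>R (- a) + t *\<^sub>R (- b)" .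
  then have "e \<in> open_segment (- a) (- b)" using t by (auto simp: in_segment)
  then show False using e ab sym unfolding extreme_point_of_def by blast
qed

context nonneg_curved_chain
begin

section \<open>Edge functionals on harmonic forms\<close>

text \<open>After scaling, an edge with the largest ratio K is tight, so the ratio K also occurs at
  an edge from x, where c bounds it.\<close>

lemma harmonic_bound_at_vertex:
  assumes \<alpha>: "\<alpha> \<in> harmonic_forms" and c: "\<And>y. adj p x y \<Longrightarrow> \<alpha> $ x $ y \<le> c * d x y"
    and uv: "adj p u v"
  shows "\<alpha> $ u $ v \<le> c * d u v"
proof -
  note ker = harmonic_in_ker[OF \<alpha>]
  define E where "E = {(x, y). adj p x y}"
  define K where "K = Max ((\<lambda>(x, y). \<alpha> $ x $ y / d x y) ` E)"
  have E: "finite E" "E \<noteq> {}" using uv by (auto simp: E_def)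
  have "K \<in> (\<lambda>(x, y). \<alpha> $ x $ y / d x y) ` E" unfolding K_def using E by (intro Max_in) auto
  then obtain a b where ab: "adj p a b" "K = \<alpha> $ a $ b / d a b" by (auto simp: E_def)
  have dpos: "0 < d a b" if "adj p a b" for a b using that by (simp add: adj_def)
  have K: "\<alpha> $ a $ b \<le> K * d a b" if "adj p a b" for a b
  proof -
    have "\<alpha> $ a $ b / d a b \<le> K" unfolding K_def using E that by (intro Max_ge) (auto simp: E_def)
    then show ?thesis using dpos[OF that] by (simp add: divide_le_eq)
  qed
  have "K \<le> c"
  proof (cases "0 < K")
    case True
    define \<gamma> where "\<gamma> = (1 / K) *\<^sub>R \<alpha>"
    have \<gamma>: "\<gamma> \<in> harmonic_forms" unfolding \<gamma>_def by (rule subspace_scale[OF subspace_harmonic \<alpha>])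
    have "unit_bounded \<gamma>"
      unfolding unit_bounded_def
    proof (intro allI)
      fix a b
      show "\<gamma> $ a $ b \<le> d a b"
      proof (cases "adj p a b")
        case adj: True
        then show ?thesis using K[OF adj] True by (simp add: \<gamma>_def field_simps)
      qed (simp add: form_nonadj[OF harmonic_in_ker[OF \<gamma>]])
    qed
    moreover have "tight \<gamma> a b"
    proof -
      have "\<alpha> $ a $ b = K * d a b" using ab(2) dpos[OF ab(1)] by simp
      then show ?thesis using ab(1) True by (simp add: tight_def \<gamma>_def)
    qed
    ultimately obtain y where "tight \<gamma> x y" using harmonic_tight_everywhere[OF \<gamma>] by blast
    then have y: "adj p x y" "\<alpha> $ x $ y = K * d x y"
      using True by (auto simp: tight_def \<gamma>_def field_simps)
    then have "K * d x y \<le> c * d x y" using c by metis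
    then show ?thesis using dpos[OF y(1)] by simp
  next
    \<comment> \<open>Without a positive ratio there is nothing to normalise; instead some edge at x
      and its reverse show that c is nonnegative.\<close>
    case False
    obtain y where y: "adj p x y"
    proof -
      have "\<exists>y. adj p x y"
      proof (rule connected_induct[where P = "\<lambda>x. \<exists>y. adj p x y", of u])
        show "\<exists>y. adj p u y" using uv by blast
        show "\<exists>y. adj p t y" if "adj p s t" for s t using that adj_sym by blast
      qed
      then show thesis using that by blast
    qed
    have yx: "adj p y x" using y adj_sym by blast
    have "\<alpha> $ y $ x \<le> K * d y x" by (rule K[OF yx])
    also have "\<dots> \<le> 0" using False by (simp add: mult_nonpos_nonneg)
    finally have "0 \<le> \<alpha> $ x $ y" using form_antisym[OF ker, of x y] by linarith
    then have "0 \<le> c * d x y" using c[OF y] by linarith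
    then have "0 \<le> c" using dpos[OF y] by (simp add: zero_le_mult_iff)
    then show ?thesis using False by linarith
  qed
  then have "K * d u v \<le> c * d u v" by (rule mult_right_mono) simp
  then show ?thesis using K[OF uv] by linarith
qed

text \<open>The Riesz representative of the functional inside \<open>harmonic_forms\<close>. Having
  functionals as vectors of the same space makes convex hulls and separation by inner products
  available.\<close>

definition edge_functional :: "'v \<Rightarrow> 'v \<Rightarrow> real^'v^'v" where
  "edge_functional x y = (SOME w. w \<in> harmonic_forms \<and>
     (\<forall>\<alpha>\<in>harmonic_forms. \<alpha> \<bullet> w = \<alpha> $ x $ y / d x y))"

lemma harmonic_projection:
  obtains y where "y \<in> harmonic_forms" "\<And>\<alpha>. \<alpha> \<in> harmonic_forms \<Longrightarrow> \<alpha> \<bullet> v = \<alpha> \<bullet> y"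
proof -
  have sp: "span harmonic_forms = harmonic_forms" using subspace_harmonic by (simp add: span_eq_iff)
  obtain y z where yz: "y \<in> harmonic_forms" "\<And>w. w \<in> harmonic_forms \<Longrightarrow> orthogonal z w" "v = y + z"
    using orthogonal_subspace_decomp_exists[of harmonic_forms v] unfolding sp by metis
  have "\<alpha> \<bullet> v = \<alpha> \<bullet> y" if "\<alpha> \<in> harmonic_forms" for \<alpha>
    using yz(2)[OF that] unfolding yz(3) by (simp add: inner_add_right orthogonal_def inner_commute)
  then show thesis using that yz(1) by blast
qed

lemma edge_functional:
  "edge_functional x y \<in> harmonic_forms"
  "\<alpha> \<in> harmonic_forms \<Longrightarrow> \<alpha> \<bullet> edge_functional x y = \<alpha> $ x $ y / d x y"
proof -
  define v :: "real^'v^'v" where "v = axis x (axis y (1 / d x y))"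
  have v: "\<alpha> \<bullet> v = \<alpha> $ x $ y / d x y" for \<alpha> by (simp add: v_def inner_axis)
  obtain w where w: "w \<in> harmonic_forms" "\<And>\<alpha>. \<alpha> \<in> harmonic_forms \<Longrightarrow> \<alpha> \<bullet> v = \<alpha> \<bullet> w"
    using harmonic_projection[of v] by metis
  then have "\<exists>w. w \<in> harmonic_forms \<and> (\<forall>\<alpha>\<in>harmonic_forms. \<alpha> \<bullet> w = \<alpha> $ x $ y / d x y)"
    using v by metis
  from someI_ex[OF this] show "edge_functional x y \<in> harmonic_forms"
    "\<alpha> \<in> harmonic_forms \<Longrightarrow> \<alpha> \<bullet> edge_functional x y = \<alpha> $ x $ y / d x y"
    unfolding edge_functional_def by blast+
qed

text \<open>The sum of the two functionals annihilates all harmonic forms, and it is itself one of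
  them.\<close>

lemma edge_functional_uminus: "edge_functional y x = - edge_functional x y"
proof -
  define w where "w = edge_functional y x + edge_functional x y"
  have w: "w \<in> harmonic_forms"
    unfolding w_def by (intro subspace_add[OF subspace_harmonic] edge_functional(1))
  have "w \<bullet> w = w \<bullet> edge_functional y x + w \<bullet> edge_functional x y"
    by (simp add: w_def inner_add_right)
  also have "\<dots> = w $ y $ x / d y x + w $ x $ y / d x y"
    using edge_functional(2)[OF w] by simp
  also have "\<dots> = 0" using form_antisym[OF harmonic_in_ker[OF w], of y x] d_sym[of x y] by simp
  finally have "w = 0" by simp
  then show ?thesis unfolding w_def by (simp add: eq_neg_iff_add_eq_0)
qed

definition star :: "'v \<Rightarrow> (real^'v^'v) set" where
  "star x = edge_functional x ` {y. adj p x y}"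

text \<open>A functional outside the hull could be separated from it. The separating vector,
  projected to the harmonic forms, would be a form whose bound at x fails at the edge u v.\<close>

lemma star_subset_hull: "star u \<subseteq> convex hull (star x)"
proof
  fix w assume "w \<in> star u"
  then obtain v where v: "adj p u v" "w = edge_functional u v" by (auto simp: star_def)
  show "w \<in> convex hull (star x)"
  proof (rule ccontr)
    assume "w \<notin> convex hull (star x)"
    moreover have "closed (convex hull (star x))"
      by (intro compact_imp_closed finite_imp_compact_convex_hull) (simp add: star_def)
    ultimately obtain a b where ab: "a \<bullet> w < b" "\<forall>s\<in>convex hull (star x). b < a \<bullet> s"
      using separating_hyperplane_closed_point[of "convex hull (star x)" w] convex_convex_hull by metis
    obtain \<beta> where \<beta>: "\<beta> \<in> harmonic_forms" "\<And>\<alpha>. \<alpha> \<in> harmonic_forms \<Longrightarrow> \<alpha> \<bullet> a = \<alpha> \<bullet> \<beta>"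
      using harmonic_projection[of a] by metis
    \<comment> \<open>The sign turns the lower bound of the separation into the upper bound that
      \<open>harmonic_bound_at_vertex\<close> expects.\<close>
    define \<alpha> where "\<alpha> = (-1) *\<^sub>R \<beta>"
    have \<alpha>: "\<alpha> \<in> harmonic_forms" unfolding \<alpha>_def by (rule subspace_scale[OF subspace_harmonic \<beta>(1)])
    have ae: "\<alpha> $ s $ t / d s t = - (a \<bullet> edge_functional s t)" for s t
      using edge_functional(2)[OF \<alpha>, of s t] \<beta>(2)[OF edge_functional(1), of s t]
      by (simp add: \<alpha>_def inner_commute)
    have dpos: "0 < d a b" if "adj p a b" for a b using that by (simp add: adj_def)
    have "\<alpha> $ x $ y \<le> (- b) * d x y" if "adj p x y" for y
    proof -
      have "edge_functional x y \<in> convex hull (star x)" using that by (auto simp: star_def intro: hull_inc)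
      then have "b < a \<bullet> edge_functional x y" using ab(2) by blast
      then have "\<alpha> $ x $ y / d x y \<le> - b" unfolding ae by simp
      then show ?thesis using dpos[OF that] by (simp add: divide_le_eq)
    qed
    then have "\<alpha> $ u $ v \<le> (- b) * d u v" using harmonic_bound_at_vertex[OF \<alpha> _ v(1)] by blast
    then have "\<alpha> $ u $ v / d u v \<le> - b" using dpos[OF v(1)] by (simp add: divide_le_eq)
    then show False using ab(1) unfolding ae v(2) by simp
  qed
qed

text \<open>The convex hull of the edge functionals at a vertex is the unit ball dual to the maximum norm,
  which does not depend on the vertex; so every star contains its extreme points, a symmetric
  spanning set.\<close>

lemma symmetric_basis_in_stars:
  obtains B where "independent B" "finite B" "span B = harmonic_forms" "card B = betti1 p d"
    "\<And>x. B \<union> uminus ` B \<subseteq> star x"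
proof -
  fix q :: 'v
  define K where "K = convex hull (star q)"
  have Kx: "K = convex hull (star x)" for x
    unfolding K_def using hull_minimal[of _ _ convex] star_subset_hull convex_convex_hull
    by (metis subset_antisym)
  define E where "E = {e. e extreme_point_of K}"
  have E_star: "E \<subseteq> star x" for x
    unfolding E_def Kx[of x] using extreme_point_of_convex_hull by blast
  have "- v \<in> K" if "v \<in> K" for v
  proof -
    have "uminus ` star q \<subseteq> K"
    proof
      fix w assume "w \<in> uminus ` star q"
      then obtain y where y: "adj p q y" "w = - edge_functional q y" by (auto simp: star_def)
      then have "w = edge_functional y q" using edge_functional_uminus[of y q] by simp
      then have "w \<in> star y" using adj_sym[of q y] y(1) by (simp add: star_def)
      then show "w \<in> K" unfolding Kx[of y] by (rule hull_inc)
    qed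
    then have "convex hull (uminus ` star q) \<subseteq> K"
      unfolding K_def by (intro hull_minimal convex_convex_hull)
    moreover have "uminus ` K = convex hull (uminus ` star q)"
      unfolding K_def by (rule convex_hull_linear_image) (rule linear_uminus)
    ultimately show ?thesis using that by blast
  qed
  then have E_neg: "- e \<in> E" if "e \<in> E" for e
    using that extreme_point_uminus[of K e] unfolding E_def by blast
  have "compact K" unfolding K_def by (intro finite_imp_compact_convex_hull) (simp add: star_def)
  then have KE: "K = convex hull E"
    unfolding E_def K_def by (rule Krein_Milman_Minkowski) (rule convex_convex_hull)
  have sub: "star x \<subseteq> span E" for x
    using hull_subset[of "star x" convex] convex_hull_subset_span[of E] Kx[of x] KE by blast
  have EH: "E \<subseteq> harmonic_forms" using E_star[of q] edge_functional(1) by (auto simp: star_def)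
  have spE: "span E = harmonic_forms"
  proof
    show "span E \<subseteq> harmonic_forms" using EH subspace_harmonic by (rule span_minimal)
  next
    show "harmonic_forms \<subseteq> span E"
    proof
      fix \<alpha> assume \<alpha>: "\<alpha> \<in> harmonic_forms"
      \<comment> \<open>The part of \<alpha> orthogonal to E vanishes on every edge, since all edge
        functionals lie in \<open>span E\<close>.\<close>
      obtain y z where yz: "y \<in> span E" "\<And>w. w \<in> span E \<Longrightarrow> orthogonal z w" "\<alpha> = y + z"
        using orthogonal_subspace_decomp_exists[of E \<alpha>] by metis
      have "y \<in> harmonic_forms" using yz(1) EH subspace_harmonic span_minimal by blast
      moreover have "z = \<alpha> - y" using yz(3) by simp
      ultimately have z: "z \<in> harmonic_forms" using \<alpha> subspace_diff[OF subspace_harmonic] by blast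
      have "z $ s $ t = 0" for s t
      proof (cases "adj p s t")
        case True
        then have "edge_functional s t \<in> span E" using sub[of s] by (auto simp: star_def)
        then have "z $ s $ t / d s t = 0"
          using yz(2) edge_functional(2)[OF z] by (metis orthogonal_def)
        then show ?thesis using True by (auto simp: adj_def)
      qed (simp add: form_nonadj[OF harmonic_in_ker[OF z]])
      then have "z = 0" by (simp add: vec_eq_iff)
      then show "\<alpha> \<in> span E" using yz by simp
    qed
  qed
  obtain B where B: "B \<subseteq> E" "independent B" "E \<subseteq> span B" "card B = dim E"
    using basis_exists by blast
  have "span B = span E" using B by (simp add: span_eq span_superset subset_trans)
  moreover have "dim E = betti1 p d" using spE betti1_eq_dim_harmonic by (metis dim_span)
  moreover have "B \<union> uminus ` B \<subseteq> star x" for x using B(1) E_neg E_star[of x] by blast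
  ultimately show thesis using that[of B] B spE independent_imp_finite[OF B(2)] by simp
qed

lemma vdeg_eq: "vdeg p x = card {y. adj p x y}"
  unfolding vdeg_def using adj_sym by simp

lemma twice_betti1_le_vdeg: "2 * betti1 p d \<le> vdeg p x"
proof -
  obtain B where B: "independent B" "finite B" "span B = harmonic_forms" "card B = betti1 p d"
    "\<And>x. B \<union> uminus ` B \<subseteq> star x" using symmetric_basis_in_stars by metis
  have "2 * betti1 p d = card (B \<union> uminus ` B)"
    using B card_union_uminus_independent by metis
  also have "\<dots> \<le> card (star x)" using B(5)[of x] by (rule card_mono[rotated]) (simp add: star_def)
  also have "\<dots> \<le> vdeg p x" unfolding star_def vdeg_eq by (rule card_image_le) simp
  finally show ?thesis .
qed

lemma vdeg_le_deg_max: "vdeg p x \<le> deg_max p"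
  unfolding deg_max_def by (rule Max_ge) auto

end

text \<open>The elements of \<open>D\<close> are the signed directions \<open>\<plusminus>a\<^sub>i\<close>, and \<open>T b\<close> is the translation in
  direction \<open>b\<close>.\<close>

locale parallel_frame = nonneg_curved_chain p d
  for p :: "'v::finite \<Rightarrow> 'v \<Rightarrow> real" and d +
  fixes D :: "(real^'v^'v) set" and \<theta> :: "real^'v^'v \<Rightarrow> real^'v^'v" and T :: "real^'v^'v \<Rightarrow> 'v \<Rightarrow> 'v"
  assumes D_uminus: "b \<in> D \<Longrightarrow> - b \<in> D" and D_neq: "b \<in> D \<Longrightarrow> - b \<noteq> b"
    and \<theta>_harmonic: "b \<in> D \<Longrightarrow> \<theta> b \<in> harmonic_forms"
    and T_adj: "b \<in> D \<Longrightarrow> adj p x (T b x)"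
    and T_surj: "adj p x y \<Longrightarrow> \<exists>b\<in>D. y = T b x"
    and T_inj: "b \<in> D \<Longrightarrow> c \<in> D \<Longrightarrow> T b x = T c x \<Longrightarrow> b = c"
    and \<theta>_T: "b \<in> D \<Longrightarrow> c \<in> D \<Longrightarrow>
      \<theta> b $ x $ T c x = (if c = b then d x (T c x) else if c = - b then - d x (T c x) else 0)"

context nonneg_curved_chain
begin

lemma parallel_frame_exists:
  assumes "deg_max p = 2 * betti1 p d"
  obtains B \<theta> T where "independent B" "finite B" "card B = betti1 p d"
    "parallel_frame p d (B \<union> uminus ` B) \<theta> T"
proof -
  obtain B where B: "independent B" "finite B" "span B = harmonic_forms" "card B = betti1 p d"
    "\<And>x. B \<union> uminus ` B \<subseteq> star x" using symmetric_basis_in_stars by metis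
  define D where "D = B \<union> uminus ` B"
  have cD: "card D = 2 * betti1 p d"
    using B card_union_uminus_independent unfolding D_def by metis
  \<comment> \<open>D has twice \<open>betti1 p d\<close> elements and lies in every star, while no
    vertex has more edges than that. Hence each star equals D, and different edges at a vertex have
    different functionals.\<close>
  have star_D: "star x = D \<and> inj_on (edge_functional x) {y. adj p x y}" for x
  proof -
    have fin: "finite (star x)" by (simp add: star_def)
    have "card (star x) \<le> card {y. adj p x y}" unfolding star_def by (rule card_image_le) simp
    also have "\<dots> \<le> card D" using vdeg_le_deg_max[of x] vdeg_eq assms cD by metis
    finally have le: "card (star x) \<le> card D" "card {y. adj p x y} \<le> card D"
      using \<open>card {y. adj p x y} \<le> card D\<close> by auto
    have "D = star x" using card_seteq[OF fin] B(5)[of x] le(1) unfolding D_def by blast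
    then have "card (edge_functional x ` {y. adj p x y}) = card {y. adj p x y}"
      using le \<open>card (star x) \<le> card {y. adj p x y}\<close> unfolding star_def by (metis le_antisym)
    then show ?thesis using \<open>D = star x\<close> eq_card_imp_inj_on by (metis finite)
  qed
  have neg: "- b \<in> D" if "b \<in> D" for b using that unfolding D_def by force
  have neq: "- b \<noteq> b" if "b \<in> D" for b
  proof
    assume b: "- b = b"
    have "b \<in> B \<or> - b \<in> B" using that unfolding D_def by force
    then have "b \<in> B" "- b \<in> B" unfolding b by auto
    then show False using uminus_notin_independent[OF B(1)] by blast
  qed
  have dual: "\<exists>\<alpha>. \<alpha> \<in> harmonic_forms \<and>
      (\<forall>c\<in>D. \<alpha> \<bullet> c = (if c = b then 1 else if c = - b then - 1 else 0))" if b: "b \<in> D" for b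
  proof -
    have *: "\<exists>\<alpha>. \<alpha> \<in> harmonic_forms \<and>
      (\<forall>c\<in>D. \<alpha> \<bullet> c = (if c = b then 1 else if c = - b then - 1 else 0))" if bB: "b \<in> B" for b
    proof -
      obtain \<alpha> where \<alpha>: "\<alpha> \<in> span B" "\<alpha> \<bullet> b = 1" "\<And>c. c \<in> B \<Longrightarrow> c \<noteq> b \<Longrightarrow> \<alpha> \<bullet> c = 0"
        using dual_basis_vector[OF B(1) bB] by metis
      have "\<alpha> \<bullet> c = (if c = b then 1 else if c = - b then - 1 else 0)" if "c \<in> D" for c
      proof (cases "c \<in> B")
        case True
        have "- b \<notin> B" using uminus_notin_independent[OF B(1) bB] .
        then show ?thesis using True \<alpha> by auto
      next
        case False
        then have "- c \<in> B" using that unfolding D_def by auto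
        show ?thesis
        proof (cases "c = - b")
          case True
          then have "\<alpha> \<bullet> c = - 1" using \<alpha>(2) by simp
          moreover have "c \<noteq> b" using False bB by blast
          ultimately show ?thesis using True by simp
        next
          case cb: False
          then have "\<alpha> \<bullet> (- c) = 0" using \<alpha>(3)[OF \<open>- c \<in> B\<close>] by force
          then show ?thesis using cb False bB by auto
        qed
      qed
      then show ?thesis using \<alpha>(1) B(3) by blast
    qed
    show ?thesis
    proof (cases "b \<in> B")
      \<comment> \<open>Then -b lies in B, and the negative of its dual form is dual to b.\<close>
      case False
      then have "- b \<in> B" using b unfolding D_def by auto
      then obtain \<alpha> where \<alpha>: "\<alpha> \<in> harmonic_forms"
        "\<forall>c\<in>D. \<alpha> \<bullet> c = (if c = - b then 1 else if c = - (- b) then - 1 else 0)" using * by blast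
      then show ?thesis
        using subspace_neg[OF subspace_harmonic \<alpha>(1)] neq[OF b] by (intro exI[of _ "- \<alpha>"]) auto
    qed (rule *)
  qed
  then obtain \<theta> where \<theta>: "\<And>b. b \<in> D \<Longrightarrow> \<theta> b \<in> harmonic_forms \<and>
      (\<forall>c\<in>D. \<theta> b \<bullet> c = (if c = b then 1 else if c = - b then - 1 else 0))" by metis
  have "\<exists>y. adj p x y \<and> edge_functional x y = b" if "b \<in> D" for b x
    using that star_D[of x] unfolding star_def by auto
  then obtain T where T: "\<And>b x. b \<in> D \<Longrightarrow> adj p x (T b x) \<and> edge_functional x (T b x) = b" by metis
  have "parallel_frame p d D \<theta> T"
  proof (unfold_locales)
    show "\<exists>b\<in>D. y = T b x" if "adj p x y" for x y
    proof -
      have "edge_functional x y \<in> D" using that star_D[of x] unfolding star_def by blast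
      then show ?thesis using T[of "edge_functional x y" x] star_D[of x] that
        by (intro bexI[of _ "edge_functional x y"]) (auto dest: inj_onD)
    qed
    show "\<theta> b $ x $ T c x = (if c = b then d x (T c x) else if c = - b then - d x (T c x) else 0)"
      if "b \<in> D" "c \<in> D" for b c x
    proof -
      have "\<theta> b $ x $ T c x / d x (T c x) = \<theta> b \<bullet> c"
        using edge_functional(2)[of "\<theta> b" x "T c x"] \<theta>[OF that(1)] T[OF that(2), of x] by simp
      moreover have "d x (T c x) \<noteq> 0" using T[OF that(2), of x] by (auto simp: adj_def)
      ultimately have "\<theta> b $ x $ T c x = (\<theta> b \<bullet> c) * d x (T c x)" by (simp add: divide_eq_eq)
      then show ?thesis using \<theta>[OF that(1)] that(2) by simp
    qed
  qed (use neg neq \<theta> T in \<open>auto, metis T\<close>)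
  then show thesis using that B unfolding D_def by blast
qed

end

context parallel_frame
begin

section \<open>Commuting translations\<close>

lemma T_pos: "b \<in> D \<Longrightarrow> 0 < d x (T b x)"
  using T_adj[of b x] by (simp add: adj_def)

lemma \<theta>_ker: "b \<in> D \<Longrightarrow> \<theta> b \<in> ker_delta1 p d"
  using \<theta>_harmonic harmonic_in_ker by blast

lemma \<theta>_step:
  assumes "b \<in> D" "c \<in> D" "y = T c x"
  shows "\<theta> b $ x $ y = (if c = b then d x y else if c = - b then - d x y else 0)"
  unfolding assms(3) by (rule \<theta>_T[OF assms(1,2)])

text \<open>The reversed edge has some direction c, and \<theta> b takes the value minus the length
  only in direction -b.\<close>

lemma T_uminus [simp]:
  assumes b: "b \<in> D" shows "T (- b) (T b x) = x"
proof -
  have "adj p (T b x) x" using T_adj[OF b] adj_sym by blast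
  then obtain c where c: "c \<in> D" "x = T c (T b x)" using T_surj by blast
  have "\<theta> b $ T b x $ x = - d x (T b x)"
    using form_antisym[OF \<theta>_ker[OF b], of "T b x" x] \<theta>_T[OF b b, of x] by simp
  moreover have "\<theta> b $ T b x $ x = (if c = b then d x (T b x) else if c = - b then - d x (T b x) else 0)"
    using \<theta>_step[OF b c] d_sym[of x "T b x"] by metis
  ultimately have "c = - b" using T_pos[OF b, of x] by (auto split: if_splits)
  then show ?thesis using c(2) by simp
qed

lemma T_uminus' [simp]: "b \<in> D \<Longrightarrow> T b (T (- b) x) = x"
  using T_uminus[of "- b" x] D_uminus by simp

lemma tight_\<theta>_iff: "b \<in> D \<Longrightarrow> tight (\<theta> b) x y \<longleftrightarrow> y = T b x"
proof
  assume b: "b \<in> D" and t: "tight (\<theta> b) x y"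
  then obtain c where c: "c \<in> D" "y = T c x" using T_surj unfolding tight_def by blast
  have "(if c = b then d x y else if c = - b then - d x y else 0) = d x y"
    using \<theta>_step[OF b c] t unfolding tight_def by metis
  then have "c = b" using T_pos[OF c(1), of x] c(2) by (auto split: if_splits)
  then show "y = T b x" using c by simp
next
  assume b: "b \<in> D" and "y = T b x"
  then show "tight (\<theta> b) x y" using T_adj[OF b] \<theta>_T[OF b b, of x] by (simp add: tight_def)
qed

text \<open>\<theta> b and \<theta> c live on different edges, so adding a fraction of the second
  does not raise the norm. The added term serves to break ties among the targets of a transport
  along a b-edge.\<close>

lemma unit_bounded_combination:
  assumes b: "b \<in> D" and c: "c \<in> D" and ne: "c \<noteq> b" "c \<noteq> - b" and s: "0 \<le> s" "s \<le> 1"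
  shows "unit_bounded (\<theta> b + s *\<^sub>R \<theta> c)"
  unfolding unit_bounded_def
proof (intro allI)
  fix x y
  show "(\<theta> b + s *\<^sub>R \<theta> c) $ x $ y \<le> d x y"
  proof (cases "adj p x y")
    case True
    then obtain e where e: "e \<in> D" "y = T e x" using T_surj by blast
    have "s * d x y \<le> 1 * d x y" "0 \<le> s * d x y" using s by (auto intro: mult_right_mono[of s 1, simplified])
    moreover have "- d x y \<le> 0" by simp
    moreover have "- b \<noteq> - c" "b \<noteq> - c" using ne by auto
    ultimately show ?thesis
      using \<theta>_step[OF b e] \<theta>_step[OF c e] ne by auto
  next
    case False
    then show ?thesis using form_nonadj[OF \<theta>_ker] b c by simp
  qed
qed

lemma unit_bounded_\<theta>:
  assumes "b \<in> D" shows "unit_bounded (\<theta> b)"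
  unfolding unit_bounded_def
proof (intro allI)
  fix x y
  show "\<theta> b $ x $ y \<le> d x y"
  proof (cases "adj p x y")
    case True
    then obtain e where e: "e \<in> D" "y = T e x" using T_surj by blast
    have "- d x y \<le> d x y" using d_nonneg[of x y] by linarith
    then show ?thesis using \<theta>_step[OF assms e] by simp
  qed (use form_nonadj[OF \<theta>_ker] assms in simp)
qed

text \<open>For all but finitely many \<open>s\<close> in the unit interval, \<open>T c (T b x)\<close> is the only vertex near
  \<open>T b x\<close> to which \<open>T c x\<close> can be moved tightly for \<open>\<theta> b + s \<theta> c\<close>.\<close>

lemma parallel_transport:
  assumes b: "b \<in> D" and c: "c \<in> D" and ne: "c \<noteq> b" "c \<noteq> - b"
    and y: "y = T b x" and z: "z = T c x" and v: "v = T c y"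
  shows "p x z \<le> p y v" and "d y v = d x z" and "d z v = d x y"
proof -
  note kc = \<theta>_ker[OF c]
  have ne': "b \<noteq> c" "b \<noteq> - c" using ne by auto
  have xy: "adj p x y" and xz: "adj p x z" and yv: "adj p y v" using T_adj b c y z v by auto
  have val: "\<theta> b $ x $ y = d x y" "\<theta> c $ x $ y = 0" "\<theta> b $ x $ z = 0" "\<theta> c $ x $ z = d x z"
    "\<theta> b $ y $ v = 0" "\<theta> c $ y $ v = d y v"
    using \<theta>_T[OF b b, of x] \<theta>_T[OF c b, of x] \<theta>_T[OF b c, of x] \<theta>_T[OF c c, of x]
      \<theta>_T[OF b c, of y] \<theta>_T[OF c c, of y] ne ne' unfolding y z v by auto
  have pos: "0 < d x z" "0 < d x y" using xz xy by (auto simp: adj_def)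
  have neg: "\<theta> c $ y $ w - d x z < 0" if w: "near y w" "w \<noteq> v" for w
  proof (cases "y = w")
    case True
    then show ?thesis using kc pos by simp
  next
    case False
    then obtain e where e: "e \<in> D" "w = T e y" using w(1) T_surj by blast
    then have "e \<noteq> c" using w v by auto
    then have "\<theta> c $ y $ w \<le> 0" using \<theta>_step[OF c e] by simp
    then show ?thesis using pos by linarith
  qed
  \<comment> \<open>For w other than v, tightness of the walk z, x, y, w is a linear equation in s
    whose slope is nonzero by \<open>neg\<close>. Its root is excluded here.\<close>
  define Bad where "Bad = range (\<lambda>w. (d z w - d x y - \<theta> b $ y $ w) / (\<theta> c $ y $ w - d x z))"
  have "finite Bad" by (simp add: Bad_def)
  then have inf: "infinite ({0<..<1} - Bad)"
    using infinite_Ioo[of "0 :: real" 1] by simp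
  have good: "p x z \<le> p y v \<and> d x y + s * (d y v - d x z) = d z v"
    if s: "s \<in> {0<..<1} - Bad" for s
  proof -
    define \<alpha> where "\<alpha> = \<theta> b + s *\<^sub>R \<theta> c"
    have \<alpha>: "\<alpha> \<in> harmonic_forms" unfolding \<alpha>_def
      by (intro subspace_add[OF subspace_harmonic] subspace_scale[OF subspace_harmonic] \<theta>_harmonic b c)
    have nth: "\<alpha> $ u $ w = \<theta> b $ u $ w + s * \<theta> c $ u $ w" for u w by (simp add: \<alpha>_def)
    have bd: "unit_bounded \<alpha>"
      unfolding \<alpha>_def using unit_bounded_combination[OF b c ne] s by simp
    have t: "tight \<alpha> x y" using xy val by (simp add: tight_def nth)
    define S where "S = {w. near y w \<and> \<alpha> $ z $ x + \<alpha> $ x $ y + \<alpha> $ y $ w = d z w}"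
    have zx: "\<alpha> $ z $ x = - s * d x z"
      using form_antisym[OF harmonic_in_ker[OF \<alpha>], of z x] val by (simp add: nth)
    have sub: "S \<subseteq> {v}"
    proof
      fix w assume w: "w \<in> S"
      show "w \<in> {v}"
      proof (rule ccontr)
        assume "w \<notin> {v}"
        then have n: "\<theta> c $ y $ w - d x z < 0" using neg w by (simp add: S_def)
        have "s * (\<theta> c $ y $ w - d x z) = d z w - d x y - \<theta> b $ y $ w"
          using w zx val unfolding S_def nth by (simp add: algebra_simps)
        then have "s = (d z w - d x y - \<theta> b $ y $ w) / (\<theta> c $ y $ w - d x z)"
          using n by (simp add: eq_divide_eq)
        then show False using s unfolding Bad_def by blast
      qed
    qed
    have yS: "y \<notin> S" using sub yv by (auto simp: adj_def)
    have le: "p x z \<le> (\<Sum>w\<in>S. p y w)"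
      by (rule tight_transport[OF harmonic_in_ker[OF \<alpha>] bd t harmonic_divergence[OF \<alpha>] xz S_def yS])
    have "0 < p x z" using xz by (simp add: adj_def)
    then have "S \<noteq> {}" using le by auto
    then have S: "S = {v}" using sub by blast
    then have "v \<in> S" by simp
    then have "d x y + s * (d y v - d x z) = d z v"
      using zx val unfolding S_def nth by (simp add: algebra_simps)
    then show ?thesis using le S by simp
  qed
  \<comment> \<open>Two different values of s separate the constant and the linear part of the
    equation in \<open>good\<close>.\<close>
  obtain s1 where s1: "s1 \<in> {0<..<1} - Bad" using inf by (metis ex_in_conv finite.emptyI)
  have "infinite ({0<..<1} - Bad - {s1})" using inf by simp
  then obtain s2 where s2: "s2 \<in> {0<..<1} - Bad - {s1}" by (metis ex_in_conv finite.emptyI)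
  show "p x z \<le> p y v" using good[OF s1] by simp
  have "s1 * (d y v - d x z) = s2 * (d y v - d x z)"
  proof -
    have "s2 \<in> {0<..<1} - Bad" using s2 by blast
    then show ?thesis using good[OF s1] good[of s2] by linarith
  qed
  then show "d y v = d x z" unfolding mult_cancel_right using s2 by auto
  then show "d z v = d x y" using good[OF s1] by simp
qed

section \<open>Tracks of edges in a fixed direction\<close>

definition track_length :: "real^'v^'v \<Rightarrow> 'v \<Rightarrow> nat \<Rightarrow> real" where
  "track_length b x n = (\<Sum>l<n. d ((T b ^^ l) x) ((T b ^^ Suc l) x))"

lemma track_length_add: "track_length b x (m + n) = track_length b x m + track_length b ((T b ^^ m) x) n"
proof (induction n)
  case (Suc n)
  have "(T b ^^ (m + n)) x = (T b ^^ n) ((T b ^^ m) x)" by (simp add: add.commute[of m] funpow_add)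
  then show ?case using Suc by (simp add: track_length_def)
qed (simp add: track_length_def)

lemma track_length_strict_mono: "b \<in> D \<Longrightarrow> m < n \<Longrightarrow> track_length b x m < track_length b x n"
proof (induction n)
  case (Suc n)
  have "track_length b x n < track_length b x (Suc n)"
    using T_pos[OF Suc.prems(1), of "(T b ^^ n) x"] by (simp add: track_length_def)
  then show ?case using Suc by (cases "m = n") auto
qed simp

lemma tight_path_track:
  assumes b: "b \<in> D"
  shows "successively (tight (\<theta> b)) g \<Longrightarrow> g \<noteq> [] \<Longrightarrow>
    \<exists>k. last g = (T b ^^ k) (hd g) \<and> path_length d g = track_length b (hd g) k"
proof (induction g)
  case (Cons a g)
  show ?case
  proof (cases g)
    case Nil
    then show ?thesis by (intro exI[of _ 0]) (simp add: track_length_def)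
  next
    case C: (Cons a' g')
    have a': "a' = T b a" using Cons.prems C tight_\<theta>_iff[OF b] by simp
    obtain k where k: "last g = (T b ^^ k) a'" "path_length d g = track_length b a' k"
      using Cons C by auto
    have "last (a # g) = (T b ^^ Suc k) a" using k(1) C a' by (simp add: funpow_swap1)
    moreover have "path_length d (a # g) = track_length b a (Suc k)"
      using k(2) C a' track_length_add[of b a 1 k] by (simp add: track_length_def)
    ultimately show ?thesis by (metis list.sel(1))
  qed
qed simp

text \<open>Edges in direction c have value 0 under \<theta> b, so the walk T c x, x, T b x, T c (T
  b x) is tight for \<theta> b. Its ends are thus joined by a tight geodesic, which is a track in
  direction b. So far the track may have several edges.\<close>

lemma translate_step:
  assumes b: "b \<in> D" and c: "c \<in> D" and ne: "c \<noteq> b" "c \<noteq> - b"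
  shows "\<exists>k\<ge>1. T c (T b x) = (T b ^^ k) (T c x) \<and> track_length b (T c x) k = d x (T b x)"
proof -
  define y where "y = T b x"
  define z where "z = T c x"
  define v where "v = T c y"
  note pt = parallel_transport[OF b c ne y_def z_def v_def]
  note kb = \<theta>_ker[OF b]
  have xy: "adj p x y" and xz: "adj p x z" and yv: "adj p y v"
    using T_adj b c y_def z_def v_def by auto
  have nr: "near z x" "near x y" "near y v" using xy xz yv adj_sym by auto
  have "\<theta> b $ x $ z = 0" "\<theta> b $ x $ y = d x y" "\<theta> b $ y $ v = 0"
    using \<theta>_T[OF b c, of x] \<theta>_T[OF b b, of x] \<theta>_T[OF b c, of y] ne unfolding y_def z_def v_def by auto
  then have "\<theta> b $ z $ x + \<theta> b $ x $ y + \<theta> b $ y $ v = d z v"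
    using form_antisym[OF kb, of z x] pt(3) by simp
  then obtain g where g: "is_geodesic p d g" "hd g = z" "last g = v" "successively (tight (\<theta> b)) g"
    using short_walk_tight[OF kb unit_bounded_\<theta>[OF b] nr] by metis
  obtain k where k: "v = (T b ^^ k) z" "path_length d g = track_length b z k"
    using tight_path_track[OF b g(4) geodesic_not_Nil[OF g(1)]] g by auto
  have len: "track_length b z k = d x y" using k(2) g pt(3) by (simp add: is_geodesic_def)
  have "0 < d x y" using xy by (simp add: adj_def)
  then have "k \<noteq> 0" using len by (cases k) (auto simp: track_length_def)
  then show ?thesis using k(1) len unfolding v_def y_def z_def by (intro exI[of _ k]) auto
qed

text \<open>Each edge is replaced by at least one edge of the same total length, so translation
  keeps the length and cannot decrease the number of edges.\<close>

lemma translate_track: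
  assumes b: "b \<in> D" and c: "c \<in> D" and ne: "c \<noteq> b" "c \<noteq> - b"
  shows "\<exists>N\<ge>n. T c ((T b ^^ n) x) = (T b ^^ N) (T c x) \<and> track_length b (T c x) N = track_length b x n"
proof (induction n)
  case 0
  show ?case by (intro exI[of _ 0]) (simp add: track_length_def)
next
  case (Suc n)
  then obtain N where N: "n \<le> N" "T c ((T b ^^ n) x) = (T b ^^ N) (T c x)"
    "track_length b (T c x) N = track_length b x n" by blast
  obtain k where k: "1 \<le> k" "T c (T b ((T b ^^ n) x)) = (T b ^^ k) (T c ((T b ^^ n) x))"
    "track_length b (T c ((T b ^^ n) x)) k = d ((T b ^^ n) x) (T b ((T b ^^ n) x))"
    using translate_step[OF b c ne, of "(T b ^^ n) x"] by blast
  have "T c ((T b ^^ Suc n) x) = (T b ^^ (k + N)) (T c x)" using k(2) N(2) by (simp add: funpow_add)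
  moreover have "track_length b (T c x) (k + N) = track_length b x (Suc n)"
    using track_length_add[of b "T c x" N k] N k(3) by (simp add: add.commute track_length_def)
  ultimately show ?case using N(1) k(1) by (intro exI[of _ "k + N"]) auto
qed

text \<open>Translating the track back by \<open>-c\<close> cannot shorten it, so it has a single edge.\<close>

lemma T_commute:
  assumes b: "b \<in> D" and c: "c \<in> D"
  shows "T c (T b x) = T b (T c x)"
proof (cases "c = b \<or> c = - b")
  case True
  then show ?thesis using b by auto
next
  case False
  then have ne: "c \<noteq> b" "c \<noteq> - b" and ne': "- c \<noteq> b" "- c \<noteq> - b" by auto
  obtain k where k: "1 \<le> k" "T c (T b x) = (T b ^^ k) (T c x)"
    "track_length b (T c x) k = d x (T b x)" using translate_step[OF b c ne] by blast
  obtain N where N: "k \<le> N" "T (- c) ((T b ^^ k) (T c x)) = (T b ^^ N) (T (- c) (T c x))"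
    "track_length b (T (- c) (T c x)) N = track_length b (T c x) k"
    using translate_track[OF b D_uminus[OF c] ne', of k "T c x"] by blast
  \<comment> \<open>Back at x, the track of N edges has the length of its first edge alone.\<close>
  have "track_length b x N = track_length b x 1"
    using N(3) k(3) c by (simp add: track_length_def)
  then have "\<not> 1 < N" using track_length_strict_mono[OF b, of 1 N x] by auto
  then have "k = 1" using N(1) k(1) by simp
  then show ?thesis using k(2) by simp
qed

text \<open>Transport gives only an inequality; transporting back along -b gives the other
  one.\<close>

lemma p_translate:
  assumes b: "b \<in> D" and c: "c \<in> D" and ne: "c \<noteq> b" "c \<noteq> - b"
  shows "p (T b x) (T c (T b x)) = p x (T c x)"
proof (rule antisym)
  show "p x (T c x) \<le> p (T b x) (T c (T b x))"
    by (rule parallel_transport(1)[OF b c ne refl refl refl])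
  have "c \<noteq> - b" "c \<noteq> - (- b)" using ne by auto
  from parallel_transport(1)[OF D_uminus[OF b] c this refl refl refl, of "T b x"]
  show "p (T b x) (T c (T b x)) \<le> p x (T c x)" using b by simp
qed

lemma d_translate:
  assumes b: "b \<in> D" and c: "c \<in> D" and ne: "c \<noteq> b" "c \<noteq> - b"
  shows "d (T b x) (T c (T b x)) = d x (T c x)"
  by (rule parallel_transport(2)[OF b c ne refl refl refl])

text \<open>The constant is the divergence of the harmonic form \<theta> b, to which only the edges
  in directions b and -b contribute.\<close>

lemma drift_const:
  assumes b: "b \<in> D"
  shows "\<exists>k. \<forall>x. p x (T b x) * d x (T b x) - p x (T (- b) x) * d x (T (- b) x) = k"
proof -
  have nb: "- b \<in> D" using D_uminus[OF b] .
  have "divergence (\<theta> b) x = p x (T b x) * d x (T b x) - p x (T (- b) x) * d x (T (- b) x)" for x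
  proof -
    have neq: "T b x \<noteq> T (- b) x" using T_inj[OF b nb] D_neq[OF b] by metis
    have zero: "p x y * \<theta> b $ x $ y = 0" if "y \<notin> {T b x, T (- b) x}" for y
    proof (cases "adj p x y")
      case True
      then obtain c where c: "c \<in> D" "y = T c x" using T_surj by blast
      then have "c \<noteq> b" "c \<noteq> - b" using that by auto
      then show ?thesis using \<theta>_T[OF b c(1), of x] c(2) by simp
    qed (simp add: form_nonadj[OF \<theta>_ker[OF b]])
    have "divergence (\<theta> b) x = (\<Sum>y\<in>{T b x, T (- b) x}. p x y * \<theta> b $ x $ y)"
      unfolding divergence_def using zero by (intro sum.mono_neutral_right) auto
    then show ?thesis using neq \<theta>_T[OF b b, of x] \<theta>_T[OF b nb, of x] D_neq[OF b] by simp
  qed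
  then show ?thesis using harmonic_divergence[OF \<theta>_harmonic[OF b]] by metis
qed

end

context parallel_frame
begin

section \<open>The translation group\<close>

text \<open>The monoid generated by the translations. It is a group because the inverse of
  \<open>T b\<close> is \<open>T (- b)\<close>.\<close>

inductive_set translation_maps :: "('v \<Rightarrow> 'v) set" where
  id: "id \<in> translation_maps"
| step: "t \<in> translation_maps \<Longrightarrow> b \<in> D \<Longrightarrow> T b \<circ> t \<in> translation_maps"

lemma T_in_translation_maps: "b \<in> D \<Longrightarrow> T b \<in> translation_maps"
  using translation_maps.step[OF translation_maps.id, of b] by simp

lemma translation_maps_commute_T: "t \<in> translation_maps \<Longrightarrow> b \<in> D \<Longrightarrow> t (T b x) = T b (t x)"
  by (induction t rule: translation_maps.induct) (auto simp: T_commute)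

lemma translation_maps_commute:
  "t \<in> translation_maps \<Longrightarrow> u \<in> translation_maps \<Longrightarrow> t (u x) = u (t x)"
  by (induction t rule: translation_maps.induct) (auto simp: translation_maps_commute_T)

lemma translation_maps_comp:
  "t \<in> translation_maps \<Longrightarrow> u \<in> translation_maps \<Longrightarrow> t \<circ> u \<in> translation_maps"
  by (induction t rule: translation_maps.induct) (auto simp: comp_assoc intro: translation_maps.step)

lemma translation_maps_transitive: "\<exists>t\<in>translation_maps. t x = y"
proof (rule connected_induct[where P = "\<lambda>y. \<exists>t\<in>translation_maps. t x = y", of x])
  show "\<exists>t\<in>translation_maps. t x = x" using translation_maps.id by (intro bexI[of _ id]) auto
next
  fix u v assume "\<exists>t\<in>translation_maps. t x = u" "adj p u v"
  then obtain t b where "t \<in> translation_maps" "t x = u" "b \<in> D" "v = T b u" using T_surj by blast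
  then show "\<exists>t\<in>translation_maps. t x = v"
    using translation_maps.step[of t b] by (intro bexI[of _ "T b \<circ> t"]) auto
qed

lemma translation_maps_inverse: "t \<in> translation_maps \<Longrightarrow> \<exists>u\<in>translation_maps. \<forall>x. u (t x) = x"
proof (induction t rule: translation_maps.induct)
  case id
  then show ?case using translation_maps.id by (intro bexI[of _ id]) auto
next
  case (step t b)
  then obtain u where u: "u \<in> translation_maps" "\<And>x. u (t x) = x" by blast
  have "u \<circ> T (- b) \<in> translation_maps"
    using translation_maps_comp[OF u(1)] T_in_translation_maps D_uminus step by blast
  then show ?case using u(2) step by (intro bexI[of _ "u \<circ> T (- b)"]) auto
qed

text \<open>A transitive action by commuting maps is free: the value at q fixes the value at s q for
  each translation s.\<close>

lemma translation_maps_regular: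
  assumes "t \<in> translation_maps" "u \<in> translation_maps" "t q = u q" shows "t = u"
proof
  fix x
  obtain s where "s \<in> translation_maps" "s q = x" using translation_maps_transitive by blast
  then show "t x = u x" using assms translation_maps_commute by metis
qed

definition translation_to :: "'v \<Rightarrow> 'v \<Rightarrow> 'v \<Rightarrow> 'v" where
  "translation_to q v = (SOME t. t \<in> translation_maps \<and> t q = v)"

lemma translation_to: "translation_to q v \<in> translation_maps" "translation_to q v q = v"
  using someI_ex[of "\<lambda>t. t \<in> translation_maps \<and> t q = v"] translation_maps_transitive[of q v]
  unfolding translation_to_def by blast+

lemma translation_to_eq: "t \<in> translation_maps \<Longrightarrow> translation_to q (t q) = t"
  using translation_maps_regular translation_to by metis

text \<open>Evaluation at q identifies the regular group of translations with the vertex set; this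
  is the group structure carried over.\<close>

definition translation_group :: "'v \<Rightarrow> 'v monoid" where
  "translation_group q = \<lparr>carrier = UNIV, mult = translation_to q, one = q\<rparr>"

lemma translation_group_simps [simp]:
  "carrier (translation_group q) = UNIV"
  "u \<otimes>\<^bsub>translation_group q\<^esub> v = translation_to q u v"
  "\<one>\<^bsub>translation_group q\<^esub> = q"
  by (simp_all add: translation_group_def)

lemma comm_group_translation_group: "comm_group (translation_group q)"
proof (rule comm_groupI)
  fix x y z
  show "x \<otimes>\<^bsub>translation_group q\<^esub> y \<otimes>\<^bsub>translation_group q\<^esub> z
      = x \<otimes>\<^bsub>translation_group q\<^esub> (y \<otimes>\<^bsub>translation_group q\<^esub> z)"
  proof -
    have "translation_to q x \<circ> translation_to q y \<in> translation_maps"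
      using translation_maps_comp translation_to(1) by blast
    moreover have "translation_to q x y = (translation_to q x \<circ> translation_to q y) q"
      by (simp add: translation_to(2))
    ultimately have "translation_to q (translation_to q x y) = translation_to q x \<circ> translation_to q y"
      using translation_to_eq by metis
    then show ?thesis by simp
  qed
  show "x \<otimes>\<^bsub>translation_group q\<^esub> y = y \<otimes>\<^bsub>translation_group q\<^esub> x"
    using translation_maps_commute[OF translation_to(1) translation_to(1), of q x q y q]
    by (simp add: translation_to(2))
  show "\<one>\<^bsub>translation_group q\<^esub> \<otimes>\<^bsub>translation_group q\<^esub> x = x"
    using translation_to_eq[OF translation_maps.id, of q] by simp
  obtain u where u: "u \<in> translation_maps" "\<And>w. u (translation_to q x w) = w"
    using translation_maps_inverse[OF translation_to(1)] by blast
  have "translation_to q (u q) x = q"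
    using translation_to_eq[OF u(1)] u(2)[of q] by (simp add: translation_to(2))
  then show "\<exists>y\<in>carrier (translation_group q). y \<otimes>\<^bsub>translation_group q\<^esub> x = \<one>\<^bsub>translation_group q\<^esub>"
    by auto
qed simp_all

lemma mult_T: "b \<in> D \<Longrightarrow> T b q \<otimes>\<^bsub>translation_group q\<^esub> x = T b x"
  using translation_to_eq[OF T_in_translation_maps] by simp

lemma inv_T: "b \<in> D \<Longrightarrow> inv\<^bsub>translation_group q\<^esub> (T b q) = T (- b) q"
  using group.inv_equality[of "translation_group q" "T (- b) q" "T b q"]
    comm_group_translation_group[of q] mult_T[of "- b" q] D_uminus
  by (simp add: comm_group_def)

lemma generate_T:
  assumes "\<And>b. b \<in> D \<Longrightarrow> b \<in> B \<or> - b \<in> B" and "B \<subseteq> D"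
  shows "generate (translation_group q) ((\<lambda>b. T b q) ` B) = UNIV"
proof -
  let ?G = "translation_group q" and ?A = "(\<lambda>b. T b q) ` B"
  have "t q \<in> generate ?G ?A" if "t \<in> translation_maps" for t
    using that
  proof (induction t rule: translation_maps.induct)
    case id
    then show ?case using generate.one[of ?G ?A] by simp
  next
    case (step t b)
    have "T b q \<in> generate ?G ?A"
    proof (cases "b \<in> B")
      case True
      then show ?thesis by (intro generate.incl) auto
    next
      case False
      then have "- b \<in> B" using assms(1) step by blast
      then have "inv\<^bsub>?G\<^esub> (T (- b) q) \<in> generate ?G ?A" by (intro generate.inv) auto
      then show ?thesis using inv_T[of "- b" q] D_uminus step by simp
    qed
    then have "T b q \<otimes>\<^bsub>?G\<^esub> t q \<in> generate ?G ?A" using step by (intro generate.eng)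
    then show ?case using mult_T[of b q] step by simp
  qed
  then show ?thesis using translation_maps_transitive[of q] by (metis UNIV_eq_I)
qed

end

context path_metric_chain
begin

section \<open>Abelian Cayley graphs\<close>

text \<open>For t other than s and its inverse, the terms at s x and at x have the same weight, and
  f rises from t x to t s x by at most the amount by which it rises from x to s x. The remaining two
  terms cannot be matched one by one, only their sum, through the drift.\<close>

lemma laplacian_mono_translation:
  fixes G (structure)
  assumes G: "comm_group G" "carrier G = UNIV"
    and A: "\<And>x y. x \<noteq> y \<Longrightarrow> 0 < p x y \<longleftrightarrow> (\<exists>t\<in>A. y = t \<otimes> x)"
    and s: "s \<in> A" "inv s \<in> A"
    and drift: "\<And>x. p x (s \<otimes> x) * d x (s \<otimes> x) - p x (inv s \<otimes> x) * d x (inv s \<otimes> x) = k"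
    and other: "\<And>t x. t \<in> A \<Longrightarrow> t \<noteq> s \<Longrightarrow> t \<noteq> inv s \<Longrightarrow>
      p x (t \<otimes> x) = p (s \<otimes> x) (t \<otimes> (s \<otimes> x)) \<and> d (t \<otimes> x) (t \<otimes> (s \<otimes> x)) = d x (s \<otimes> x)"
    and f: "lip f" "f (s \<otimes> x) - f x = d x (s \<otimes> x)"
  shows "laplacian p f (s \<otimes> x) \<le> laplacian p f x"
proof -
  interpret comm_group G by (rule G(1))
  define F where "F x t = p x (t \<otimes> x) * (f (t \<otimes> x) - f x)" for x t
  have lap: "laplacian p f x = (\<Sum>t\<in>A. F x t)" for x
  proof -
    have inj: "inj_on (\<lambda>t. t \<otimes> x) A" using G(2) by (intro inj_onI) simp
    have "laplacian p f x = (\<Sum>y\<in>(\<lambda>t. t \<otimes> x) ` A. p x y * (f y - f x))"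
      unfolding laplacian_def
    proof (rule sum.mono_neutral_right)
      show "\<forall>y\<in>UNIV - (\<lambda>t. t \<otimes> x) ` A. p x y * (f y - f x) = 0"
      proof
        fix y assume "y \<in> UNIV - (\<lambda>t. t \<otimes> x) ` A"
        then have "x = y \<or> \<not> 0 < p x y" using A[of x y] by blast
        then show "p x y * (f y - f x) = 0" using p_nonneg[of x y] by (auto simp: less_le)
      qed
    qed simp_all
    then show ?thesis unfolding F_def by (simp add: sum.reindex[OF inj])
  qed
  let ?A' = "A - {s, inv s}" and ?y = "s \<otimes> x"
  have split: "(\<Sum>t\<in>A. F u t) = (\<Sum>t\<in>?A'. F u t) + (\<Sum>t\<in>{s, inv s}. F u t)" for u
    using s by (intro sum.subset_diff) auto
  have "(\<Sum>t\<in>?A'. F ?y t) \<le> (\<Sum>t\<in>?A'. F x t)"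
  proof (rule sum_mono)
    fix t assume t: "t \<in> ?A'"
    then have eqs: "p x (t \<otimes> x) = p ?y (t \<otimes> ?y)" "d (t \<otimes> x) (t \<otimes> ?y) = d x ?y"
      using other[of t x] by blast+
    have "f (t \<otimes> ?y) - f (t \<otimes> x) \<le> d (t \<otimes> ?y) (t \<otimes> x)" using f(1) by blast
    then have "f (t \<otimes> ?y) - f ?y \<le> f (t \<otimes> x) - f x"
      using eqs(2) f(2) d_sym[of "t \<otimes> ?y" "t \<otimes> x"] by linarith
    then show "F ?y t \<le> F x t" unfolding F_def eqs(1) by (rule mult_left_mono) simp
  qed
  moreover have "(\<Sum>t\<in>{s, inv s}. F ?y t) \<le> (\<Sum>t\<in>{s, inv s}. F x t)"
  proof -
    have inv_y: "inv s \<otimes> ?y = x" using G(2) by (simp add: m_assoc[symmetric])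
    have Fx: "F x s = p x ?y * d x ?y" using f(2) by (simp add: F_def)
    have Fy: "F ?y (inv s) = - (p ?y x * d ?y x)"
    proof -
      have "f x - f ?y = - d ?y x" using f(2) d_sym[of x ?y] by linarith
      then show ?thesis unfolding F_def inv_y by simp
    qed
    show ?thesis
    proof (cases "s = inv s")
      \<comment> \<open>For an involution the two terms are one and the same, and signs alone
        decide.\<close>
      case True
      then have "F ?y s = - (p ?y x * d ?y x)" using Fy by simp
      also have "\<dots> \<le> 0" by simp
      also have "0 \<le> F x s" unfolding Fx by simp
      finally show ?thesis using True by auto
    next
      case False
      have "f x - f (inv s \<otimes> x) \<le> d x (inv s \<otimes> x)" using f(1) by blast
      then have "- d x (inv s \<otimes> x) \<le> f (inv s \<otimes> x) - f x" by linarith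
      then have "p x (inv s \<otimes> x) * - d x (inv s \<otimes> x) \<le> F x (inv s)"
        unfolding F_def by (rule mult_left_mono) simp
      then have 1: "- (p x (inv s \<otimes> x) * d x (inv s \<otimes> x)) \<le> F x (inv s)" by simp
      have "f (s \<otimes> ?y) - f ?y \<le> d ?y (s \<otimes> ?y)" using f(1) d_sym by metis
      then have 2: "F ?y s \<le> p ?y (s \<otimes> ?y) * d ?y (s \<otimes> ?y)"
        unfolding F_def by (rule mult_left_mono) simp
      \<comment> \<open>The two terms at s x sum to at most k and the two at x to at least
        k.\<close>
      have "p ?y (s \<otimes> ?y) * d ?y (s \<otimes> ?y) - p ?y x * d ?y x = k" using drift[of ?y] inv_y by simp
      then have "F ?y s + F ?y (inv s) \<le> F x s + F x (inv s)"
        using 1 2 Fx Fy drift[of x] by linarith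
      then show ?thesis using False by simp
    qed
  qed
  ultimately show ?thesis unfolding lap split by linarith
qed

end

text \<open>Condition (a) concerns pairs off the diagonal, because p x x > 0 is allowed and gives no
  edge.\<close>

theorem theorem4p22:
  fixes p :: "'v::finite \<Rightarrow> 'v \<Rightarrow> real" and d :: "'v \<Rightarrow> 'v \<Rightarrow> real"
  assumes "markov_chain p"
    and "irreducible_chain p"
    and "symmetric_support p"
    and "general_path_distance p d"
  shows "(nonneg_ollivier_curvature p d \<and> real (betti1 p d) = real (deg_max p) / 2) \<longleftrightarrow>
    (\<exists>(G :: 'v monoid) (m :: nat) (a :: nat \<Rightarrow> 'v).
       comm_group G \<and> carrier G = UNIV \<and>
       generate G (a ` {1..m}) = carrier G \<and>
       (\<forall>i\<in>{1..m}. \<forall>j\<in>{1..m}. i \<noteq> j \<longrightarrow>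
          (\<forall>e\<in>{-1, 1::int}. a i \<noteq> a j [^]\<^bsub>G\<^esub> e)) \<and>
       (\<forall>x y. x \<noteq> y \<longrightarrow>
          (0 < p x y \<longleftrightarrow>
           y \<in> {(a i [^]\<^bsub>G\<^esub> e) \<otimes>\<^bsub>G\<^esub> x | i (e::int). i \<in> {1..m} \<and> e \<in> {-1, 1}})) \<and>
       (\<forall>i\<in>{1..m}. \<exists>c::real. \<forall>x.
          p x (a i \<otimes>\<^bsub>G\<^esub> x) * d x (a i \<otimes>\<^bsub>G\<^esub> x)
          - p x (inv\<^bsub>G\<^esub> (a i) \<otimes>\<^bsub>G\<^esub> x) * d x (inv\<^bsub>G\<^esub> (a i) \<otimes>\<^bsub>G\<^esub> x) = c) \<and>
       (\<forall>x. \<forall>i\<in>{1..m}. \<forall>j\<in>{1..m}. i \<noteq> j \<longrightarrow>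
          (\<forall>e1\<in>{-1, 1::int}. \<forall>e2\<in>{-1, 1::int}.
             p x ((a i [^]\<^bsub>G\<^esub> e1) \<otimes>\<^bsub>G\<^esub> x)
             = p ((a j [^]\<^bsub>G\<^esub> e2) \<otimes>\<^bsub>G\<^esub> x)
                 ((a i [^]\<^bsub>G\<^esub> e1) \<otimes>\<^bsub>G\<^esub> (a j [^]\<^bsub>G\<^esub> e2) \<otimes>\<^bsub>G\<^esub> x))) \<and>
       (\<forall>x. \<forall>i\<in>{1..m}. \<forall>j\<in>{1..m}. i \<noteq> j \<longrightarrow>
          d x (a i \<otimes>\<^bsub>G\<^esub> x) = d (a j \<otimes>\<^bsub>G\<^esub> x) (a j \<otimes>\<^bsub>G\<^esub> a i \<otimes>\<^bsub>G\<^esub> x)) \<and>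
       betti1 p d = m)"
proof -
  interpret path_metric_chain p d by unfold_locales (fact assms)+
  show ?thesis
  proof (rule iffI, goal_cases)
    case 1
    then interpret nonneg_curved_chain p d by unfold_locales blast
    have "real (deg_max p) = real (2 * betti1 p d)" using 1 by simp
    then have "deg_max p = 2 * betti1 p d" by (rule of_nat_eq_iff[THEN iffD1])
    then obtain B \<theta> T where B: "independent B" "finite B" "card B = betti1 p d"
      and frame: "parallel_frame p d (B \<union> uminus ` B) \<theta> T"
      using parallel_frame_exists by metis
    define m where "m = betti1 p d"
    define D where "D = B \<union> uminus ` B"
    interpret parallel_frame p d D \<theta> T using frame unfolding D_def .
    obtain h where h: "bij_betw h {1..m} B"
      using ex_bij_betw_nat_finite_1[OF B(2)] B(3) unfolding m_def by metis
    \<comment> \<open>An arbitrary vertex becomes the unit of the group.\<close>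
    fix q :: 'v
    let ?G = "translation_group q"
    define a where "a i = T (h i) q" for i
    define \<sigma> where "\<sigma> i e = (if e = 1 then h i else - h i)" for i and e :: int
    interpret G: comm_group ?G by (rule comm_group_translation_group)
    have hB: "h i \<in> B" if "i \<in> {1..m}" for i using h that by (auto dest: bij_betwE)
    have hD: "h i \<in> D" "- h i \<in> D" "\<sigma> i e \<in> D" if "i \<in> {1..m}" for i e
      using hB[OF that] by (auto simp: D_def \<sigma>_def)
    have a_pow: "a i [^]\<^bsub>?G\<^esub> e = T (\<sigma> i e) q" if "i \<in> {1..m}" "e \<in> {-1, 1}" for i and e :: int
      using that inv_T[OF hD(1)[OF that(1)]] G.int_pow_neg[of "a i" 1] G.int_pow_1[of "a i"]
      by (auto simp: a_def \<sigma>_def)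
    have mult_a: "a i [^]\<^bsub>?G\<^esub> e \<otimes>\<^bsub>?G\<^esub> x = T (\<sigma> i e) x" if "i \<in> {1..m}" "e \<in> {-1, 1}" for i x and e :: int
      using a_pow[OF that] mult_T[OF hD(3)[OF that(1)]] by simp
    have mult_a1: "a i \<otimes>\<^bsub>?G\<^esub> x = T (h i) x" "inv\<^bsub>?G\<^esub> (a i) \<otimes>\<^bsub>?G\<^esub> x = T (- h i) x"
      if "i \<in> {1..m}" for i x
      using mult_T[OF hD(1)[OF that]] mult_T[OF hD(2)[OF that]] inv_T[OF hD(1)[OF that]]
      by (auto simp: a_def)
    have \<sigma>_ne: "\<sigma> i e \<noteq> \<sigma> j e'" "\<sigma> i e \<noteq> - \<sigma> j e'"
      if ij: "i \<in> {1..m}" "j \<in> {1..m}" "i \<noteq> j" for i j and e e' :: int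
    proof -
      have "h i \<noteq> h j" using inj_on_contraD[OF bij_betw_imp_inj_on[OF h]] ij by blast
      moreover have "h i \<noteq> - h j" using uminus_notin_independent[OF B(1) hB[OF ij(2)]] hB[OF ij(1)] by metis
      moreover have "- h i \<noteq> h j" using uminus_notin_independent[OF B(1) hB[OF ij(1)]] hB[OF ij(2)] by metis
      ultimately show "\<sigma> i e \<noteq> \<sigma> j e'" "\<sigma> i e \<noteq> - \<sigma> j e'" by (auto simp: \<sigma>_def)
    qed
    have adj_iff: "adj p x y \<longleftrightarrow> (\<exists>i\<in>{1..m}. \<exists>e\<in>{-1, 1::int}. y = T (\<sigma> i e) x)" for x y
    proof
      assume "adj p x y"
      then obtain b where b: "b \<in> D" "y = T b x" using T_surj by blast
      have im: "B = h ` {1..m}" using h by (simp add: bij_betw_def)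
      from b(1) consider i where "i \<in> {1..m}" "b = h i" | i where "i \<in> {1..m}" "b = - h i"
        unfolding D_def im by blast
      then show "\<exists>i\<in>{1..m}. \<exists>e\<in>{-1, 1::int}. y = T (\<sigma> i e) x"
      proof cases
        case (1 i)
        then show ?thesis using b(2) by (intro bexI[of _ i] bexI[of _ "1 :: int"]) (auto simp: \<sigma>_def)
      next
        case (2 i)
        then show ?thesis using b(2) by (intro bexI[of _ i] bexI[of _ "- 1 :: int"]) (auto simp: \<sigma>_def)
      qed
    next
      assume "\<exists>i\<in>{1..m}. \<exists>e\<in>{-1, 1::int}. y = T (\<sigma> i e) x"
      then show "adj p x y" using T_adj hD(3) by blast
    qed
    show ?case
    proof (intro exI[of _ ?G] exI[of _ m] exI[of _ a] conjI ballI allI impI)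
      show "comm_group ?G" by (rule comm_group_translation_group)
      show "carrier ?G = UNIV" by simp
      have "a ` {1..m} = (\<lambda>b. T b q) ` B"
        using h by (force simp: a_def bij_betw_def)
      moreover have "generate ?G ((\<lambda>b. T b q) ` B) = UNIV"
        by (rule generate_T) (auto simp: D_def)
      ultimately show "generate ?G (a ` {1..m}) = carrier ?G" by simp
    next
      fix i j and e :: int assume i: "i \<in> {1..m}" and j: "j \<in> {1..m}" and ne: "i \<noteq> j" and e: "e \<in> {-1, 1}"
      have "a i = T (\<sigma> i 1) q" by (simp add: a_def \<sigma>_def)
      then show "a i \<noteq> a j [^]\<^bsub>?G\<^esub> e"
        using a_pow[OF j e] T_inj[OF hD(3)[OF i] hD(3)[OF j]] \<sigma>_ne(1)[OF i j ne] by metis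
    next
      fix x y :: 'v assume "x \<noteq> y"
      then have "0 < p x y \<longleftrightarrow> adj p x y" by (simp add: adj_def)
      also have "\<dots> \<longleftrightarrow> (\<exists>i\<in>{1..m}. \<exists>e\<in>{-1, 1::int}. y = (a i [^]\<^bsub>?G\<^esub> e) \<otimes>\<^bsub>?G\<^esub> x)"
        unfolding adj_iff using mult_a by (intro bex_cong refl) (simp only: mult_a)
      also have "\<dots> \<longleftrightarrow> y \<in> {(a i [^]\<^bsub>?G\<^esub> e) \<otimes>\<^bsub>?G\<^esub> x | i (e::int). i \<in> {1..m} \<and> e \<in> {-1, 1}}"
        by blast
      finally show "0 < p x y \<longleftrightarrow>
        y \<in> {(a i [^]\<^bsub>?G\<^esub> e) \<otimes>\<^bsub>?G\<^esub> x | i (e::int). i \<in> {1..m} \<and> e \<in> {-1, 1}}" .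
    next
      fix i assume i: "i \<in> {1..m}"
      show "\<exists>c::real. \<forall>x. p x (a i \<otimes>\<^bsub>?G\<^esub> x) * d x (a i \<otimes>\<^bsub>?G\<^esub> x)
          - p x (inv\<^bsub>?G\<^esub> (a i) \<otimes>\<^bsub>?G\<^esub> x) * d x (inv\<^bsub>?G\<^esub> (a i) \<otimes>\<^bsub>?G\<^esub> x) = c"
        unfolding mult_a1[OF i] by (rule drift_const[OF hD(1)[OF i]])
    next
      fix x i j and e1 e2 :: int
      assume i: "i \<in> {1..m}" and j: "j \<in> {1..m}" and ne: "i \<noteq> j"
        and e1: "e1 \<in> {-1, 1}" and e2: "e2 \<in> {-1, 1}"
      \<comment> \<open>The product in the goal is bracketed to the left, so it is reassociated
        before the factors can act as translations.\<close>
      have "(a i [^]\<^bsub>?G\<^esub> e1) \<otimes>\<^bsub>?G\<^esub> (a j [^]\<^bsub>?G\<^esub> e2) \<otimes>\<^bsub>?G\<^esub> x = T (\<sigma> i e1) (T (\<sigma> j e2) x)"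
        using G.m_assoc[of "a i [^]\<^bsub>?G\<^esub> e1" "a j [^]\<^bsub>?G\<^esub> e2" x] mult_a[OF i e1] mult_a[OF j e2]
        by (simp del: translation_group_simps(2))
      then show "p x ((a i [^]\<^bsub>?G\<^esub> e1) \<otimes>\<^bsub>?G\<^esub> x)
          = p ((a j [^]\<^bsub>?G\<^esub> e2) \<otimes>\<^bsub>?G\<^esub> x) ((a i [^]\<^bsub>?G\<^esub> e1) \<otimes>\<^bsub>?G\<^esub> (a j [^]\<^bsub>?G\<^esub> e2) \<otimes>\<^bsub>?G\<^esub> x)"
        using p_translate[OF hD(3)[OF j] hD(3)[OF i] \<sigma>_ne[OF i j ne], of e2 x e1]
        unfolding mult_a[OF i e1] mult_a[OF j e2] by simp
    next
      fix x i j
      assume i: "i \<in> {1..m}" and j: "j \<in> {1..m}" and ne: "i \<noteq> j"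
      have "a j \<otimes>\<^bsub>?G\<^esub> a i \<otimes>\<^bsub>?G\<^esub> x = T (h j) (T (h i) x)"
        using G.m_assoc[of "a j" "a i" x] mult_a1(1)[OF i] mult_a1(1)[OF j]
        by (simp del: translation_group_simps(2))
      also have "\<dots> = T (h i) (T (h j) x)" by (rule T_commute[OF hD(1)[OF i] hD(1)[OF j]])
      finally have "a j \<otimes>\<^bsub>?G\<^esub> a i \<otimes>\<^bsub>?G\<^esub> x = T (h i) (T (h j) x)" .
      moreover have "h i \<noteq> h j" "h i \<noteq> - h j" using \<sigma>_ne[OF i j ne, of 1 1] by (auto simp: \<sigma>_def)
      ultimately show "d x (a i \<otimes>\<^bsub>?G\<^esub> x) = d (a j \<otimes>\<^bsub>?G\<^esub> x) (a j \<otimes>\<^bsub>?G\<^esub> a i \<otimes>\<^bsub>?G\<^esub> x)"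
        using d_translate[OF hD(1)[OF j] hD(1)[OF i]] unfolding mult_a1[OF i] mult_a1[OF j] by metis
    next
      show "betti1 p d = m" by (simp add: m_def)
    qed
  next
    case 2
    then obtain G :: "'v monoid" and m a where G: "comm_group G" "carrier G = UNIV"
      and supp': "\<forall>x y. x \<noteq> y \<longrightarrow> (0 < p x y \<longleftrightarrow>
           y \<in> {(a i [^]\<^bsub>G\<^esub> e) \<otimes>\<^bsub>G\<^esub> x | i (e::int). i \<in> {1..m} \<and> e \<in> {-1, 1}})"
      and drift: "\<forall>i\<in>{1..m}. \<exists>c::real. \<forall>x. p x (a i \<otimes>\<^bsub>G\<^esub> x) * d x (a i \<otimes>\<^bsub>G\<^esub> x)
          - p x (inv\<^bsub>G\<^esub> (a i) \<otimes>\<^bsub>G\<^esub> x) * d x (inv\<^bsub>G\<^esub> (a i) \<otimes>\<^bsub>G\<^esub> x) = c"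
      and p_inv': "\<forall>x. \<forall>i\<in>{1..m}. \<forall>j\<in>{1..m}. i \<noteq> j \<longrightarrow> (\<forall>e1\<in>{-1, 1::int}. \<forall>e2\<in>{-1, 1::int}.
             p x ((a i [^]\<^bsub>G\<^esub> e1) \<otimes>\<^bsub>G\<^esub> x)
             = p ((a j [^]\<^bsub>G\<^esub> e2) \<otimes>\<^bsub>G\<^esub> x) ((a i [^]\<^bsub>G\<^esub> e1) \<otimes>\<^bsub>G\<^esub> (a j [^]\<^bsub>G\<^esub> e2) \<otimes>\<^bsub>G\<^esub> x))"
      and d_inv': "\<forall>x. \<forall>i\<in>{1..m}. \<forall>j\<in>{1..m}. i \<noteq> j \<longrightarrow>
          d x (a i \<otimes>\<^bsub>G\<^esub> x) = d (a j \<otimes>\<^bsub>G\<^esub> x) (a j \<otimes>\<^bsub>G\<^esub> a i \<otimes>\<^bsub>G\<^esub> x)"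
      and betti: "betti1 p d = m"
      by (elim exE conjE) (rule that)
    have supp: "0 < p x y \<longleftrightarrow> (\<exists>i e. y = (a i [^]\<^bsub>G\<^esub> (e::int)) \<otimes>\<^bsub>G\<^esub> x \<and> i \<in> {1..m} \<and> e \<in> {-1, 1})"
      if "x \<noteq> y" for x y using supp' that by blast
    have p_inv: "p x ((a i [^]\<^bsub>G\<^esub> e1) \<otimes>\<^bsub>G\<^esub> x)
        = p ((a j [^]\<^bsub>G\<^esub> e2) \<otimes>\<^bsub>G\<^esub> x) ((a i [^]\<^bsub>G\<^esub> e1) \<otimes>\<^bsub>G\<^esub> (a j [^]\<^bsub>G\<^esub> e2) \<otimes>\<^bsub>G\<^esub> x)"
      if "i \<in> {1..m}" "j \<in> {1..m}" "i \<noteq> j" "e1 \<in> {-1, 1}" "e2 \<in> {-1, 1}" for x i j and e1 e2 :: int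
      using p_inv' that by blast
    have d_inv: "d x (a i \<otimes>\<^bsub>G\<^esub> x) = d (a j \<otimes>\<^bsub>G\<^esub> x) (a j \<otimes>\<^bsub>G\<^esub> a i \<otimes>\<^bsub>G\<^esub> x)"
      if "i \<in> {1..m}" "j \<in> {1..m}" "i \<noteq> j" for x i j
      using d_inv' that by blast
    interpret G: comm_group G by (rule G(1))
    have [simp]: "x \<in> carrier G" for x using G(2) by simp
    have pow: "a i [^]\<^bsub>G\<^esub> (1::int) = a i" "a i [^]\<^bsub>G\<^esub> (-1::int) = inv\<^bsub>G\<^esub> (a i)" for i
      using G.int_pow_neg[of "a i" 1] G.int_pow_1[of "a i"] by auto
    define A where "A = (\<Union>i\<in>{1..m}. (\<lambda>e::int. a i [^]\<^bsub>G\<^esub> e) ` {-1, 1})"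
    have A: "0 < p x y \<longleftrightarrow> (\<exists>t\<in>A. y = t \<otimes>\<^bsub>G\<^esub> x)" if "x \<noteq> y" for x y
      unfolding supp[OF that] A_def by blast
    \<comment> \<open>Only an upper bound: a generator of order two would be counted once in A. The
      reverse inequality for the degree comes from \<open>twice_betti1_le_vdeg\<close> once
      curvature is known to be nonnegative.\<close>
    have cA: "card A \<le> 2 * m"
    proof -
      have "card A \<le> (\<Sum>i\<in>{1..m}. card ((\<lambda>e::int. a i [^]\<^bsub>G\<^esub> e) ` {-1, 1}))"
        unfolding A_def by (rule card_UN_le) simp
      also have "\<dots> \<le> (\<Sum>i\<in>{1..m}. card {-1, 1::int})" by (intro sum_mono card_image_le) simp
      finally show ?thesis by simp
    qed
    \<comment> \<open>Condition (d) speaks of the generators only. For the inverse of a j it is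
      applied at the translated point t x.\<close>
    have d1: "d (t \<otimes>\<^bsub>G\<^esub> x) (t \<otimes>\<^bsub>G\<^esub> (a i \<otimes>\<^bsub>G\<^esub> x)) = d x (a i \<otimes>\<^bsub>G\<^esub> x)"
      if "i \<in> {1..m}" "j \<in> {1..m}" "i \<noteq> j" "t = a j \<or> t = inv\<^bsub>G\<^esub> (a j)" for i j t x
    proof (cases "t = a j")
      case True
      then show ?thesis using d_inv[OF that(1-3), of x] by (simp add: G.m_assoc)
    next
      case False
      then have t: "t = inv\<^bsub>G\<^esub> (a j)" using that by blast
      have "a j \<otimes>\<^bsub>G\<^esub> (t \<otimes>\<^bsub>G\<^esub> x) = x" unfolding t by (simp add: G.m_assoc[symmetric])
      moreover have "a j \<otimes>\<^bsub>G\<^esub> a i \<otimes>\<^bsub>G\<^esub> (t \<otimes>\<^bsub>G\<^esub> x) = a i \<otimes>\<^bsub>G\<^esub> x"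
        using calculation by (metis G.m_assoc G.m_comm \<open>\<And>x. x \<in> carrier G\<close>)
      moreover have "a i \<otimes>\<^bsub>G\<^esub> (t \<otimes>\<^bsub>G\<^esub> x) = t \<otimes>\<^bsub>G\<^esub> (a i \<otimes>\<^bsub>G\<^esub> x)" by (simp add: G.m_lcomm)
      ultimately show ?thesis using d_inv[OF that(1-3), of "t \<otimes>\<^bsub>G\<^esub> x"] by simp
    qed
    \<comment> \<open>For the inverse of a i the same edge is read from its other end.\<close>
    have d2: "d (t \<otimes>\<^bsub>G\<^esub> x) (t \<otimes>\<^bsub>G\<^esub> (s \<otimes>\<^bsub>G\<^esub> x)) = d x (s \<otimes>\<^bsub>G\<^esub> x)"
      if "i \<in> {1..m}" "j \<in> {1..m}" "i \<noteq> j" "t = a j \<or> t = inv\<^bsub>G\<^esub> (a j)" "s = a i \<or> s = inv\<^bsub>G\<^esub> (a i)" for i j s t x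
    proof (cases "s = a i")
      case True
      then show ?thesis using d1[OF that(1-4)] by simp
    next
      case False
      then have "s = inv\<^bsub>G\<^esub> (a i)" using that by blast
      then have "a i \<otimes>\<^bsub>G\<^esub> (s \<otimes>\<^bsub>G\<^esub> x) = x" by (simp add: G.m_assoc[symmetric])
      then show ?thesis using d1[OF that(1-4), of "s \<otimes>\<^bsub>G\<^esub> x"] d_sym by metis
    qed
    have nonneg: "nonneg_ollivier_curvature p d"
      unfolding nonneg_ollivier_curvature_def
    proof (intro allI impI)
      fix x y assume "adj p x y"
      then have xy: "x \<noteq> y" "0 < p x y" by (auto simp: adj_def)
      then obtain i e where ie: "i \<in> {1..m}" "e \<in> {-1, 1::int}" "y = (a i [^]\<^bsub>G\<^esub> e) \<otimes>\<^bsub>G\<^esub> x"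
        using supp by auto
      define s where "s = a i [^]\<^bsub>G\<^esub> e"
      have s: "s = a i \<and> inv\<^bsub>G\<^esub> s = a i [^]\<^bsub>G\<^esub> (-1::int) \<or> s = inv\<^bsub>G\<^esub> (a i) \<and> inv\<^bsub>G\<^esub> s = a i [^]\<^bsub>G\<^esub> (1::int)"
        using ie(2) pow unfolding s_def by auto
      have sA: "s \<in> A" using ie unfolding A_def s_def by auto
      have "inv\<^bsub>G\<^esub> s \<in> A" using s ie(1) unfolding A_def by auto
      obtain c where c: "\<And>x. p x (a i \<otimes>\<^bsub>G\<^esub> x) * d x (a i \<otimes>\<^bsub>G\<^esub> x)
          - p x (inv\<^bsub>G\<^esub> (a i) \<otimes>\<^bsub>G\<^esub> x) * d x (inv\<^bsub>G\<^esub> (a i) \<otimes>\<^bsub>G\<^esub> x) = c" using drift ie(1) by blast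
      \<comment> \<open>Passing from a generator to its inverse reverses the sign of the
        drift.\<close>
      define k where "k = (if s = a i then c else - c)"
      have k: "p x (s \<otimes>\<^bsub>G\<^esub> x) * d x (s \<otimes>\<^bsub>G\<^esub> x) - p x (inv\<^bsub>G\<^esub> s \<otimes>\<^bsub>G\<^esub> x) * d x (inv\<^bsub>G\<^esub> s \<otimes>\<^bsub>G\<^esub> x) = k" for x
      proof (cases "s = a i")
        case True
        then show ?thesis using c[of x] by (simp add: k_def)
      next
        case False
        then have "s = inv\<^bsub>G\<^esub> (a i)" "inv\<^bsub>G\<^esub> s = a i" using s pow by auto
        then show ?thesis using c[of x] False unfolding k_def by auto
      qed
      have other: "p x (t \<otimes>\<^bsub>G\<^esub> x) = p (s \<otimes>\<^bsub>G\<^esub> x) (t \<otimes>\<^bsub>G\<^esub> (s \<otimes>\<^bsub>G\<^esub> x)) \<and>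
          d (t \<otimes>\<^bsub>G\<^esub> x) (t \<otimes>\<^bsub>G\<^esub> (s \<otimes>\<^bsub>G\<^esub> x)) = d x (s \<otimes>\<^bsub>G\<^esub> x)"
        if t: "t \<in> A" "t \<noteq> s" "t \<noteq> inv\<^bsub>G\<^esub> s" for t x
      proof -
        obtain j e' where j: "j \<in> {1..m}" "e' \<in> {-1, 1::int}" "t = a j [^]\<^bsub>G\<^esub> e'"
          using t(1) unfolding A_def by blast
        have t': "t = a j \<or> t = inv\<^bsub>G\<^esub> (a j)" using j pow by auto
        have "i \<noteq> j" using t t' s pow by auto
        moreover have "p x (t \<otimes>\<^bsub>G\<^esub> x) = p (s \<otimes>\<^bsub>G\<^esub> x) (t \<otimes>\<^bsub>G\<^esub> s \<otimes>\<^bsub>G\<^esub> x)"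
          using p_inv[OF j(1) ie(1) _ j(2) ie(2), of x] calculation unfolding s_def j(3) by blast
        moreover have "s = a i \<or> s = inv\<^bsub>G\<^esub> (a i)" using s by blast
        ultimately show ?thesis using d2[OF ie(1) j(1) _ t', of s x] by (simp add: G.m_assoc)
      qed
      show "0 \<le> ollivier_curvature p d x y"
        unfolding curvature_nonneg_iff[OF xy(1)]
      proof (intro allI impI)
        fix f assume f: "lip f" "f y - f x = d x y"
        show "laplacian p f y \<le> laplacian p f x"
          using laplacian_mono_translation[OF G A sA \<open>inv\<^bsub>G\<^esub> s \<in> A\<close> k other f(1), of x] f(2)
          unfolding ie(3) s_def[symmetric] by blast
      qed
    qed
    then interpret nonneg_curved_chain p d by unfold_locales
    have "vdeg p x \<le> 2 * m" for x
    proof -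
      have "{y. adj p x y} \<subseteq> (\<lambda>t. t \<otimes>\<^bsub>G\<^esub> x) ` A" using A by (auto simp: adj_def)
      then have "card {y. adj p x y} \<le> card A"
        by (meson card_image_le card_mono finite finite_imageI order_trans)
      then show ?thesis using cA vdeg_eq by simp
    qed
    then have "deg_max p \<le> 2 * m" unfolding deg_max_def by (subst Max_le_iff) auto
    moreover have "2 * m \<le> deg_max p"
      using twice_betti1_le_vdeg vdeg_le_deg_max betti order_trans by blast
    ultimately show ?case using nonneg betti by simp
  qed
qed

end
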